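(* If the Min-Degree Group Steiner Tree problem admits a polynomial-time approximation algorithm with approximation ratio $\rho$, then the Min-Degree Steiner $k$-Tree problem admits a polynomial-time approximation algorithm with approximation ratio $\rho\cdot O(\log k)$. *)

theory Defs
  imports
    Complex_Main
    "HOL-Library.Landau_Symbols"
    "HOL-Computational_Algebra.Polynomial"
begin

section \<open>Polynomial-time computation\<close>

text \<open>
  The machine model is Neil Jones' WHILE language: deterministic imperative programs whose
  variables hold binary trees. Evaluating an expression is charged the total size of all trees
  occurring as values of its subexpressions, so that a run of cost \<open>t\<close> on an input of size \<open>n\<close>
  never handles a tree of size above \<open>n + t\<close> (copying a tree is not free). Under this cost measure
  the model and deterministic Turing machines simulate each other with polynomial overhead.
\<close>

datatype data = Nl | Pr data data

primrec dsize :: "data \<Rightarrow> nat" where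
  "dsize Nl = 1"
| "dsize (Pr a b) = Suc (dsize a + dsize b)"

primrec dfst :: "data \<Rightarrow> data" where
  "dfst Nl = Nl"
| "dfst (Pr a b) = a"

primrec dsnd :: "data \<Rightarrow> data" where
  "dsnd Nl = Nl"
| "dsnd (Pr a b) = b"

datatype exp = Var nat | Const data | Mk exp exp | Fst exp | Snd exp | Eq exp exp

type_synonym state = "nat \<Rightarrow> data"

primrec evl :: "exp \<Rightarrow> state \<Rightarrow> data" where
  "evl (Var v) s = s v"
| "evl (Const d) s = d"
| "evl (Mk e1 e2) s = Pr (evl e1 s) (evl e2 s)"
| "evl (Fst e) s = dfst (evl e s)"
| "evl (Snd e) s = dsnd (evl e s)"
| "evl (Eq e1 e2) s = (if evl e1 s = evl e2 s then Pr Nl Nl else Nl)"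

primrec ecost :: "exp \<Rightarrow> state \<Rightarrow> nat" where
  "ecost (Var v) s = dsize (s v)"
| "ecost (Const d) s = dsize d"
| "ecost (Mk e1 e2) s = ecost e1 s + ecost e2 s + dsize (evl (Mk e1 e2) s)"
| "ecost (Fst e) s = ecost e s + dsize (evl (Fst e) s)"
| "ecost (Snd e) s = ecost e s + dsize (evl (Snd e) s)"
| "ecost (Eq e1 e2) s = ecost e1 s + ecost e2 s + dsize (evl (Eq e1 e2) s)"

datatype com =
    Skip
  | Assign nat exp
  | Seq com com
  | If exp com com
  | While exp com

text \<open>\<open>exec c s t s'\<close>: program \<open>c\<close>, started in state \<open>s\<close>, halts in state \<open>s'\<close> at cost \<open>t\<close>.
  A test succeeds iff its value is not \<open>Nl\<close>.\<close>

inductive exec :: "com \<Rightarrow> state \<Rightarrow> nat \<Rightarrow> state \<Rightarrow> bool" where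
  Skip: "exec Skip s 1 s"
| Assign: "exec (Assign v e) s (1 + ecost e s) (s(v := evl e s))"
| Seq: "exec c1 s t1 s' \<Longrightarrow> exec c2 s' t2 s'' \<Longrightarrow> exec (Seq c1 c2) s (t1 + t2) s''"
| IfTrue: "evl e s \<noteq> Nl \<Longrightarrow> exec c1 s t s' \<Longrightarrow> exec (If e c1 c2) s (1 + ecost e s + t) s'"
| IfFalse: "evl e s = Nl \<Longrightarrow> exec c2 s t s' \<Longrightarrow> exec (If e c1 c2) s (1 + ecost e s + t) s'"
| WhileFalse: "evl e s = Nl \<Longrightarrow> exec (While e c) s (1 + ecost e s) s"
| WhileTrue: "evl e s \<noteq> Nl \<Longrightarrow> exec c s t1 s' \<Longrightarrow> exec (While e c) s' t2 s'' \<Longrightarrow>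
    exec (While e c) s (1 + ecost e s + t1 + t2) s''"

inductive_cases exec_SkipE: "exec Skip s t s'"
inductive_cases exec_AssignE: "exec (Assign v e) s t s'"
inductive_cases exec_SeqE: "exec (Seq c1 c2) s t s'"
inductive_cases exec_IfE: "exec (If e c1 c2) s t s'"
inductive_cases exec_WhileE: "exec (While e c) s t s'"

lemma exec_deterministic:
  "exec c s t s' \<Longrightarrow> exec c s u s'' \<Longrightarrow> u = t \<and> s'' = s'"
proof (induction arbitrary: u s'' rule: exec.induct)
  case (Skip s)
  then show ?case by (auto elim: exec_SkipE)
next
  case (Assign v e s)
  then show ?case by (auto elim: exec_AssignE)
next
  case (Seq c1 s t1 s' c2 t2 s'')
  from Seq.prems show ?case by (rule exec_SeqE) (use Seq.IH in metis)
next
  case (IfTrue e s c1 t s' c2)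
  from IfTrue.prems show ?case by (rule exec_IfE) (use IfTrue.IH IfTrue.hyps in \<open>metis plus_1_eq_Suc add_Suc\<close>)+
next
  case (IfFalse e s c2 t s' c1)
  from IfFalse.prems show ?case by (rule exec_IfE) (use IfFalse.IH IfFalse.hyps in \<open>metis plus_1_eq_Suc add_Suc\<close>)+
next
  case (WhileFalse e s c)
  from WhileFalse.prems show ?case by (rule exec_WhileE) (use WhileFalse.hyps in \<open>metis plus_1_eq_Suc add_Suc\<close>)+
next
  case (WhileTrue e s c t1 s' t2 s'')
  from WhileTrue.prems show ?case by (rule exec_WhileE) (use WhileTrue.IH WhileTrue.hyps in \<open>metis plus_1_eq_Suc add_Suc\<close>)+
qed

text \<open>Input and output are held by variable 0; all other variables are initially \<open>Nl\<close>.\<close>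

definition computes :: "com \<Rightarrow> data \<Rightarrow> nat \<Rightarrow> data \<Rightarrow> bool" where
  "computes c x t y \<longleftrightarrow> (\<exists>s'. exec c ((\<lambda>_. Nl)(0 := x)) t s' \<and> s' 0 = y)"

section \<open>Minimization problems and approximation algorithms\<close>

text \<open>\<open>in_rep P x i\<close> says that \<open>x\<close> is a representation of the instance \<open>i\<close>. An object may have several
  representations (a set is given by a list of its elements in any order), and an algorithm has
  to work for all of them.\<close>

record ('i, 's) min_problem =
  inst :: "'i \<Rightarrow> bool"
  in_rep :: "data \<Rightarrow> 'i \<Rightarrow> bool"
  feas :: "'i \<Rightarrow> 's set"
  out_rep :: "data \<Rightarrow> 's \<Rightarrow> bool"
  cost :: "'s \<Rightarrow> nat"

definition opt :: "('i, 's) min_problem \<Rightarrow> 'i \<Rightarrow> nat" where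
  "opt P i = (INF s \<in> feas P i. cost P s)"

definition approx_alg :: "('i, 's) min_problem \<Rightarrow> ('i \<Rightarrow> real) \<Rightarrow> com \<Rightarrow> bool" where
  "approx_alg P r c \<longleftrightarrow>
    (\<exists>p :: nat poly. \<forall>i x. inst P i \<longrightarrow> in_rep P x i \<longrightarrow>
      (\<exists>t y. computes c x t y \<and> t \<le> poly p (dsize x) \<and>
        (feas P i \<noteq> {} \<longrightarrow>
          (\<exists>s \<in> feas P i. out_rep P y s \<and> real (cost P s) \<le> r i * real (opt P i)))))"

definition poly_time_approximable :: "('i, 's) min_problem \<Rightarrow> ('i \<Rightarrow> real) \<Rightarrow> bool" where
  "poly_time_approximable P r \<longleftrightarrow> (\<exists>c. approx_alg P r c)"

section \<open>Graphs and trees\<close>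

type_synonym graph = "nat set \<times> nat set set"

definition simple_graph :: "graph \<Rightarrow> bool" where
  "simple_graph = (\<lambda>(V, E). finite V \<and> E \<subseteq> {{u, v} | u v. u \<in> V \<and> v \<in> V \<and> u \<noteq> v})"

definition connected_graph :: "graph \<Rightarrow> bool" where
  "connected_graph = (\<lambda>(V, E). V \<noteq> {} \<and> (\<forall>u \<in> V. \<forall>v \<in> V. (u, v) \<in> {(x, y). {x, y} \<in> E}\<^sup>*))"

definition is_cycle :: "nat set set \<Rightarrow> nat list \<Rightarrow> bool" where
  "is_cycle E p \<longleftrightarrow> 3 \<le> length p \<and> distinct p \<and>
    (\<forall>j < length p. {p ! j, p ! (Suc j mod length p)} \<in> E)"

definition is_tree :: "graph \<Rightarrow> bool" where
  "is_tree T \<longleftrightarrow> simple_graph T \<and> connected_graph T \<and> (\<nexists>p. is_cycle (snd T) p)"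

definition subtrees :: "graph \<Rightarrow> graph set" where
  "subtrees G = {T. is_tree T \<and> fst T \<subseteq> fst G \<and> snd T \<subseteq> snd G}"

definition max_degree :: "graph \<Rightarrow> nat" where
  "max_degree = (\<lambda>(V, E). Max ((\<lambda>v. card {e \<in> E. v \<in> e}) ` V))"

section \<open>Representations\<close>

text \<open>Little-endian binary notation.\<close>

fun enc_nat :: "nat \<Rightarrow> data" where
  "enc_nat 0 = Nl"
| "enc_nat (Suc n) = Pr (if odd (Suc n) then Pr Nl Nl else Nl) (enc_nat (Suc n div 2))"

primrec enc_list :: "data list \<Rightarrow> data" where
  "enc_list [] = Nl"
| "enc_list (x # xs) = Pr x (enc_list xs)"

definition rep_nat :: "data \<Rightarrow> nat \<Rightarrow> bool" where
  "rep_nat x n \<longleftrightarrow> x = enc_nat n"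

definition rep_set :: "(data \<Rightarrow> 'a \<Rightarrow> bool) \<Rightarrow> data \<Rightarrow> 'a set \<Rightarrow> bool" where
  "rep_set R x A \<longleftrightarrow> (\<exists>ds as. x = enc_list ds \<and> list_all2 R ds as \<and> set as = A)"

definition rep_edge :: "data \<Rightarrow> nat set \<Rightarrow> bool" where
  "rep_edge x e \<longleftrightarrow> (\<exists>u v. x = Pr (enc_nat u) (enc_nat v) \<and> e = {u, v})"

definition rep_graph :: "data \<Rightarrow> graph \<Rightarrow> bool" where
  "rep_graph x G \<longleftrightarrow> (\<exists>a b. x = Pr a b \<and> rep_set rep_nat a (fst G) \<and> rep_set rep_edge b (snd G))"

section \<open>The two problems\<close>

definition group_steiner_tree :: "(graph \<times> nat set set, graph) min_problem" where
  "group_steiner_tree = \<lparr>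
    inst = (\<lambda>(G, \<S>). simple_graph G \<and> finite \<S> \<and> (\<forall>S \<in> \<S>. S \<subseteq> fst G)),
    in_rep = (\<lambda>x (G, \<S>). \<exists>a b. x = Pr a b \<and> rep_graph a G \<and> rep_set (rep_set rep_nat) b \<S>),
    feas = (\<lambda>(G, \<S>). {T \<in> subtrees G. \<forall>S \<in> \<S>. fst T \<inter> S \<noteq> {}}),
    out_rep = rep_graph,
    cost = max_degree \<rparr>"

definition steiner_k_tree :: "(graph \<times> nat set \<times> nat, graph) min_problem" where
  "steiner_k_tree = \<lparr>
    inst = (\<lambda>(G, S, k). simple_graph G \<and> S \<subseteq> fst G \<and> 1 \<le> k),
    in_rep = (\<lambda>x (G, S, k). \<exists>a b c. x = Pr a (Pr b c) \<and>
      rep_graph a G \<and> rep_set rep_nat b S \<and> rep_nat c k),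
    feas = (\<lambda>(G, S, k). {T \<in> subtrees G. k \<le> card (fst T \<inter> S)}),
    out_rep = rep_graph,
    cost = max_degree \<rparr>"

end

theory Submission
  imports Defs "HOL-Number_Theory.Cong"
begin

text \<open>
  Let \<open>T\<close> be an optimal tree and \<open>r\<close> one of its vertices (all vertices are tried). Each round calls the
  group Steiner tree algorithm on the same graph with the group \<open>{r}\<close> and a family of groups of
  terminals that is hit by \<open>T\<close>, but such that every set hitting the family contains at least \<open>k' / 272\<close>
  terminals, where \<open>k'\<close> is the number of terminals still missing. The trees found all contain \<open>r\<close> and have
  degree at most \<open>\<rho>\<close> times the optimum; \<open>O(log k)\<close> rounds suffice, and a spanning tree of their union is
  the solution.

  Since \<open>T\<close> is unknown, polynomially many families are enumerated, one of which suits \<open>T\<close>; the output of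
  a wrong family is harmless, because only the edges of \<open>G\<close> reachable from \<open>r\<close> are kept and the terminals
  in the resulting tree are counted. To construct the families, terminals are hashed into cells indexed by
  \<open>v \<in> F\<^sub>q\<^sup>r\<close> by a pairwise independent function such that most cells contain a terminal of \<open>T\<close>. Translates
  \<open>v + C\<close> of a cube \<open>C\<close> of logarithmic size form the blocks, and the groups are the unions of at least
  seven eighths of the cells of a block. The generators of \<open>C\<close> are sums of vectors
  \<open>a * (1, x, \<dots>, x ^ (r - 1))\<close>. Averaging along the lines in these directions gives commuting projections,
  any \<open>r\<close> of which compose to the mean, so that translations by such sums are nearly uncorrelated, and
  some choice among polynomially many makes all blocks contain many cells hit by \<open>T\<close>.
\<close>

section \<open>Polynomial-time functions\<close>

text \<open>The groups must be hit by a tree that is unknown, and no random choice is available, so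
  everything hinges on a short list of families. A union of seven eighths of a block tolerates cells
  that \<open>T\<close> misses, and a set that hits all such unions meets more than an eighth of the
  block. Listing the unions takes \<open>2 ^ len\<close> groups for a block of \<open>len\<close>
  cells, so \<open>len\<close> must be O(log n); yet not one of the polynomially many blocks may be
  bad.

  Doubling a cube by arbitrary translations would leave polynomially many choices for each of about
  log log n doublings, hence more than polynomially many cubes. Over a field of polylogarithmic
  size, one line vector costs only O(log log n) bits and shrinks the correlation error by a
  logarithmic factor. Doubling \<open>i\<close> tolerates an error of about
  \<open>(1/4) ^ 2 ^ i\<close>, so the numbers of line vectors form a geometric series with sum
  O(log n / log log n), and all choices together take O(log n) bits.

  The constant 272 is \<open>(8 * 2) * 17\<close>: one eighth of the cells, fibres of the hash up to
  twice the average, and windows sized for 16 expected hits and then rounded up.\<close>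

lemma poly_mono_nat: "x \<le> y \<Longrightarrow> poly p x \<le> poly p (y::nat)" for p :: "nat poly"
  by (induction p) (auto intro!: add_mono mult_mono)

section \<open>Runs within a cost bound, and the variables a program leaves alone\<close>

definition runs :: "com \<Rightarrow> state \<Rightarrow> nat \<Rightarrow> state \<Rightarrow> bool" where
  "runs c s b s' \<longleftrightarrow> (\<exists>t\<le>b. exec c s t s')"

lemma runs_mono: "runs c s b s' \<Longrightarrow> b \<le> b' \<Longrightarrow> runs c s b' s'"
  unfolding runs_def by (meson le_trans)

lemma runs_Seq: "runs c1 s b1 s1 \<Longrightarrow> runs c2 s1 b2 s2 \<Longrightarrow> runs (Seq c1 c2) s (b1 + b2) s2"
  unfolding runs_def by (meson Seq add_mono)

lemma runs_Assign: "1 + ecost e s \<le> b \<Longrightarrow> s' = s(v := evl e s) \<Longrightarrow> runs (Assign v e) s b s'"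
  unfolding runs_def using Assign by blast

lemma runs_If_True: "evl e s \<noteq> Nl \<Longrightarrow> runs c1 s b s' \<Longrightarrow> runs (If e c1 c2) s (1 + ecost e s + b) s'"
  unfolding runs_def by (meson IfTrue add_left_mono)

lemma runs_If_False: "evl e s = Nl \<Longrightarrow> runs c2 s b s' \<Longrightarrow> runs (If e c1 c2) s (1 + ecost e s + b) s'"
  unfolding runs_def by (meson IfFalse add_left_mono)

lemma runs_While_False: "evl e s = Nl \<Longrightarrow> runs (While e c) s (1 + ecost e s) s"
  unfolding runs_def by (meson WhileFalse order_refl)

lemma runs_While_True: "evl e s \<noteq> Nl \<Longrightarrow> runs c s b1 s' \<Longrightarrow> runs (While e c) s' b2 s'' \<Longrightarrow>
    runs (While e c) s (1 + ecost e s + b1 + b2) s''"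
  unfolding runs_def by (meson WhileTrue add_mono order_refl)

primrec exp_bound :: "exp \<Rightarrow> nat" where
  "exp_bound (Var v) = Suc v"
| "exp_bound (Const d) = 0"
| "exp_bound (Mk e1 e2) = max (exp_bound e1) (exp_bound e2)"
| "exp_bound (Fst e) = exp_bound e"
| "exp_bound (Snd e) = exp_bound e"
| "exp_bound (Eq e1 e2) = max (exp_bound e1) (exp_bound e2)"

primrec com_bound :: "com \<Rightarrow> nat" where
  "com_bound Skip = 0"
| "com_bound (Assign v e) = max (Suc v) (exp_bound e)"
| "com_bound (Seq c1 c2) = max (com_bound c1) (com_bound c2)"
| "com_bound (If e c1 c2) = max (exp_bound e) (max (com_bound c1) (com_bound c2))"
| "com_bound (While e c) = max (exp_bound e) (com_bound c)"

lemma exp_frame: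
  "exp_bound e \<le> m \<Longrightarrow> (\<And>v. v < m \<Longrightarrow> u v = s v) \<Longrightarrow> evl e u = evl e s \<and> ecost e u = ecost e s"
  by (induction e) auto

text \<open>Values parked in variables at or above \<open>com_bound c\<close> survive a run of
  \<open>c\<close>. This is how programs are combined into pairs and loops.\<close>

lemma exec_frame:
  "exec c s t s' \<Longrightarrow> com_bound c \<le> m \<Longrightarrow> (\<And>v. v < m \<Longrightarrow> u v = s v) \<Longrightarrow>
    exec c u t (\<lambda>v. if v < m then s' v else u v)"
proof (induction arbitrary: u rule: exec.induct)
  case (Skip s)
  then have "(\<lambda>v. if v < m then s v else u v) = u" by auto
  then show ?case by (metis exec.Skip)
next
  case (Assign v e s)
  have e: "evl e u = evl e s" "ecost e u = ecost e s" using exp_frame[of e m u s] Assign by auto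
  have "(\<lambda>w. if w < m then (s(v := evl e s)) w else u w) = u(v := evl e u)"
    using Assign e by auto
  then show ?case using exec.Assign[of v e u] e by simp
next
  case (Seq c1 s t1 s' c2 t2 s'')
  have 1: "exec c1 u t1 (\<lambda>v. if v < m then s' v else u v)" using Seq by simp
  have "exec c2 (\<lambda>v. if v < m then s' v else u v) t2
     (\<lambda>v. if v < m then s'' v else (if v < m then s' v else u v))" using Seq by simp
  then have "exec c2 (\<lambda>v. if v < m then s' v else u v) t2 (\<lambda>v. if v < m then s'' v else u v)"
    by (simp cong: if_cong)
  with 1 show ?case by (rule exec.Seq)
next
  case (IfTrue e s c1 t s' c2)
  have e: "evl e u = evl e s" "ecost e u = ecost e s" using exp_frame[of e m u s] IfTrue by auto
  show ?case using exec.IfTrue[of e u c1 t _ c2] IfTrue e by simp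
next
  case (IfFalse e s c2 t s' c1)
  have e: "evl e u = evl e s" "ecost e u = ecost e s" using exp_frame[of e m u s] IfFalse by auto
  show ?case using exec.IfFalse[of e u c2 t _ c1] IfFalse e by simp
next
  case (WhileFalse e s c)
  have e: "evl e u = evl e s" "ecost e u = ecost e s" using exp_frame[of e m u s] WhileFalse by auto
  have "(\<lambda>v. if v < m then s v else u v) = u" using WhileFalse by auto
  then show ?case using exec.WhileFalse[of e u c] WhileFalse e by simp
next
  case (WhileTrue e s c t1 s' t2 s'')
  have e: "evl e u = evl e s" "ecost e u = ecost e s" using exp_frame[of e m u s] WhileTrue by auto
  have 1: "exec c u t1 (\<lambda>v. if v < m then s' v else u v)" using WhileTrue by simp
  have "exec (While e c) (\<lambda>v. if v < m then s' v else u v) t2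
     (\<lambda>v. if v < m then s'' v else (if v < m then s' v else u v))" using WhileTrue by simp
  then have "exec (While e c) (\<lambda>v. if v < m then s' v else u v) t2 (\<lambda>v. if v < m then s'' v else u v)"
    by (simp cong: if_cong)
  then show ?case using exec.WhileTrue[of e u c t1 _ t2] WhileTrue.hyps e 1 by simp
qed

lemma runs_frame:
  assumes "runs c s b s'" "com_bound c \<le> m" "\<And>v. v < m \<Longrightarrow> u v = s v"
    and "\<And>v. v < m \<Longrightarrow> u' v = s' v" "\<And>v. v \<ge> m \<Longrightarrow> u' v = u v"
  shows "runs c u b u'"
proof -
  obtain t where t: "t \<le> b" "exec c s t s'" using assms(1) unfolding runs_def by blast
  have "(\<lambda>v. if v < m then s' v else u v) = u'" using assms(4,5) by (auto simp: fun_eq_iff)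
  then show ?thesis using exec_frame[OF t(2) assms(2,3)] t(1) unfolding runs_def by auto
qed

lemma exec_unused:
  "exec c s t s' \<Longrightarrow> com_bound c \<le> v \<Longrightarrow> s' v = s v"
  by (induction rule: exec.induct) auto

lemma dsize_evl_le_ecost: "dsize (evl e s) \<le> ecost e s"
  by (induction e) auto

text \<open>A variable changes only by an assignment, which is charged at least the size of the new
  value. Hence outputs of polynomial-time programs are polynomially long.\<close>

lemma exec_size: "exec c s t s' \<Longrightarrow> dsize (s' v) \<le> dsize (s v) + t"
proof (induction rule: exec.induct)
  case (Assign w e s)
  then show ?case using dsize_evl_le_ecost[of e s] by auto
qed auto

lemma dsize_pos [simp]: "0 < dsize d"
  by (cases d) auto

lemma dsize_ge_1 [simp]: "Suc 0 \<le> dsize d"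
  by (cases d) auto

definition st :: "data \<Rightarrow> state" where
  "st x = (\<lambda>_. Nl)(0 := x)"

lemma st_simps [simp]: "st x 0 = x" "v \<noteq> 0 \<Longrightarrow> st x v = Nl" "(st x)(0 := y) = st y"
  by (auto simp: st_def)

section \<open>Values of various types encoded as trees\<close>

class encodable =
  fixes enc :: "'a \<Rightarrow> data"
  assumes enc_eqD: "enc x = enc y \<Longrightarrow> x = y"

lemma enc_eq_iff [simp]: "enc x = enc y \<longleftrightarrow> x = y"
  using enc_eqD by blast

abbreviation sz :: "'a::encodable \<Rightarrow> nat" where
  "sz x \<equiv> dsize (enc x)"

instantiation data :: encodable begin
definition enc_data_def [simp]: "enc (d::data) = d"
instance by standard simp
end

instantiation unit :: encodable begin
definition enc_unit_def [simp]: "enc (u::unit) = Nl"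
instance by standard simp
end

instantiation bool :: encodable begin
definition enc_bool_def: "enc b = (if b then Pr Nl Nl else Nl)"
instance by standard (auto simp: enc_bool_def split: if_splits)
end

instantiation prod :: (encodable, encodable) encodable begin
definition enc_prod_def [simp]: "enc p = Pr (enc (fst p)) (enc (snd p))"
instance by standard (auto simp: prod_eq_iff)
end

lemma enc_list_inject [simp]: "enc_list xs = enc_list ys \<longleftrightarrow> xs = ys"
proof (induction xs arbitrary: ys)
  case Nil then show ?case by (cases ys) auto
next
  case (Cons x xs) then show ?case by (cases ys) auto
qed

instantiation list :: (encodable) encodable begin
definition enc_list_def: "enc xs = enc_list (map enc xs)"
instance
proof
  fix xs ys :: "'a list"
  assume "enc xs = enc ys"
  then have "map enc xs = map enc ys" by (simp add: enc_list_def)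
  moreover have "inj (enc :: 'a \<Rightarrow> data)" by (simp add: inj_def)
  ultimately show "xs = ys" by (simp add: inj_map_eq_map)
qed
end

text \<open>Numbers computed internally are unary, unlike the binary notation of the problem input.
  Arithmetic becomes counting, and polynomial in the size means polynomial in the value.\<close>

instantiation nat :: encodable begin
definition enc_nat_def: "enc n = enc (replicate n ())"
instance
proof
  fix m n :: nat
  assume "enc m = enc n"
  then have "replicate m () = replicate n ()" by (simp add: enc_nat_def)
  then show "m = n" by (metis length_replicate)
qed
end

lemma enc_list_simps [simp]: "enc [] = Nl" "enc (x # xs) = Pr (enc x) (enc xs)"
  by (auto simp: enc_list_def)

lemma enc_nat_simps [simp]: "enc (0::nat) = Nl" "enc (Suc n) = Pr Nl (enc n)"
  by (auto simp: enc_nat_def)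

lemma enc_bool_simps [simp]: "enc True = Pr Nl Nl" "enc False = Nl"
  by (auto simp: enc_bool_def)

lemma sz_nat [simp]: "sz n = 2 * n + 1" for n :: nat
  by (induction n) auto

lemma length_le_sz: "2 * length xs + 1 \<le> sz xs"
proof (induction xs)
  case (Cons x xs)
  then show ?case by (cases "enc x") auto
qed simp

lemma sz_member: "x \<in> set xs \<Longrightarrow> sz x \<le> sz xs"
  by (induction xs) auto

lemma sz_list_le: "(\<And>x. x \<in> set xs \<Longrightarrow> sz x \<le> B) \<Longrightarrow> sz xs \<le> length xs * Suc B + 1"
proof (induction xs)
  case (Cons x xs)
  have "sz x \<le> B" "sz xs \<le> length xs * Suc B + 1" using Cons by auto
  then show ?case by simp
qed simp

lemma sz_append: "Suc (sz (xs @ ys)) = sz xs + sz ys"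
  by (induction xs) auto

lemma sz_rev: "sz (rev xs) = sz xs"
proof (induction xs)
  case (Cons x xs)
  then show ?case using sz_append[of "rev xs" "[x]"] by simp
qed simp

section \<open>Quantities bounded by a polynomial in the size of the code\<close>

definition pbd :: "'a::encodable set \<Rightarrow> ('a \<Rightarrow> nat) \<Rightarrow> bool" where
  "pbd A g \<longleftrightarrow> (\<exists>p. \<forall>a\<in>A. g a \<le> poly p (sz a))"

lemma pbdI: "(\<And>a. a \<in> A \<Longrightarrow> g a \<le> poly p (sz a)) \<Longrightarrow> pbd A g"
  unfolding pbd_def by blast

lemma pbd_mono: "pbd A h \<Longrightarrow> (\<And>a. a \<in> A \<Longrightarrow> g a \<le> h a) \<Longrightarrow> pbd A g"
  unfolding pbd_def by (meson le_trans)

lemma pbd_const: "pbd A (\<lambda>_. k)"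
  by (rule pbdI[of _ _ "[:k:]"]) simp

lemma pbd_sz: "pbd A (\<lambda>a. sz a)"
  by (rule pbdI[of _ _ "[:0, 1:]"]) simp

lemma pbd_add: "pbd A g \<Longrightarrow> pbd A h \<Longrightarrow> pbd A (\<lambda>a. g a + h a)"
proof -
  assume "pbd A g" "pbd A h"
  then obtain p q where "\<forall>a\<in>A. g a \<le> poly p (sz a)" "\<forall>a\<in>A. h a \<le> poly q (sz a)"
    unfolding pbd_def by blast
  then show ?thesis by (intro pbdI[of _ _ "p + q"]) (simp add: add_mono)
qed

lemma pbd_mult: "pbd A g \<Longrightarrow> pbd A h \<Longrightarrow> pbd A (\<lambda>a. g a * h a)"
proof -
  assume "pbd A g" "pbd A h"
  then obtain p q where "\<forall>a\<in>A. g a \<le> poly p (sz a)" "\<forall>a\<in>A. h a \<le> poly q (sz a)"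
    unfolding pbd_def by blast
  then show ?thesis by (intro pbdI[of _ _ "p * q"]) (simp add: mult_le_mono)
qed

lemma pbd_Suc: "pbd A g \<Longrightarrow> pbd A (\<lambda>a. Suc (g a))"
  using pbd_add[OF _ pbd_const, of A g 1] by simp

lemma pbd_poly: "pbd A g \<Longrightarrow> pbd A (\<lambda>a. poly p (g a))"
proof -
  assume "pbd A g"
  then obtain q where "\<forall>a\<in>A. g a \<le> poly q (sz a)"
    unfolding pbd_def by blast
  then show ?thesis by (intro pbdI[of _ _ "p \<circ>\<^sub>p q"]) (simp add: poly_pcompose poly_mono_nat)
qed

lemma pbd_comp: "pbd B h \<Longrightarrow> pbd A (\<lambda>a. sz (f a)) \<Longrightarrow> (\<And>a. a \<in> A \<Longrightarrow> f a \<in> B) \<Longrightarrow> pbd A (\<lambda>a. h (f a))"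
proof -
  assume h: "pbd B h" and f: "pbd A (\<lambda>a. sz (f a))" and B: "\<And>a. a \<in> A \<Longrightarrow> f a \<in> B"
  obtain p where p: "\<And>b. b \<in> B \<Longrightarrow> h b \<le> poly p (sz b)"
    using h unfolding pbd_def by blast
  show ?thesis by (rule pbd_mono[OF pbd_poly[OF f, of p]]) (rule p[OF B])
qed

lemma dsize_dfst_le: "dsize (dfst d) \<le> dsize d" and dsize_dsnd_le: "dsize (dsnd d) \<le> dsize d"
  by (cases d; simp)+

lemma pbd_ecost: "pbd UNIV (\<lambda>x::data. ecost e (st x))"
proof (induction e)
  case (Var v)
  show ?case
  proof (rule pbd_mono[where h = "\<lambda>x. sz x + 1"])
    show "pbd UNIV (\<lambda>x::data. sz x + 1)"
      by (intro pbd_add pbd_mult pbd_const pbd_sz )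
    show "ecost (Var v) (st x) \<le> sz x + 1" for x
      by (cases "v = 0") auto
  qed
next
  case (Const d)
  show ?case
  proof (rule pbd_mono[where h = "\<lambda>x. dsize d"])
    show "pbd UNIV (\<lambda>x::data. dsize d)"
      by (intro pbd_add pbd_mult pbd_const pbd_sz )
    show "ecost (Const d) (st x) \<le> dsize d" for x
      by simp
  qed
next
  case (Mk e1 e2)
  show ?case
  proof (rule pbd_mono[where h = "\<lambda>x. 2 * ecost e1 (st x) + 2 * ecost e2 (st x) + 1"])
    show "pbd UNIV (\<lambda>x::data. 2 * ecost e1 (st x) + 2 * ecost e2 (st x) + 1)"
      by (intro pbd_add pbd_mult pbd_const pbd_sz Mk)
    show "ecost (Mk e1 e2) (st x) \<le> 2 * ecost e1 (st x) + 2 * ecost e2 (st x) + 1" for x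
      using dsize_evl_le_ecost[of e1 "st x"] dsize_evl_le_ecost[of e2 "st x"] by simp
  qed
next
  case (Fst e)
  show ?case
  proof (rule pbd_mono[where h = "\<lambda>x. 2 * ecost e (st x)"])
    show "pbd UNIV (\<lambda>x::data. 2 * ecost e (st x))"
      by (intro pbd_add pbd_mult pbd_const pbd_sz Fst)
    show "ecost (Fst e) (st x) \<le> 2 * ecost e (st x)" for x
      using dsize_evl_le_ecost[of e "st x"] dsize_dfst_le[of "evl e (st x)"] by simp
  qed
next
  case (Snd e)
  show ?case
  proof (rule pbd_mono[where h = "\<lambda>x. 2 * ecost e (st x)"])
    show "pbd UNIV (\<lambda>x::data. 2 * ecost e (st x))"
      by (intro pbd_add pbd_mult pbd_const pbd_sz Snd)
    show "ecost (Snd e) (st x) \<le> 2 * ecost e (st x)" for x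
      using dsize_evl_le_ecost[of e "st x"] dsize_dsnd_le[of "evl e (st x)"] by simp
  qed
next
  case (Eq e1 e2)
  show ?case
  proof (rule pbd_mono[where h = "\<lambda>x. ecost e1 (st x) + ecost e2 (st x) + 3"])
    show "pbd UNIV (\<lambda>x::data. ecost e1 (st x) + ecost e2 (st x) + 3)"
      by (intro pbd_add pbd_mult pbd_const pbd_sz Eq)
    show "ecost (Eq e1 e2) (st x) \<le> ecost e1 (st x) + ecost e2 (st x) + 3" for x
      by simp
  qed
qed

text \<open>All variables except variable 0 are \<open>Nl\<close> again when the program halts, so that programs can be
  composed sequentially.\<close>

definition pt :: "'a::encodable set \<Rightarrow> ('a \<Rightarrow> 'b::encodable) \<Rightarrow> bool" where
  "pt A f \<longleftrightarrow> (\<exists>c b. pbd A b \<and> (\<forall>a\<in>A. runs c (st (enc a)) (b a) (st (enc (f a)))))"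

named_theorems pt_intros

lemma ptI: "pbd A b \<Longrightarrow> (\<And>a. a \<in> A \<Longrightarrow> runs c (st (enc a)) (b a) (st (enc (f a)))) \<Longrightarrow> pt A f"
  unfolding pt_def by blast

lemma pt_cong: "pt A f \<Longrightarrow> (\<And>a. a \<in> A \<Longrightarrow> f a = g a) \<Longrightarrow> pt A g"
  unfolding pt_def by metis

lemma pt_pbd:
  assumes "pt A f"
  shows "pbd A (\<lambda>a. sz (f a))"
proof -
  obtain c b where cb: "pbd A b" "\<And>a. a \<in> A \<Longrightarrow> runs c (st (enc a)) (b a) (st (enc (f a)))"
    using assms unfolding pt_def by blast
  have "sz (f a) \<le> sz a + b a" if a: "a \<in> A" for a
  proof -
    obtain t where t: "t \<le> b a" "exec c (st (enc a)) t (st (enc (f a)))"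
      using cb(2)[OF a] unfolding runs_def by blast
    then show ?thesis using exec_size[OF t(2), of 0] by simp
  qed
  then show ?thesis by (rule pbd_mono[OF pbd_add[OF pbd_sz cb(1)]])
qed

text \<open>The domains matter because the oracle is polynomial on valid instances only. The second
  cost is polynomial in the first output, whose size \<open>pt_pbd\<close> bounds in terms of the
  input.\<close>

lemma pt_comp:
  assumes "pt A f" "pt B g" "\<And>a. a \<in> A \<Longrightarrow> f a \<in> B"
  shows "pt A (\<lambda>a. g (f a))"
proof -
  obtain c1 b1 where 1: "pbd A b1" "\<And>a. a \<in> A \<Longrightarrow> runs c1 (st (enc a)) (b1 a) (st (enc (f a)))"
    using assms(1) unfolding pt_def by blast
  obtain c2 b2 where 2: "pbd B b2" "\<And>a. a \<in> B \<Longrightarrow> runs c2 (st (enc a)) (b2 a) (st (enc (g a)))"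
    using assms(2) unfolding pt_def by blast
  have B: "pbd A (\<lambda>a. b1 a + b2 (f a))"
    by (rule pbd_add[OF 1(1) pbd_comp[OF 2(1) pt_pbd[OF assms(1)] assms(3)]])
  show ?thesis
  proof (rule ptI[OF B])
    fix a assume a: "a \<in> A"
    show "runs (Seq c1 c2) (st (enc a)) (b1 a + b2 (f a)) (st (enc (g (f a))))"
      using runs_Seq[OF 1(2)[OF a] 2(2)[OF assms(3)[OF a]]] .
  qed
qed

lemma pt_exp:
  assumes "pt A g" "\<And>a. a \<in> A \<Longrightarrow> evl e (st (enc (g a))) = enc (f a)"
  shows "pt A f"
proof -
  obtain c b where 1: "pbd A b" "\<And>a. a \<in> A \<Longrightarrow> runs c (st (enc a)) (b a) (st (enc (g a)))"
    using assms(1) unfolding pt_def by blast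
  have "pbd A (\<lambda>a. ecost e (st (enc (g a))))"
    using pbd_comp[OF pbd_ecost[of e], of A "\<lambda>a. enc (g a)"] pt_pbd[OF assms(1)] by simp
  then have B: "pbd A (\<lambda>a. b a + (1 + ecost e (st (enc (g a)))))"
    by (intro pbd_add 1 pbd_const)
  show ?thesis
  proof (rule ptI[OF B])
    fix a assume a: "a \<in> A"
    show "runs (Seq c (Assign 0 e)) (st (enc a)) (b a + (1 + ecost e (st (enc (g a))))) (st (enc (f a)))"
      by (rule runs_Seq[OF 1(2)[OF a] runs_Assign]) (simp_all add: assms(2) a)
  qed
qed

lemma pt_id [pt_intros]: "pt A (\<lambda>a. a)"
proof (rule ptI[where b = "\<lambda>_. 1" and c = Skip])
  show "pbd A (\<lambda>_. 1)" by (rule pbd_const)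
  show "runs Skip (st (enc a)) 1 (st (enc a))" for a :: 'a
    unfolding runs_def using exec.Skip by blast
qed

lemma pt_const [pt_intros]: "pt A (\<lambda>_. k)"
  by (rule pt_exp[OF pt_id, of _ "Const (enc k)"]) simp

text \<open>The input is needed twice: variable \<open>m\<close> keeps it during the first program,
  and \<open>Suc m\<close> keeps the first result during the second. Both lie beyond the variables
  of either program and are cleared after use.\<close>

lemma pt_Pair [pt_intros]:
  assumes "pt A f" "pt A g"
  shows "pt A (\<lambda>a. (f a, g a))"
proof -
  obtain c1 b1 where 1: "pbd A b1" "\<And>a. a \<in> A \<Longrightarrow> runs c1 (st (enc a)) (b1 a) (st (enc (f a)))"
    using assms(1) unfolding pt_def by blast
  obtain c2 b2 where 2: "pbd A b2" "\<And>a. a \<in> A \<Longrightarrow> runs c2 (st (enc a)) (b2 a) (st (enc (g a)))"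
    using assms(2) unfolding pt_def by blast
  define m where "m = Suc (max (com_bound c1) (com_bound c2))"
  have m: "m > 0" "com_bound c1 \<le> m" "com_bound c2 \<le> m" unfolding m_def by auto
  let ?c = "Seq (Assign m (Var 0)) (Seq c1 (Seq (Assign (Suc m) (Var 0)) (Seq (Assign 0 (Var m))
    (Seq (Assign m (Const Nl)) (Seq c2 (Seq (Assign 0 (Mk (Var (Suc m)) (Var 0)))
       (Assign (Suc m) (Const Nl))))))))"
  let ?B = "\<lambda>a. (1 + sz a) + (b1 a + ((1 + sz (f a)) + ((1 + sz a) +
      (2 + (b2 a + ((2 + 2 * sz (f a) + 2 * sz (g a)) + 2))))))"
  have R: "runs ?c (st (enc a)) (?B a) (st (enc (f a, g a)))" if a: "a \<in> A" for a
  proof -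
    have r0: "runs c1 ((st (enc a))(m := enc a)) (b1 a) ((st (enc (f a)))(m := enc a))"
      by (rule runs_frame[OF 1(2)[OF a] m(2)]) auto
    have r1: "runs c2 ((st (enc a))(Suc m := enc (f a))) (b2 a) ((st (enc (g a)))(Suc m := enc (f a)))"
      by (rule runs_frame[OF 2(2)[OF a] m(3)]) (use m in auto)
    have r2: "runs (Assign m (Var 0)) (st (enc a)) (1 + sz a) ((st (enc a))(m := enc a))"
      by (rule runs_Assign) auto
    have r3: "runs (Assign (Suc m) (Var 0)) ((st (enc (f a)))(m := enc a)) (1 + sz (f a))
        ((st (enc (f a)))(m := enc a, Suc m := enc (f a)))"
      by (rule runs_Assign) (use m in auto)
    have r4: "runs (Assign 0 (Var m)) ((st (enc (f a)))(m := enc a, Suc m := enc (f a))) (1 + sz a)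
        ((st (enc a))(m := enc a, Suc m := enc (f a)))"
      by (rule runs_Assign) (use m in \<open>auto simp: st_def fun_eq_iff\<close>)
    have r5: "runs (Assign m (Const Nl)) ((st (enc a))(m := enc a, Suc m := enc (f a))) 2
        ((st (enc a))(Suc m := enc (f a)))"
      by (rule runs_Assign) (use m in \<open>auto simp: st_def fun_eq_iff\<close>)
    have r6: "runs (Assign 0 (Mk (Var (Suc m)) (Var 0))) ((st (enc (g a)))(Suc m := enc (f a)))
        (2 + 2 * sz (f a) + 2 * sz (g a)) ((st (enc (f a, g a)))(Suc m := enc (f a)))"
      by (rule runs_Assign) (use m in \<open>auto simp: st_def fun_eq_iff\<close>)
    have r7: "runs (Assign (Suc m) (Const Nl)) ((st (enc (f a, g a)))(Suc m := enc (f a))) 2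
        (st (enc (f a, g a)))"
      by (rule runs_Assign) (use m in \<open>auto simp: st_def fun_eq_iff\<close>)
    show ?thesis
      by (rule runs_Seq[OF r2 runs_Seq[OF r0 runs_Seq[OF r3 runs_Seq[OF r4 runs_Seq[OF r5
        runs_Seq[OF r1 runs_Seq[OF r6 r7]]]]]]])
  qed
  have B: "pbd A ?B"
    by (intro pbd_add pbd_mult pbd_const pbd_sz pt_pbd assms 1 2)
  show ?thesis
  proof (rule ptI[OF B])
    fix a assume "a \<in> A"
    from R[OF this] show "runs ?c (st (enc a)) (?B a) (st (enc (f a, g a)))" .
  qed
qed

lemma pt_fst [pt_intros]: "pt A g \<Longrightarrow> pt A (\<lambda>a. fst (g a))"
  by (rule pt_exp[of A g "Fst (Var 0)"]) auto

lemma pt_snd [pt_intros]: "pt A g \<Longrightarrow> pt A (\<lambda>a. snd (g a))"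
  by (rule pt_exp[of A g "Snd (Var 0)"]) auto

lemma pt_If [pt_intros]:
  assumes "pt A d" "pt A f" "pt A g"
  shows "pt A (\<lambda>a. if d a then f a else g a)"
proof -
  have "pt A (\<lambda>a. (d a, a))" by (intro pt_Pair assms pt_id)
  then obtain c0 b0 where 0: "pbd A b0" "\<And>a. a \<in> A \<Longrightarrow> runs c0 (st (enc a)) (b0 a) (st (enc (d a, a)))"
    unfolding pt_def by blast
  obtain c1 b1 where 1: "pbd A b1" "\<And>a. a \<in> A \<Longrightarrow> runs c1 (st (enc a)) (b1 a) (st (enc (f a)))"
    using assms(2) unfolding pt_def by blast
  obtain c2 b2 where 2: "pbd A b2" "\<And>a. a \<in> A \<Longrightarrow> runs c2 (st (enc a)) (b2 a) (st (enc (g a)))"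
    using assms(3) unfolding pt_def by blast
  let ?s = "Assign 0 (Snd (Var 0))"
  let ?c = "Seq c0 (If (Fst (Var 0)) (Seq ?s c1) (Seq ?s c2))"
  let ?B = "\<lambda>a. b0 a + (1 + (2 * sz (d a) + sz a + 1) + ((2 + sz (d a) + 2 * sz a) + (b1 a + b2 a)))"
  have B: "pbd A ?B"
    by (intro pbd_add pbd_mult pbd_const pbd_sz pt_pbd assms 0 1 2)
  have R: "runs ?c (st (enc a)) (?B a) (st (enc (if d a then f a else g a)))" if a: "a \<in> A" for a
  proof (rule runs_Seq[OF 0(2)[OF a]])
    let ?x = "st (enc (d a, a))"
    have s: "runs ?s ?x (2 + sz (d a) + 2 * sz a) (st (enc a))" by (rule runs_Assign) auto
    have e: "1 + ecost (Fst (Var 0)) ?x = 1 + (2 * sz (d a) + sz a + 1)" by simp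
    show "runs (If (Fst (Var 0)) (Seq ?s c1) (Seq ?s c2)) ?x
      (1 + (2 * sz (d a) + sz a + 1) + ((2 + sz (d a) + 2 * sz a) + (b1 a + b2 a)))
      (st (enc (if d a then f a else g a)))"
    proof (cases "d a")
      case True
      have "runs (If (Fst (Var 0)) (Seq ?s c1) (Seq ?s c2)) ?x
          (1 + ecost (Fst (Var 0)) ?x + ((2 + sz (d a) + 2 * sz a) + b1 a)) (st (enc (f a)))"
        by (rule runs_If_True) (use True in simp, rule runs_Seq[OF s 1(2)[OF a]])
      then show ?thesis unfolding e by (simp only: True if_True) (erule runs_mono, simp)
    next
      case False
      have "runs (If (Fst (Var 0)) (Seq ?s c1) (Seq ?s c2)) ?x
          (1 + ecost (Fst (Var 0)) ?x + ((2 + sz (d a) + 2 * sz a) + b2 a)) (st (enc (g a)))"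
        by (rule runs_If_False) (use False in simp, rule runs_Seq[OF s 2(2)[OF a]])
      then show ?thesis unfolding e by (simp only: False if_False) (erule runs_mono, simp)
    qed
  qed
  show ?thesis
  proof (rule ptI[OF B])
    fix a assume "a \<in> A"
    from R[OF this] show "runs ?c (st (enc a)) (?B a) (st (enc (if d a then f a else g a)))" .
  qed
qed

text \<open>A polynomial-time step may square its accumulator, so iterating it need not stay
  polynomial; the bound \<open>Q\<close> on all intermediate results excludes this. The parameter
  \<open>a\<close> is passed to each call of the step, since a program has only one input.\<close>

lemma pt_fold_raw:
  fixes f :: "'a::encodable \<Rightarrow> 'x::encodable \<Rightarrow> 'b::encodable \<Rightarrow> 'b"
  assumes xs: "pt A xs" and init: "pt A h"
    and step: "pt (A \<times> UNIV) (\<lambda>p. f (fst p) (fst (snd p)) (snd (snd p)))"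
    and Q: "pbd A Q" "\<And>a ys zs. a \<in> A \<Longrightarrow> xs a = ys @ zs \<Longrightarrow> sz (fold (f a) ys (h a)) \<le> Q a"
  shows "pt A (\<lambda>a. fold (f a) (xs a) (h a))"
proof -
  have "pt A (\<lambda>a. (a, xs a, h a))" by (intro pt_Pair pt_id xs init)
  then obtain c0 b0 where 0: "pbd A b0"
    "\<And>a. a \<in> A \<Longrightarrow> runs c0 (st (enc a)) (b0 a) (st (enc (a, xs a, h a)))"
    unfolding pt_def by blast
  obtain c b where c: "pbd (A \<times> UNIV) b" "\<And>a x y. a \<in> A \<Longrightarrow>
      runs c (st (enc (a, x, y))) (b (a, x, y)) (st (enc (f a x y)))"
    using step unfolding pt_def by force
  obtain p where p: "\<And>a x y. a \<in> A \<Longrightarrow> b (a, x, y) \<le> poly p (sz (a, x, y))"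
    using c(1) unfolding pbd_def by auto
  define m where "m = Suc (com_bound c)"
  have m: "m > 0" "com_bound c \<le> m" unfolding m_def by auto
  let ?b1 = "Assign 0 (Mk (Var m) (Mk (Fst (Var (Suc m))) (Var 0)))"
  let ?b2 = "Assign (Suc m) (Snd (Var (Suc m)))"
  let ?body = "Seq ?b1 (Seq c ?b2)"
  let ?loop = "While (Var (Suc m)) ?body"
  let ?init = "Seq (Assign m (Fst (Var 0))) (Seq (Assign (Suc m) (Fst (Snd (Var 0))))
     (Assign 0 (Snd (Snd (Var 0)))))"
  \<comment> \<open>One pass copies the parameter, the remaining list and the accumulator a bounded
    number of times and runs the body once.\<close>
  define W where "W a = 10 * (1 + sz a + sz (xs a) + Q a) + poly p (2 + sz a + sz (xs a) + Q a)" for a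
  define \<sigma> where "\<sigma> a ys y = (st (enc y))(m := enc a, Suc m := enc (ys :: 'x list))" for a :: 'a and ys and y :: 'b
  have loop: "runs ?loop (\<sigma> a ys y) ((length ys + 1) * W a) (\<sigma> a [] (fold (f a) ys y))"
    if a: "a \<in> A" and "xs a = us @ ys" and "y = fold (f a) us (h a)" for a ys us y
    using that(2,3)
  proof (induction ys arbitrary: us y)
    case Nil
    have "runs ?loop (\<sigma> a [] y) (1 + ecost (Var (Suc m)) (\<sigma> a [] y)) (\<sigma> a [] y)"
      by (rule runs_While_False) (simp add: \<sigma>_def)
    then have "runs ?loop (\<sigma> a [] y) (W a) (\<sigma> a [] y)"
      by (rule runs_mono) (simp add: \<sigma>_def W_def)
    then show ?case by simp
  next
    case (Cons x ys)
    have sz_y: "sz y \<le> Q a" using Q(2)[OF a Cons.prems(1)] Cons.prems(2) by simp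
    have sz_ys: "sz (x # ys) \<le> sz (xs a)" using sz_append[of us "x # ys"] Cons.prems(1)
      dsize_pos[of "enc us"] by simp
    have "sz (a, x, y) \<le> 2 + sz a + sz (xs a) + Q a" using sz_y sz_ys by simp
    then have bW: "b (a, x, y) \<le> poly p (2 + sz a + sz (xs a) + Q a)"
      using p[OF a] poly_mono_nat le_trans by blast
    let ?s1 = "(st (enc (a, x, y)))(m := enc a, Suc m := enc (x # ys))"
    let ?s2 = "(st (enc (f a x y)))(m := enc a, Suc m := enc (x # ys))"
    have 1: "runs ?b1 (\<sigma> a (x # ys) y) (5 + 2 * sz a + 4 * sz (x # ys) + 3 * sz y) ?s1"
      by (rule runs_Assign) (use m in \<open>auto simp: \<sigma>_def st_def fun_eq_iff\<close>)
    have 2: "runs c ?s1 (b (a, x, y)) ?s2"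
      by (rule runs_frame[OF c(2)[OF a] m(2)]) (use m in auto)
    have 3: "runs ?b2 ?s2 (1 + 2 * sz (x # ys)) (\<sigma> a ys (f a x y))"
      by (rule runs_Assign) (use m in \<open>auto simp: \<sigma>_def st_def fun_eq_iff\<close>)
    have IH: "runs ?loop (\<sigma> a ys (f a x y)) ((length ys + 1) * W a) (\<sigma> a [] (fold (f a) ys (f a x y)))"
      by (rule Cons.IH[of "us @ [x]"]) (use Cons.prems in auto)
    have "runs ?loop (\<sigma> a (x # ys) y) (1 + ecost (Var (Suc m)) (\<sigma> a (x # ys) y) +
       ((5 + 2 * sz a + 4 * sz (x # ys) + 3 * sz y) + (b (a, x, y) + (1 + 2 * sz (x # ys))))
       + (length ys + 1) * W a) (\<sigma> a [] (fold (f a) ys (f a x y)))"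
      by (rule runs_While_True[OF _ runs_Seq[OF 1 runs_Seq[OF 2 3]] IH]) (simp add: \<sigma>_def)
    moreover have "1 + ecost (Var (Suc m)) (\<sigma> a (x # ys) y) +
       ((5 + 2 * sz a + 4 * sz (x # ys) + 3 * sz y) + (b (a, x, y) + (1 + 2 * sz (x # ys)))) \<le> W a"
    proof -
      have "ecost (Var (Suc m)) (\<sigma> a (x # ys) y) = sz (x # ys)" by (simp add: \<sigma>_def)
      moreover have "1 + e + (5 + 2 * A + 4 * s + 3 * u + (v + (1 + 2 * s))) \<le> 10 * (1 + A + X + q) + P"
        if "e = s" "u \<le> q" "s \<le> X" "v \<le> P" for e s u v q X P A :: nat
        using that by simp
      ultimately show ?thesis using sz_y sz_ys bW unfolding W_def by blast
    qed
    ultimately have "runs ?loop (\<sigma> a (x # ys) y) (W a + (length ys + 1) * W a) (\<sigma> a [] (fold (f a) ys (f a x y)))"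
      by (meson runs_mono add_le_mono1)
    then show ?case by simp
  qed
  let ?c = "Seq c0 (Seq ?init (Seq ?loop (Assign m (Const Nl))))"
  let ?B = "\<lambda>a. b0 a + (20 * (1 + sz a + sz (xs a) + sz (h a)) + ((sz (xs a) + 1) * W a + 2))"
  have "pbd A W" unfolding W_def
    by (intro pbd_add pbd_mult pbd_const pbd_poly pbd_sz pt_pbd xs init Q(1))
  then have B: "pbd A ?B"
    by (intro pbd_add pbd_mult pbd_const pbd_sz pt_pbd xs init 0)
  have R: "runs ?c (st (enc a)) (?B a) (st (enc (fold (f a) (xs a) (h a))))" if a: "a \<in> A" for a
  proof -
    let ?x = "st (enc (a, xs a, h a))"
    let ?s1 = "?x(m := enc a)" and ?s2 = "?x(m := enc a, Suc m := enc (xs a))"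
    have 1: "runs (Assign m (Fst (Var 0))) ?x (10 * (1 + sz a + sz (xs a) + sz (h a)) ) ?s1"
      by (rule runs_Assign) auto
    have 2: "runs (Assign (Suc m) (Fst (Snd (Var 0)))) ?s1 (5 * (1 + sz a + sz (xs a) + sz (h a)) ) ?s2"
      by (rule runs_Assign) (use m in auto)
    have 3: "runs (Assign 0 (Snd (Snd (Var 0)))) ?s2 (5 * (1 + sz a + sz (xs a) + sz (h a)) ) (\<sigma> a (xs a) (h a))"
      by (rule runs_Assign) (use m in \<open>auto simp: \<sigma>_def st_def fun_eq_iff\<close>)
    have i1: "runs ?init ?x (20 * (1 + sz a + sz (xs a) + sz (h a))) (\<sigma> a (xs a) (h a))"
      by (rule runs_mono[OF runs_Seq[OF 1 runs_Seq[OF 2 3]]]) simp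
    have "length (xs a) \<le> sz (xs a)" using length_le_sz[of "xs a"] by simp
    then have 1: "(length (xs a) + 1) * W a + 2 \<le> (sz (xs a) + 1) * W a + 2" by simp
    have 2: "runs ?loop (\<sigma> a (xs a) (h a)) ((length (xs a) + 1) * W a) (\<sigma> a [] (fold (f a) (xs a) (h a)))"
      by (rule loop[OF a, of "[]"]) auto
    have 3: "runs (Assign m (Const Nl)) (\<sigma> a [] (fold (f a) (xs a) (h a))) 2 (st (enc (fold (f a) (xs a) (h a))))"
      by (rule runs_Assign) (use m in \<open>auto simp: \<sigma>_def st_def fun_eq_iff\<close>)
    show ?thesis
      by (rule runs_Seq[OF 0(2)[OF a] runs_Seq[OF i1 runs_mono[OF runs_Seq[OF 2 3] 1]]])
  qed
  show ?thesis
  proof (rule ptI[OF B])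
    fix a assume "a \<in> A"
    from R[OF this] show "runs ?c (st (enc a)) (?B a) (st (enc (fold (f a) (xs a) (h a))))" .
  qed
qed

text \<open>Injectivity of \<open>enc\<close> makes the comparison of codes decide equality of
  values.\<close>

lemma pt_eq [pt_intros]: "pt A f \<Longrightarrow> pt A g \<Longrightarrow> pt A (\<lambda>a. f a = g a)"
  by (rule pt_exp[OF pt_Pair, of A f g "Eq (Fst (Var 0)) (Snd (Var 0))"]) auto

lemma pt_Not [pt_intros]: "pt A P \<Longrightarrow> pt A (\<lambda>a. \<not> P a)"
  by (rule pt_cong[OF pt_If[OF _ pt_const pt_const, of A P False True]]) auto

lemma pt_fst_dom:
  assumes "pt A f"
  shows "pt (A \<times> UNIV) (\<lambda>p. f (fst p))"
  by (rule pt_comp[OF pt_fst[OF pt_id] assms]) auto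

lemma pt_env:
  assumes "pt (A \<times> UNIV) (\<lambda>p. f (fst p) (snd p))" "pt (A \<times> UNIV) g"
  shows "pt (A \<times> UNIV) (\<lambda>p. f (fst p) (g p))"
proof -
  have "pt (A \<times> UNIV) (\<lambda>p. (fst p, g p))"
    by (intro pt_Pair pt_fst pt_id assms)
  from pt_comp[OF this assms(1)] show ?thesis by auto
qed

lemma pt_conj [pt_intros]: "pt A P \<Longrightarrow> pt A Q \<Longrightarrow> pt A (\<lambda>a. P a \<and> Q a)"
  by (rule pt_cong[OF pt_If[OF _ _ pt_const, of A P Q False]]) auto

lemma pt_disj [pt_intros]: "pt A P \<Longrightarrow> pt A Q \<Longrightarrow> pt A (\<lambda>a. P a \<or> Q a)"
  by (rule pt_cong[OF pt_If[OF _ pt_const _, of A P Q True]]) auto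

lemma pt_Suc [pt_intros]: "pt A n \<Longrightarrow> pt A (\<lambda>a. Suc (n a))"
  by (rule pt_exp[of A n "Mk (Const Nl) (Var 0)"]) auto

lemma pt_pred: "pt A n \<Longrightarrow> pt A (\<lambda>a. n a - Suc 0)"
  by (rule pt_exp[of A n "Snd (Var 0)"]) (auto, metis Suc_pred dsnd.simps enc_nat_simps not_gr_zero zero_diff)

lemma pt_Cons [pt_intros]: "pt A x \<Longrightarrow> pt A xs \<Longrightarrow> pt A (\<lambda>a. x a # xs a)"
  by (rule pt_exp[OF pt_Pair, of A x xs "Var 0"]) auto

lemma pt_tl [pt_intros]: "pt A xs \<Longrightarrow> pt A (\<lambda>a. tl (xs a))"
proof (rule pt_exp[of A xs "Snd (Var 0)"])
  show "evl (Snd (Var 0)) (st (enc (xs a))) = enc (tl (xs a))" for a by (cases "xs a") auto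
qed

text \<open>A unary numeral is by definition the code of a list of units, so the conversion is free;
  folding over that list yields counted loops.\<close>

lemma pt_replicate: "pt A n \<Longrightarrow> pt A (\<lambda>a. replicate (n a) ())"
  by (rule pt_exp[of A n "Var 0"]) (auto simp: enc_nat_def)

text \<open>Growth by at most \<open>w a\<close> per step keeps all intermediate results linear in
  the length of the list, which discharges the hypothesis \<open>Q\<close> of
  \<open>pt_fold_raw\<close>.\<close>

lemma pt_fold:
  fixes f :: "'a::encodable \<Rightarrow> 'x::encodable \<Rightarrow> 'b::encodable \<Rightarrow> 'b"
  assumes xs: "pt A xs" and init: "pt A h"
    and step: "pt (A \<times> UNIV) (\<lambda>p. f (fst p) (fst (snd p)) (snd (snd p)))"
    and w: "pbd A w" "\<And>a x y. a \<in> A \<Longrightarrow> x \<in> set (xs a) \<Longrightarrow> sz (f a x y) \<le> sz y + w a"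
  shows "pt A (\<lambda>a. fold (f a) (xs a) (h a))"
proof (rule pt_fold_raw[OF xs init step])
  show "pbd A (\<lambda>a. sz (h a) + sz (xs a) * w a)"
    by (intro pbd_add pbd_mult pt_pbd xs init w)
  fix a ys zs
  assume a: "a \<in> A" "xs a = ys @ zs"
  have "set ys \<subseteq> set (xs a) \<Longrightarrow> sz (fold (f a) ys y) \<le> sz y + length ys * w a" for y
  proof (induction ys arbitrary: y)
    case (Cons x ys)
    then have "sz (fold (f a) ys (f a x y)) \<le> sz (f a x y) + length ys * w a" by simp
    moreover have "sz (f a x y) \<le> sz y + w a" using w(2)[OF a(1)] Cons by simp
    ultimately show ?case by simp
  qed simp
  then have "sz (fold (f a) ys (h a)) \<le> sz (h a) + length ys * w a" using a by simp
  moreover have "length ys \<le> sz (xs a)" using a length_le_sz[of "xs a"] by simp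
  ultimately show "sz (fold (f a) ys (h a)) \<le> sz (h a) + sz (xs a) * w a"
    using mult_le_mono1[of "length ys" "sz (xs a)" "w a"] by linarith
qed

lemma fold_replicate_funpow: "fold (\<lambda>_. f) (replicate n u) = f ^^ n"
  by (induction n) (auto simp: funpow_swap1)

lemma pt_funpow_raw:
  fixes f :: "'a::encodable \<Rightarrow> 'b::encodable \<Rightarrow> 'b"
  assumes n: "pt A n" and init: "pt A h"
    and step: "pt (A \<times> UNIV) (\<lambda>p. f (fst p) (snd p))"
    and Q: "pbd A Q" "\<And>a i. a \<in> A \<Longrightarrow> i \<le> n a \<Longrightarrow> sz ((f a ^^ i) (h a)) \<le> Q a"
  shows "pt A (\<lambda>a. (f a ^^ n a) (h a))"
proof -
  have "pt A (\<lambda>a. fold (\<lambda>_. f a) (replicate (n a) ()) (h a))"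
  proof (rule pt_fold_raw[OF pt_replicate[OF n] init _ Q(1)])
    show "pt (A \<times> UNIV) (\<lambda>p. f (fst p) (snd (snd p)))"
      by (intro pt_env[OF step] pt_snd pt_id)
    fix a ys and zs :: "unit list"
    assume a: "a \<in> A" "replicate (n a) () = ys @ zs"
    then have "ys = replicate (length ys) ()" by (intro replicate_eqI) auto
    moreover have "length ys \<le> n a" using arg_cong[OF a(2), of length] by simp
    ultimately show "sz (fold (\<lambda>_. f a) ys (h a)) \<le> Q a"
      using Q(2)[OF a(1), of "length ys"] fold_replicate_funpow[of "f a" "length ys" "()"] by simp
  qed
  then show ?thesis by (simp add: fold_replicate_funpow)
qed

lemma pt_funpow:
  fixes f :: "'a::encodable \<Rightarrow> 'b::encodable \<Rightarrow> 'b"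
  assumes n: "pt A n" and init: "pt A h"
    and step: "pt (A \<times> UNIV) (\<lambda>p. f (fst p) (snd p))"
    and w: "pbd A w" "\<And>a y. a \<in> A \<Longrightarrow> sz (f a y) \<le> sz y + w a"
  shows "pt A (\<lambda>a. (f a ^^ n a) (h a))"
proof (rule pt_funpow_raw[OF n init step])
  show "pbd A (\<lambda>a. sz (h a) + sz (n a) * w a)"
    by (intro pbd_add pbd_mult pt_pbd n init w)
  fix a i assume a: "a \<in> A" "i \<le> n a"
  have "sz ((f a ^^ i) (h a)) \<le> sz (h a) + i * w a"
  proof (induction i)
    case (Suc i)
    then show ?case using w(2)[OF a(1), of "(f a ^^ i) (h a)"] by simp
  qed simp
  moreover have "i \<le> sz (n a)" using a by simp
  ultimately show "sz ((f a ^^ i) (h a)) \<le> sz (h a) + sz (n a) * w a"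
    using mult_le_mono1[of i "sz (n a)" "w a"] by linarith
qed

lemma pt_rev [pt_intros]:
  assumes "pt A xs"
  shows "pt A (\<lambda>a. rev (xs a))"
proof -
  have "pt A (\<lambda>a. fold (\<lambda>x y. x # y) (xs a) [])"
  proof (rule pt_fold[OF assms pt_const])
    show "pbd A (\<lambda>a. Suc (sz (xs a)))" by (intro pbd_Suc pt_pbd assms)
    show "sz (x # y) \<le> sz y + Suc (sz (xs a))" if "x \<in> set (xs a)" for a x y
      using sz_member[OF that] by simp
  qed (intro pt_intros)
  then show ?thesis by (simp add: rev_conv_fold[symmetric])
qed

lemma pt_append [pt_intros]:
  assumes "pt A xs" "pt A ys"
  shows "pt A (\<lambda>a. xs a @ ys a)"
proof -
  have "pt A (\<lambda>a. fold (\<lambda>x y. x # y) (rev (xs a)) (ys a))"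
  proof (rule pt_fold[OF pt_rev[OF assms(1)] assms(2)])
    show "pbd A (\<lambda>a. Suc (sz (xs a)))" by (intro pbd_Suc pt_pbd assms)
    show "sz (x # y) \<le> sz y + Suc (sz (xs a))" if "x \<in> set (rev (xs a))" for a x y
      using sz_member[of x "xs a"] that by simp
  qed (intro pt_intros)
  moreover have "fold (\<lambda>x y. x # y) (rev us) vs = us @ vs" for us vs :: "'b list"
    by (induction us arbitrary: vs) (auto simp: fold_append)
  ultimately show ?thesis by simp
qed

lemma pbd_member:
  assumes "pt A xs" "pt (A \<times> UNIV) (\<lambda>p. f (fst p) (snd p))"
  obtains w where "pbd A w" "\<And>a x. a \<in> A \<Longrightarrow> x \<in> set (xs a) \<Longrightarrow> sz (f a x) \<le> w a"
proof -
  obtain p where p: "\<And>a x. a \<in> A \<Longrightarrow> sz (f a x) \<le> poly p (sz (a, x))"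
    using pt_pbd[OF assms(2)] unfolding pbd_def by auto
  show ?thesis
  proof (rule that)
    show "pbd A (\<lambda>a. poly p (Suc (sz a + sz (xs a))))"
      by (intro pbd_poly pbd_Suc pbd_add pbd_sz pt_pbd assms)
    show "sz (f a x) \<le> poly p (Suc (sz a + sz (xs a)))" if "a \<in> A" "x \<in> set (xs a)" for a x
      by (rule order_trans[OF p[OF that(1)] poly_mono_nat]) (simp add: sz_member[OF that(2)])
  qed
qed

text \<open>The one loop behind \<open>map\<close>, \<open>filter\<close> and the bounded
  quantifiers.\<close>

lemma pt_concat_map [pt_intros]:
  assumes xs: "pt A xs" and f: "pt (A \<times> UNIV) (\<lambda>p. f (fst p) (snd p))"
  shows "pt A (\<lambda>a. concat (map (f a) (xs a)))"
proof -
  obtain w where w: "pbd A w" "\<And>a x. a \<in> A \<Longrightarrow> x \<in> set (xs a) \<Longrightarrow> sz (f a x) \<le> w a"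
    using pbd_member[OF assms] by blast
  have "pt A (\<lambda>a. fold (\<lambda>x y. y @ f a x) (xs a) [])"
  proof (rule pt_fold[OF xs pt_const _ w(1)])
    have "pt (A \<times> UNIV) (\<lambda>p. f (fst p) (fst (snd p)))"
      by (intro pt_env[OF f] pt_fst pt_snd pt_id)
    then show "pt (A \<times> UNIV) (\<lambda>p. snd (snd p) @ f (fst p) (fst (snd p)))"
      by (intro pt_append pt_snd pt_id)
    show "sz (y @ f a x) \<le> sz y + w a" if "a \<in> A" "x \<in> set (xs a)" for a x y
      using w(2)[OF that] sz_append[of y "f a x"] by simp
  qed
  moreover have "fold (\<lambda>x y. y @ g x) us vs = vs @ concat (map g us)" for g :: "'b \<Rightarrow> 'c list" and us vs
    by (induction us arbitrary: vs) auto
  ultimately show ?thesis by simp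
qed

lemma pt_map [pt_intros]:
  assumes "pt A xs" "pt (A \<times> UNIV) (\<lambda>p. f (fst p) (snd p))"
  shows "pt A (\<lambda>a. map (f a) (xs a))"
proof -
  have "pt A (\<lambda>a. concat (map (\<lambda>x. [f a x]) (xs a)))"
    by (intro pt_concat_map pt_Cons pt_const assms)
  moreover have "concat (map (\<lambda>x. [g x]) us) = map g us" for g :: "'b \<Rightarrow> 'c" and us
    by (induction us) auto
  ultimately show ?thesis by simp
qed

lemma pt_filter [pt_intros]:
  assumes "pt A xs" "pt (A \<times> UNIV) (\<lambda>p. P (fst p) (snd p))"
  shows "pt A (\<lambda>a. filter (P a) (xs a))"
proof -
  have "pt A (\<lambda>a. concat (map (\<lambda>x. if P a x then [x] else []) (xs a)))"
    by (intro pt_concat_map pt_Cons pt_const pt_If pt_snd pt_id assms)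
  moreover have "concat (map (\<lambda>x. if P x then [x] else []) us) = filter P us" for P :: "'b \<Rightarrow> bool" and us
    by (induction us) auto
  ultimately show ?thesis by simp
qed

lemma pt_Bex [pt_intros]:
  assumes "pt A xs" "pt (A \<times> UNIV) (\<lambda>p. P (fst p) (snd p))"
  shows "pt A (\<lambda>a. \<exists>x\<in>set (xs a). P a x)"
proof -
  have "pt A (\<lambda>a. filter (P a) (xs a) \<noteq> [])"
    by (intro pt_Not pt_eq pt_filter pt_const assms)
  moreover have "filter P us \<noteq> [] \<longleftrightarrow> (\<exists>x\<in>set us. P x)" for P :: "'b \<Rightarrow> bool" and us
    by (auto simp: filter_empty_conv)
  ultimately show ?thesis by simp
qed

lemma pt_Ball [pt_intros]:
  assumes "pt A xs" "pt (A \<times> UNIV) (\<lambda>p. P (fst p) (snd p))"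
  shows "pt A (\<lambda>a. \<forall>x\<in>set (xs a). P a x)"
proof -
  have "pt A (\<lambda>a. \<not> (\<exists>x\<in>set (xs a). \<not> P a x))"
    by (intro pt_Not pt_Bex assms)
  then show ?thesis by simp
qed

lemma pt_member [pt_intros]:
  assumes "pt A x" "pt A xs"
  shows "pt A (\<lambda>a. x a \<in> set (xs a))"
proof -
  have "pt (A \<times> UNIV) (\<lambda>p. x (fst p))"
    by (rule pt_fst_dom[OF assms(1)])
  then have "pt A (\<lambda>a. \<exists>y\<in>set (xs a). y = x a)"
    by (intro pt_Bex pt_eq pt_snd pt_id assms)
  then show ?thesis by simp
qed

lemma pt_length [pt_intros]:
  assumes "pt A xs"
  shows "pt A (\<lambda>a. length (xs a))"
proof (rule pt_exp[where e = "Var 0"])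
  show "pt A (\<lambda>a. map (\<lambda>_. ()) (xs a))" by (intro pt_map assms pt_const)
  show "evl (Var 0) (st (enc (map (\<lambda>_. ()) (xs a)))) = enc (length (xs a))" for a
    by (simp add: enc_nat_def map_replicate_const)
qed

section \<open>Arithmetic on unary numerals\<close>

lemma pt_add [pt_intros]:
  assumes "pt A m" "pt A n"
  shows "pt A (\<lambda>a. m a + n a :: nat)"
proof -
  have "pt A (\<lambda>a. (Suc ^^ m a) (n a))"
    by (rule pt_funpow[OF assms(1) assms(2) _ pbd_const[of _ 2]]) (intro pt_intros, simp)
  then show ?thesis by simp
qed

lemma pt_mult [pt_intros]:
  assumes "pt A m" "pt A n"
  shows "pt A (\<lambda>a. m a * n a :: nat)"
proof -
  have n: "pt (A \<times> UNIV) (\<lambda>p. n (fst p))"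
    by (rule pt_fst_dom[OF assms(2)])
  have "pt A (\<lambda>a. ((\<lambda>y. n a + y) ^^ m a) 0)"
  proof (rule pt_funpow[OF assms(1) pt_const])
    show "pbd A (\<lambda>a. sz (n a))" by (intro pt_pbd assms)
    show "pt (A \<times> UNIV) (\<lambda>p. n (fst p) + snd p)" by (intro pt_intros n)
  qed simp
  moreover have "((\<lambda>y. k + y) ^^ i) 0 = i * k" for i k :: nat
    by (induction i) auto
  ultimately show ?thesis by simp
qed

text \<open>The exponent is a constant of the program; with a variable exponent the unary result
  could be exponentially long.\<close>

lemma pt_power [pt_intros]:
  assumes "pt A n"
  shows "pt A (\<lambda>a. n a ^ k :: nat)"
proof (induction k)
  case 0
  show ?case using pt_const[of A "Suc 0"] by simp
next
  case (Suc k)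
  show ?case using pt_mult[OF assms Suc] by simp
qed

lemma pt_diff [pt_intros]:
  assumes "pt A m" "pt A n"
  shows "pt A (\<lambda>a. m a - n a :: nat)"
proof -
  have "pt A (\<lambda>a. ((\<lambda>y. y - Suc 0) ^^ n a) (m a))"
  proof (rule pt_funpow[OF assms(2) assms(1) _ pbd_const[of _ 0]])
    show "pt (A \<times> UNIV) (\<lambda>p. snd p - Suc 0)" by (intro pt_pred pt_intros)
  qed simp
  moreover have "((\<lambda>y. y - Suc 0) ^^ i) j = j - i" for i j
    by (induction i) auto
  ultimately show ?thesis by simp
qed

lemma pt_less [pt_intros]:
  assumes "pt A m" "pt A n"
  shows "pt A (\<lambda>a. m a < (n a :: nat))"
proof -
  have "pt A (\<lambda>a. n a - m a \<noteq> 0)" by (intro pt_intros assms)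
  then show ?thesis by (simp add: not_le)
qed

lemma pt_le [pt_intros]:
  assumes "pt A m" "pt A n"
  shows "pt A (\<lambda>a. m a \<le> (n a :: nat))"
proof -
  have "pt A (\<lambda>a. m a - n a = 0)" by (intro pt_intros assms)
  then show ?thesis by simp
qed

lemma pt_max [pt_intros]:
  assumes "pt A m" "pt A n"
  shows "pt A (\<lambda>a. max (m a) (n a :: nat))"
  unfolding max_def by (intro pt_intros assms)

lemma pt_min [pt_intros]:
  assumes "pt A m" "pt A n"
  shows "pt A (\<lambda>a. min (m a) (n a :: nat))"
  unfolding min_def by (intro pt_intros assms)

lemma mod_conv_funpow: "((\<lambda>r. if Suc r = n then 0 else Suc r) ^^ m) 0 = m mod n"
  by (induction m) (auto simp: mod_Suc)

lemma pt_mod [pt_intros]: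
  assumes "pt A m" "pt A n"
  shows "pt A (\<lambda>a. m a mod n a :: nat)"
proof -
  have n: "pt (A \<times> UNIV) (\<lambda>p. n (fst p))"
    by (rule pt_fst_dom[OF assms(2)])
  have "pt A (\<lambda>a. ((\<lambda>r. if Suc r = n a then 0 else Suc r) ^^ m a) 0)"
  proof (rule pt_funpow[OF assms(1) pt_const _ pbd_const[of _ 2]])
    show "pt (A \<times> UNIV) (\<lambda>p. if Suc (snd p) = n (fst p) then 0 else Suc (snd p))"
      by (intro pt_intros n)
  qed simp
  then show ?thesis by (simp add: mod_conv_funpow)
qed

lemma pt_upt [pt_intros]:
  assumes "pt A n"
  shows "pt A (\<lambda>a. [0..<n a])"
proof -
  have eq: "((\<lambda>l. length l # l) ^^ i) [] = rev [0..<i]" for i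
    by (induction i) auto
  have "pt A (\<lambda>a. rev (((\<lambda>l. length l # l) ^^ n a) []))"
  proof (intro pt_rev, rule pt_funpow_raw[OF assms pt_const])
    show "pt (A \<times> UNIV) (\<lambda>p. length (snd p) # snd p)" by (intro pt_intros)
    show "pbd A (\<lambda>a. sz (n a) * (2 * sz (n a) + 2) + 1)"
      by (intro pbd_add pbd_mult pbd_const pt_pbd assms)
    fix a i assume i: "a \<in> A" "i \<le> n a"
    have "sz [0..<i] \<le> length [0..<i] * Suc (sz i) + 1"
      by (rule sz_list_le) auto
    also have "\<dots> \<le> sz (n a) * (2 * sz (n a) + 2) + 1"
      using i by (intro add_mono mult_le_mono) auto
    finally show "sz (((\<lambda>l. length l # l) ^^ i) []) \<le> sz (n a) * (2 * sz (n a) + 2) + 1"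
      unfolding eq sz_rev .
  qed
  then show ?thesis by (simp add: eq)
qed

lemma pt_drop [pt_intros]:
  assumes "pt A n" "pt A xs"
  shows "pt A (\<lambda>a. drop (n a) (xs a))"
proof -
  have "pt A (\<lambda>a. (tl ^^ n a) (xs a))"
  proof (rule pt_funpow[OF assms(1) assms(2) _ pbd_const[of _ 0]])
    show "pt (A \<times> UNIV) (\<lambda>p. tl (snd p))" by (intro pt_intros)
    show "sz (tl y) \<le> sz y + 0" for y :: "'b list" by (cases y) auto
  qed
  moreover have "(tl ^^ i) us = drop i us" for i and us :: "'b list"
    by (induction i) (auto simp: drop_Suc tl_drop)
  ultimately show ?thesis by simp
qed

text \<open>A list of length at most one serves as an optional value, so that access outside a list
  needs no default element.\<close>

definition first :: "'a list \<Rightarrow> 'a list" where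
  "first xs = take 1 xs"

lemma first_simps [simp]: "first [] = []" "first (x # xs) = [x]"
  by (simp_all add: first_def)

lemma pt_first [pt_intros]:
  assumes "pt A xs"
  shows "pt A (\<lambda>a. first (xs a))"
proof -
  have eq: "fold (\<lambda>x y. if y = [] then [x] else y) us vs = (if vs = [] then first us else vs)" for us vs :: "'b list"
    by (induction us arbitrary: vs) auto
  have "pt A (\<lambda>a. fold (\<lambda>x y. if y = [] then [x] else y) (xs a) [])"
  proof (rule pt_fold[OF assms pt_const])
    show "pt (A \<times> UNIV) (\<lambda>p. if snd (snd p) = [] then [fst (snd p)] else snd (snd p))" by (intro pt_intros)
    show "pbd A (\<lambda>a. Suc (sz (xs a)))" by (intro pbd_Suc pt_pbd assms)
    show "sz (if y = [] then [x] else y) \<le> sz y + Suc (sz (xs a))" if "x \<in> set (xs a)" for a x y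
      using sz_member[OF that] by simp
  qed
  then show ?thesis by (simp add: eq)
qed

text \<open>The right spine of a tree. Every tree is the code of exactly one list of trees, so
  reading an input as a list costs nothing and never fails.\<close>

primrec data_list :: "data \<Rightarrow> data list" where
  "data_list Nl = []"
| "data_list (Pr x y) = x # data_list y"

lemma enc_data_list [simp]: "enc (data_list d) = d"
  by (induction d) auto

lemma data_list_enc_list [simp]: "data_list (enc_list ds) = ds"
  by (induction ds) auto

lemma pt_data_list [pt_intros]: "pt A d \<Longrightarrow> pt A (\<lambda>a. data_list (d a))"
  by (rule pt_exp[of A d "Var 0"]) auto

lemma pt_dfst [pt_intros]: "pt A d \<Longrightarrow> pt A (\<lambda>a. dfst (d a))"
  by (rule pt_exp[of A d "Fst (Var 0)"]) auto

lemma pt_dsnd [pt_intros]: "pt A d \<Longrightarrow> pt A (\<lambda>a. dsnd (d a))"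
  by (rule pt_exp[of A d "Snd (Var 0)"]) auto

lemma pt_enc [pt_intros]: "pt A f \<Longrightarrow> pt A (\<lambda>a. enc (f a))"
  by (rule pt_exp[of A f "Var 0"]) auto

section \<open>Primes in a polynomially long interval\<close>

text \<open>The reciprocals of these numbers form Leibniz's harmonic triangle, in which
  \<open>1/z = 1/x - 1/y\<close> for the \<open>x\<close>, \<open>y\<close> and \<open>z\<close> of
  the proof. If \<open>x\<close> and \<open>y\<close> divide a common multiple \<open>M\<close>,
  then \<open>M/z = M/x - M/y\<close> is an integer as well.\<close>

lemma leibniz_triangle_dvd_Lcm:
  "k \<le> n \<Longrightarrow> (n + 1) * (n choose k) dvd Lcm {1..n + 1}"
proof (induction k arbitrary: n)
  case 0
  show ?case by (simp add: dvd_Lcm)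
next
  case (Suc k)
  then obtain N where n: "n = Suc N" and k: "k \<le> N" by (cases n) auto
  define x where "x = int ((N + 1) * (N choose k))"
  define y where "y = int ((N + 2) * (Suc N choose k))"
  define z where "z = int ((N + 2) * (Suc N choose Suc k))"
  define M where "M = int (Lcm {1..N + 2})"
  have "Lcm {1..N + 1} dvd Lcm {1..N + 2}" by (rule Lcm_subset) auto
  then have "(N + 1) * (N choose k) dvd Lcm {1..N + 2}"
    using Suc.IH[OF k] dvd_trans by blast
  then obtain u where u: "M = x * u" unfolding M_def x_def by (meson dvdE int_dvd_int_iff)
  have "(Suc N + 1) * (Suc N choose k) dvd Lcm {1..Suc N + 1}"
    using Suc.IH[of "Suc N"] k by simp
  then have "y dvd M" unfolding y_def M_def by (simp only: int_dvd_int_iff) simp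
  then obtain w where w: "M = y * w" by (elim dvdE)
  have 1: "int (Suc k) * z = int (N + 2) * x"
    unfolding x_def z_def using Suc_times_binomial_eq[of N k] by (simp add: algebra_simps flip: of_nat_mult of_nat_add of_nat_Suc)
  have absorb: "(Suc N choose k) * (Suc N - k) = Suc N * (N choose k)"
    using binomial_absorb_comp[of "Suc N" k] by (simp add: mult.commute)
  have 2: "y * int (Suc N - k) = int (N + 2) * x"
  proof -
    have "y * int (Suc N - k) = int ((N + 2) * ((Suc N choose k) * (Suc N - k)))"
      unfolding y_def by (simp only: of_nat_mult mult.assoc)
    also have "\<dots> = int (N + 2) * x"
      unfolding x_def absorb by (simp only: of_nat_mult Suc_eq_plus1)
    finally show ?thesis .
  qed
  have pos: "x > 0" "y > 0" unfolding x_def y_def of_nat_0_less_iff using k by (auto intro!: mult_pos_pos zero_less_binomial)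
  have "int (Suc N - k) = int (N + 2) - int (Suc k)" using k by simp
  then have "y * int (N + 2) = int (N + 2) * x + y * int (Suc k)"
    using 2 by (simp add: algebra_simps)
  then have "int (N + 2) * (y - x) = int (Suc k) * y" by (simp add: algebra_simps)
  then have "int (Suc k) * (z * (y - x)) = int (Suc k) * (x * y)"
    using 1 by (metis (no_types, lifting) mult.assoc mult.commute mult.left_commute)
  then have zyx: "z * (y - x) = x * y" by simp
  have "M * (x * y) = z * (u - w) * (x * y)"
  proof -
    have "z * (u - w) * (x * y) = z * ((x * u) * y - (y * w) * x)" by (simp add: algebra_simps)
    also have "\<dots> = z * (M * y - M * x)" by (simp only: u[symmetric] w[symmetric])
    also have "\<dots> = M * (z * (y - x))" by (simp add: algebra_simps)
    finally show ?thesis unfolding zyx by (rule sym)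
  qed
  then have "M = z * (u - w)" using pos by simp
  then have "z dvd M" by simp
  then show ?case unfolding z_def M_def n by (simp only: int_dvd_int_iff) simp
qed

text \<open>The multiplicity of \<open>p\<close> in a least common multiple is the largest one among
  the numbers, and it is attained.\<close>

lemma prime_power_dvd_Lcm:
  fixes p n :: nat
  assumes "prime p" "p ^ e dvd Lcm {1..n}" "e > 0"
  shows "\<exists>i\<in>{1..n}. p ^ e dvd i"
  using assms(2)
proof (induction n)
  case 0
  then show ?case using assms(1,3) prime_gt_1_nat[of p] by (simp add: nat_dvd_1_iff_1)
next
  case (Suc n)
  have "Lcm {1..n} \<noteq> 0" by (simp add: Lcm_0_iff)
  moreover have "Lcm {1..Suc n} = lcm (Suc n) (Lcm {1..n})"
    by (simp add: atLeastAtMostSuc_conv)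
  moreover have "e \<le> multiplicity p (Lcm {1..Suc n})"
    using Suc.prems assms(1) by (subst power_dvd_iff_le_multiplicity[symmetric]) (auto simp: Lcm_0_iff)
  ultimately have "e \<le> max (multiplicity p (Suc n)) (multiplicity p (Lcm {1..n}))"
    using assms(1) by (simp add: multiplicity_lcm)
  then have "p ^ e dvd Suc n \<or> p ^ e dvd Lcm {1..n}"
    using assms(1) by (auto simp: le_max_iff_disj intro: multiplicity_dvd')
  then show ?case using Suc.IH by fastforce
qed

lemma le_power_primes:
  fixes N B :: nat
  assumes N: "N > 0" and B: "B \<ge> 1"
    and le: "\<And>p. p \<in> prime_factors N \<Longrightarrow> p ^ multiplicity p N \<le> B \<and> p \<le> B"
  shows "N \<le> B ^ card {p. prime p \<and> p \<le> B}"
proof -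
  have "(\<Prod>p\<in>prime_factors N. p ^ multiplicity p N) \<le> (\<Prod>p\<in>prime_factors N. B)"
    by (rule prod_mono) (use le in auto)
  also have "\<dots> = B ^ card (prime_factors N)" by (rule prod_constant)
  also have "\<dots> \<le> B ^ card {p. prime p \<and> p \<le> B}"
  proof (rule power_increasing[OF card_mono B])
    show "finite {p. prime p \<and> p \<le> B}" by simp
    show "prime_factors N \<subseteq> {p. prime p \<and> p \<le> B}" using le by auto
  qed
  finally show ?thesis by (rule ord_eq_le_trans[OF prime_factorization_nat[OF N]])
qed

text \<open>Each maximal prime power in the least common multiple divides one of the numbers up to
  \<open>n\<close>, so it is at most \<open>n\<close>, and there is one such factor per
  prime.\<close>

lemma Lcm_le_power_primes:
  fixes n :: nat
  assumes "n \<ge> 1"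
  shows "Lcm {1..n} \<le> n ^ card {p. prime p \<and> p \<le> n}"
proof -
  let ?N = "Lcm {1..n}"
  have N: "?N \<noteq> 0" by (simp add: Lcm_0_iff)
  have le: "p ^ multiplicity p ?N \<le> n \<and> p \<le> n" if p: "p \<in> prime_factors ?N" for p
  proof -
    have pr: "prime p" and m: "multiplicity p ?N > 0" using p by (auto simp: prime_factors_multiplicity)
    obtain i where i: "i \<in> {1..n}" "p ^ multiplicity p ?N dvd i"
      using prime_power_dvd_Lcm[OF pr multiplicity_dvd m] by blast
    then have "p ^ multiplicity p ?N \<le> n" using dvd_imp_le[of _ i] by fastforce
    moreover have "p \<le> p ^ multiplicity p ?N" by (rule self_le_power[OF prime_ge_1_nat[OF pr] m])
    ultimately show ?thesis by simp
  qed
  show ?thesis by (rule le_power_primes[OF N[unfolded neq0_conv] assms le])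
qed

text \<open>Without a prime in the interval, \<open>Lcm {1..2 * m + 1}\<close> would have at most
  \<open>R\<close> distinct prime factors and be at most \<open>(16 * R\<^sup>2) ^ R\<close>, yet
  the central binomial coefficient forces it to be at least \<open>4 ^ m\<close>. A quadratically
  long interval is short enough for the parameters and permits crude estimates.\<close>

lemma exists_prime_between:
  fixes R :: nat
  assumes "R \<ge> 1"
  shows "\<exists>p. prime p \<and> R < p \<and> p \<le> 16 * R\<^sup>2"
proof (rule ccontr)
  assume no: "\<not> ?thesis"
  \<comment> \<open>The largest \<open>m\<close> with
    \<open>2 * m + 1 \<le> 16 * R\<^sup>2\<close>.\<close>
  define m where "m = 8 * R\<^sup>2 - 1"
  have R2: "R\<^sup>2 \<ge> R" "R\<^sup>2 \<ge> 1" using assms by (simp_all add: power2_eq_square)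
  have m: "2 * m + 1 \<le> 16 * R\<^sup>2" "m > 0" "m \<ge> 7 * R\<^sup>2" unfolding m_def using R2 by auto
  have "{p. prime p \<and> p \<le> 2 * m + 1} \<subseteq> {1..R}"
  proof
    fix p assume "p \<in> {p. prime p \<and> p \<le> 2 * m + 1}"
    then have "prime p" "p \<le> 16 * R\<^sup>2" using m(1) by auto
    then show "p \<in> {1..R}" using no prime_ge_1_nat[of p] by (auto simp: not_less)
  qed
  from card_mono[OF finite_atLeastAtMost this]
  have card: "card {p. prime p \<and> p \<le> 2 * m + 1} \<le> R" by simp
  have "4 ^ m \<le> (2 * m + 1) * (2 * m choose m)"
  proof -
    have "4 ^ m / (2 * real m) \<le> real (2 * m choose m)" using central_binomial_lower_bound[OF m(2)] .
    then have "4 ^ m \<le> 2 * real m * real (2 * m choose m)" using m(2) by (simp add: field_simps)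
    also have "\<dots> \<le> real ((2 * m + 1) * (2 * m choose m))" by (simp add: algebra_simps)
    finally show ?thesis by (metis of_nat_le_iff of_nat_numeral of_nat_power)
  qed
  also have "\<dots> \<le> Lcm {1..2 * m + 1}"
    by (rule dvd_imp_le[OF leibniz_triangle_dvd_Lcm]) (auto intro: Nat.gr0I simp: Lcm_0_iff)
  also have "\<dots> \<le> (2 * m + 1) ^ card {p. prime p \<and> p \<le> 2 * m + 1}"
    by (rule Lcm_le_power_primes) simp
  also have "\<dots> \<le> (2 * m + 1) ^ R" by (rule power_increasing[OF card]) simp
  also have "\<dots> \<le> (16 * R\<^sup>2) ^ R" by (rule power_mono[OF m(1)]) simp
  also have "16 * R\<^sup>2 \<le> 2 ^ (4 + 2 * R)"
  proof -
    have "R\<^sup>2 \<le> (2 ^ R)\<^sup>2" by (rule power_mono) (auto intro: less_imp_le)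
    then show ?thesis by (simp add: power_add power_mult power2_eq_square flip: power_mult_distrib)
  qed
  then have "(16 * R\<^sup>2) ^ R \<le> (2 ^ (4 + 2 * R)) ^ R" by (rule power_mono) simp
  finally have "(2::nat) ^ (2 * m) \<le> 2 ^ ((4 + 2 * R) * R)" by (simp add: power_mult)
  then have "2 * m \<le> (4 + 2 * R) * R" by simp
  also have "\<dots> = 4 * R + 2 * R\<^sup>2" by (simp add: algebra_simps power2_eq_square)
  finally show False using m(3) R2 by linarith
qed

section \<open>Correlations under translations along lines\<close>

text \<open>A finite abelian group \<open>G\<close> with subgroups \<open>w x ` {..<q}\<close>, any \<open>r\<close> of which generate \<open>G\<close>.\<close>

locale line_group =
  fixes G :: "'v set" and add :: "'v \<Rightarrow> 'v \<Rightarrow> 'v" (infixl "\<oplus>" 65) and zero :: 'v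
    and q r :: nat and w :: "nat \<Rightarrow> nat \<Rightarrow> 'v"
  assumes fin: "finite G"
    and zero: "zero \<in> G"
    and closed: "\<And>u v. u \<in> G \<Longrightarrow> v \<in> G \<Longrightarrow> u \<oplus> v \<in> G"
    and assoc: "\<And>u v x. u \<in> G \<Longrightarrow> v \<in> G \<Longrightarrow> x \<in> G \<Longrightarrow> u \<oplus> v \<oplus> x = u \<oplus> (v \<oplus> x)"
    and comm: "\<And>u v. u \<in> G \<Longrightarrow> v \<in> G \<Longrightarrow> u \<oplus> v = v \<oplus> u"
    and add_zero: "\<And>v. v \<in> G \<Longrightarrow> v \<oplus> zero = v"
    and cancel: "\<And>u v x. u \<in> G \<Longrightarrow> v \<in> G \<Longrightarrow> x \<in> G \<Longrightarrow> u \<oplus> x = v \<oplus> x \<Longrightarrow> u = v"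
    and q: "q > 0" and r: "r > 0"
    and w_in: "\<And>x a. x < q \<Longrightarrow> a < q \<Longrightarrow> w x a \<in> G"
    and w_add: "\<And>x a b. x < q \<Longrightarrow> a < q \<Longrightarrow> b < q \<Longrightarrow> w x a \<oplus> w x b = w x ((a + b) mod q)"
    and span: "\<And>xs (f :: 'v \<Rightarrow> real) v. distinct xs \<Longrightarrow> set xs \<subseteq> {..<q} \<Longrightarrow> length xs = r \<Longrightarrow>
      (\<And>x a v. x \<in> set xs \<Longrightarrow> a < q \<Longrightarrow> v \<in> G \<Longrightarrow> f (v \<oplus> w x a) = f v) \<Longrightarrow> v \<in> G \<Longrightarrow> f v = f zero"
begin

lemma swap: "u \<in> G \<Longrightarrow> v \<in> G \<Longrightarrow> x \<in> G \<Longrightarrow> u \<oplus> v \<oplus> x = u \<oplus> x \<oplus> v"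
  by (simp add: assoc comm[of v x])

lemma sum_shift:
  fixes f :: "'v \<Rightarrow> real"
  assumes "c \<in> G"
  shows "(\<Sum>v\<in>G. f (v \<oplus> c)) = (\<Sum>v\<in>G. f v)"
proof (rule sum.reindex_bij_betw)
  have "inj_on (\<lambda>v. v \<oplus> c) G" using cancel assms by (auto intro: inj_onI)
  moreover have "(\<lambda>v. v \<oplus> c) ` G \<subseteq> G" using closed assms by auto
  ultimately show "bij_betw (\<lambda>v. v \<oplus> c) G G"
    using endo_inj_surj[OF fin] by (auto simp: bij_betw_def)
qed

section \<open>Averaging along lines as orthogonal projection\<close>

definition ip :: "('v \<Rightarrow> real) \<Rightarrow> ('v \<Rightarrow> real) \<Rightarrow> real" where
  "ip f g = (\<Sum>v\<in>G. f v * g v)"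

text \<open>The orthogonal projection onto the functions that are constant on the cosets of the line
  in direction \<open>x\<close>.\<close>

definition P :: "nat \<Rightarrow> ('v \<Rightarrow> real) \<Rightarrow> 'v \<Rightarrow> real" where
  "P x f v = (\<Sum>a<q. f (v \<oplus> w x a)) / q"

definition inv :: "nat \<Rightarrow> ('v \<Rightarrow> real) \<Rightarrow> bool" where
  "inv x f \<longleftrightarrow> (\<forall>a<q. \<forall>v\<in>G. f (v \<oplus> w x a) = f v)"

lemma ip_cong: "(\<And>v. v \<in> G \<Longrightarrow> f v = f' v) \<Longrightarrow> (\<And>v. v \<in> G \<Longrightarrow> g v = g' v) \<Longrightarrow> ip f g = ip f' g'"
  unfolding ip_def by (rule sum.cong) auto

lemma ip_self_nonneg: "ip f f \<ge> 0"
  unfolding ip_def by (rule sum_nonneg) simp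

lemma P_cong:
  assumes "x < q" "\<And>v. v \<in> G \<Longrightarrow> f v = g v" "v \<in> G"
  shows "P x f v = P x g v"
  unfolding P_def using assms by (intro arg_cong2[where f = "(/)"] sum.cong) (auto simp: closed w_in)

lemma P_inv:
  assumes x: "x < q"
  shows "inv x (P x f)"
proof -
  have "P x f (v \<oplus> w x b) = P x f v" if b: "b < q" and v: "v \<in> G" for b v
  proof -
    have "(\<Sum>a<q. f (v \<oplus> w x b \<oplus> w x a)) = (\<Sum>a<q. f (v \<oplus> w x ((a + b) mod q)))"
      using x b v by (intro sum.cong refl) (auto simp: assoc w_in w_add add.commute)
    also have "\<dots> = (\<Sum>a<q. f (v \<oplus> w x a))"
    proof (rule sum.reindex_bij_betw[where g = "\<lambda>a. f (v \<oplus> w x a)"])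
      have "inj_on (\<lambda>a. (a + b) mod q) {..<q}"
      proof (rule inj_onI)
        fix a a' assume "a \<in> {..<q}" "a' \<in> {..<q}" "(a + b) mod q = (a' + b) mod q"
        then have "[a + b = a' + b] (mod q)" by (simp add: cong_def)
        then have "[a = a'] (mod q)" by (simp add: cong_add_rcancel_nat)
        then show "a = a'" using \<open>a \<in> _\<close> \<open>a' \<in> _\<close> by (simp add: cong_def)
      qed
      moreover have "(\<lambda>a. (a + b) mod q) ` {..<q} \<subseteq> {..<q}" using q by auto
      ultimately show "bij_betw (\<lambda>a. (a + b) mod q) {..<q} {..<q}"
        using endo_inj_surj[OF finite_lessThan] by (auto simp: bij_betw_def)
    qed
    finally show ?thesis unfolding P_def by simp
  qed
  then show ?thesis unfolding inv_def by blast
qed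

lemma inv_P:
  assumes "x < q" "y < q" "inv y f"
  shows "inv y (P x f)"
  unfolding inv_def
proof (intro allI impI ballI)
  fix a v assume a: "a < q" and v: "v \<in> G"
  have "f (v \<oplus> w y a \<oplus> w x b) = f (v \<oplus> w x b)" if "b < q" for b
    using assms a v that swap[of v "w y a" "w x b"] unfolding inv_def by (simp add: w_in closed)
  then show "P x f (v \<oplus> w y a) = P x f v" unfolding P_def by simp
qed

lemma P_diff: "P x (\<lambda>v. f v - g v) = (\<lambda>v. P x f v - P x g v)"
  unfolding P_def by (simp add: sum_subtractf diff_divide_distrib)

lemma P_commute:
  assumes "x < q" "y < q" "v \<in> G"
  shows "P x (P y f) v = P y (P x f) v"
proof -
  have "(\<Sum>a<q. \<Sum>b<q. f (v \<oplus> w x a \<oplus> w y b)) = (\<Sum>a<q. \<Sum>b<q. f (v \<oplus> w y b \<oplus> w x a))"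
    using assms by (intro sum.cong refl arg_cong[of _ _ f] swap) (auto simp: w_in)
  also have "\<dots> = (\<Sum>b<q. \<Sum>a<q. f (v \<oplus> w y b \<oplus> w x a))" by (rule sum.swap)
  finally show ?thesis unfolding P_def by (simp flip: sum_divide_distrib)
qed

text \<open>Each translation can be applied to the whole summand, because it leaves the invariant
  factor \<open>h\<close> alone, and then disappears in the sum over \<open>G\<close>.\<close>

lemma ip_P_inv:
  assumes x: "x < q" and h: "inv x h"
  shows "ip (P x f) h = ip f h"
proof -
  have "ip (P x f) h = (\<Sum>v\<in>G. \<Sum>a<q. f (v \<oplus> w x a) * h v) / q"
    unfolding ip_def P_def by (simp add: sum_distrib_right sum_divide_distrib)
  also have "(\<Sum>v\<in>G. \<Sum>a<q. f (v \<oplus> w x a) * h v) = (\<Sum>a<q. \<Sum>v\<in>G. f (v \<oplus> w x a) * h v)"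
    by (rule sum.swap)
  also have "\<dots> = (\<Sum>a<q. \<Sum>v\<in>G. f (v \<oplus> w x a) * h (v \<oplus> w x a))"
    using h unfolding inv_def by (intro sum.cong refl) auto
  also have "\<dots> = (\<Sum>a<q. \<Sum>v\<in>G. f v * h v)"
  proof (rule sum.cong[OF refl])
    fix a assume "a \<in> {..<q}"
    then have "w x a \<in> G" using x w_in by simp
    from sum_shift[OF this] show "(\<Sum>v\<in>G. f (v \<oplus> w x a) * h (v \<oplus> w x a)) = (\<Sum>v\<in>G. f v * h v)" .
  qed
  also have "\<dots> / q = ip f h" using q by (simp add: ip_def)
  finally show ?thesis .
qed

lemma ip_diff_left: "ip (\<lambda>v. f v - g v) h = ip f h - ip g h"
  and ip_diff_right: "ip h (\<lambda>v. f v - g v) = ip h f - ip h g"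
  and ip_commute: "ip f g = ip g f"
  unfolding ip_def by (simp_all add: algebra_simps sum_subtractf)

lemma pythagoras:
  assumes "x < q"
  shows "ip f f = ip (P x f) (P x f) + ip (\<lambda>v. f v - P x f v) (\<lambda>v. f v - P x f v)"
  using ip_P_inv[OF assms P_inv[OF assms], of f f] ip_commute[of f "P x f"]
  by (simp add: ip_diff_left ip_diff_right)

lemma sum_P:
  assumes "x < q"
  shows "(\<Sum>v\<in>G. P x f v) = (\<Sum>v\<in>G. f v)"
  using ip_P_inv[OF assms, of "\<lambda>_. 1" f] by (simp add: ip_def inv_def)

definition PP :: "nat list \<Rightarrow> ('v \<Rightarrow> real) \<Rightarrow> 'v \<Rightarrow> real" where
  "PP xs f = foldr P xs f"

lemma PP_simps [simp]: "PP [] f = f" "PP (x # xs) f = P x (PP xs f)"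
  by (simp_all add: PP_def)

lemma PP_append: "PP (xs @ ys) f = PP xs (PP ys f)"
  by (simp add: PP_def)

lemma PP_diff: "PP xs (\<lambda>v. f v - g v) = (\<lambda>v. PP xs f v - PP xs g v)"
  by (induction xs) (auto simp: P_diff)

lemma PP_P_commute:
  "set xs \<subseteq> {..<q} \<Longrightarrow> x < q \<Longrightarrow> v \<in> G \<Longrightarrow> PP xs (P x f) v = P x (PP xs f) v"
proof (induction xs arbitrary: v)
  case (Cons y xs)
  have "PP (y # xs) (P x f) v = P y (P x (PP xs f)) v"
    using Cons by (auto intro!: P_cong)
  then show ?case using Cons.prems P_commute[of y x v] by simp
qed simp

lemma sum_PP: "set xs \<subseteq> {..<q} \<Longrightarrow> (\<Sum>v\<in>G. PP xs f v) = (\<Sum>v\<in>G. f v)"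
  by (induction xs) (auto simp: sum_P)

lemma inv_PP: "set xs \<subseteq> {..<q} \<Longrightarrow> x \<in> set xs \<Longrightarrow> inv x (PP xs f)"
proof (induction xs)
  case (Cons y xs)
  show ?case
  proof (cases "x = y")
    case True
    then show ?thesis using P_inv Cons.prems by simp
  next
    case False
    then show ?thesis using Cons by (auto intro!: inv_P)
  qed
qed simp

lemma ip_PP_inv:
  "set xs \<subseteq> {..<q} \<Longrightarrow> (\<And>x. x \<in> set xs \<Longrightarrow> inv x h) \<Longrightarrow> ip (PP xs f) h = ip f h"
  by (induction xs) (auto simp: ip_P_inv)

text \<open>Averaging over \<open>r\<close> distinct directions makes a function invariant under all
  of them, hence constant by \<open>span\<close>; the constant is the mean, which averaging
  preserves.\<close>

lemma PP_eq_0: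
  assumes xs: "distinct xs" "set xs \<subseteq> {..<q}" "length xs = r" and g: "(\<Sum>v\<in>G. g v) = 0" and v: "v \<in> G"
  shows "PP xs g v = 0"
proof -
  have const: "PP xs g u = PP xs g zero" if "u \<in> G" for u
    using span[OF xs, of "PP xs g"] inv_PP[OF xs(2)] that unfolding inv_def by blast
  have "0 = (\<Sum>v\<in>G. PP xs g v)" using sum_PP[OF xs(2)] g by simp
  also have "\<dots> = card G * PP xs g zero" using const by simp
  finally have "PP xs g zero = 0" using fin zero by auto
  then show ?thesis using const[OF v] by simp
qed

text \<open>The \<open>P x\<close> are commuting orthogonal projections, hence simultaneously diagonalizable: on a vector killed
  by all products of \<open>s\<close> of them, at most \<open>s - 1\<close> of them act as the identity in each joint eigenspace.\<close>

lemma sum_ip_P_le: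
  assumes "finite X" "X \<subseteq> {..<q}" "s > 0"
    and "\<And>xs v. distinct xs \<Longrightarrow> set xs \<subseteq> X \<Longrightarrow> length xs = s \<Longrightarrow> v \<in> G \<Longrightarrow> PP xs g v = 0"
  shows "(\<Sum>x\<in>X. ip (P x g) (P x g)) \<le> real (s - 1) * ip g g"
  using assms
proof (induction X arbitrary: s g rule: finite_induct)
  case empty
  then show ?case by (simp add: ip_self_nonneg)
next
  case (insert x X)
  have x: "x < q" and X: "X \<subseteq> {..<q}" using insert.prems by auto
  define u where "u = P x g"
  define z where "z = (\<lambda>v. g v - P x g v)"
  have split: "ip (P y g) (P y g) = ip (P y u) (P y u) + ip (P y z) (P y z)" if "y \<in> X" for y
  proof -
    have y: "y < q" using that X by auto
    have "ip (P y g) (P y g) = ip (P x (P y g)) (P x (P y g)) +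
        ip (\<lambda>v. P y g v - P x (P y g) v) (\<lambda>v. P y g v - P x (P y g) v)"
      by (rule pythagoras[OF x])
    also have "ip (P x (P y g)) (P x (P y g)) = ip (P y u) (P y u)"
      unfolding u_def by (rule ip_cong) (auto intro: P_commute x y)
    also have "ip (\<lambda>v. P y g v - P x (P y g) v) (\<lambda>v. P y g v - P x (P y g) v) = ip (P y z) (P y z)"
      unfolding z_def P_diff by (rule ip_cong) (auto intro: P_commute x y)
    finally show ?thesis .
  qed
  \<comment> \<open>\<open>P x\<close> kills \<open>z\<close>, so direction \<open>x\<close>
    contributes nothing, and \<open>z\<close> inherits the hypothesis with the same
    \<open>s\<close>.\<close>
  have z: "(\<Sum>y\<in>X. ip (P y z) (P y z)) \<le> real (s - 1) * ip z z"
  proof (rule insert.IH[OF X insert.prems(2)])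
    fix xs v assume xs: "distinct xs" "set xs \<subseteq> X" "length xs = s" and v: "v \<in> G"
    have 0: "PP xs g v = 0" if "v \<in> G" for v using insert.prems(3)[of xs v] xs that by auto
    have "PP xs (P x g) v = P x (PP xs g) v" using xs X x v by (intro PP_P_commute) auto
    also have "\<dots> = P x (\<lambda>_. 0) v" using 0 x v by (intro P_cong) auto
    finally show "PP xs z v = 0" unfolding z_def PP_diff using 0[OF v] by (simp add: P_def)
  qed
  \<comment> \<open>\<open>P x\<close> fixes \<open>u\<close>, so direction \<open>x\<close>
    contributes all of \<open>ip u u\<close>; in return, products of only \<open>s - 1\<close> of
    the remaining projections already kill \<open>u\<close>.\<close>
  have u: "(\<Sum>y\<in>X. ip (P y u) (P y u)) + ip u u \<le> real (s - 1) * ip u u"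
  proof (cases "s = 1")
    case True
    have "u v = 0" if "v \<in> G" for v
      using insert.prems(3)[of "[x]" v] that True unfolding u_def by simp
    then have u0: "ip (P y u) (P y u) = 0" if "y \<in> X" for y
    proof -
      have "P y u v = 0" if "v \<in> G" for v
        using P_cong[of y u "\<lambda>_. 0" v] \<open>\<And>v. v \<in> G \<Longrightarrow> u v = 0\<close> \<open>y \<in> X\<close> X that by (auto simp: P_def)
      then show ?thesis by (simp add: ip_def)
    qed
    have "ip u u = 0" using \<open>\<And>v. v \<in> G \<Longrightarrow> u v = 0\<close> by (simp add: ip_def)
    then show ?thesis using u0 by simp
  next
    case False
    then have s: "s - 1 > 0" using insert.prems by simp
    have "(\<Sum>y\<in>X. ip (P y u) (P y u)) \<le> real (s - 1 - 1) * ip u u"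
    proof (rule insert.IH[OF X s])
      fix xs v assume xs: "distinct xs" "set xs \<subseteq> X" "length xs = s - 1" and v: "v \<in> G"
      have "PP (xs @ [x]) g v = 0"
        using xs v insert.hyps s by (intro insert.prems(3)) auto
      then show "PP xs u v = 0" unfolding u_def PP_append by simp
    qed
    moreover have "real (s - 1) = real (s - 1 - 1) + 1" using s by simp
    ultimately show ?thesis by (simp add: algebra_simps)
  qed
  have "(\<Sum>y\<in>insert x X. ip (P y g) (P y g)) =
      ((\<Sum>y\<in>X. ip (P y u) (P y u)) + ip u u) + (\<Sum>y\<in>X. ip (P y z) (P y z))"
    using insert.hyps split by (simp add: sum.distrib u_def)
  also have "\<dots> \<le> real (s - 1) * (ip u u + ip z z)" using add_mono[OF u z] by (simp only: distrib_left)
  also have "ip u u + ip z z = ip g g" unfolding u_def z_def using pythagoras[OF x, of g] by (rule sym)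
  finally show ?case .
qed

section \<open>Contraction by averaging, and translations that nearly decorrelate\<close>

definition lam :: real where "lam = real (r - 1) / q"

text \<open>The \<open>q\<close> squared norms sum to at most \<open>r - 1\<close> times that of
  \<open>g\<close>, so the smallest is at most the fraction \<open>lam\<close> of it.\<close>

lemma contract_once:
  assumes "(\<Sum>v\<in>G. g v) = 0"
  shows "\<exists>x<q. ip (P x g) (P x g) \<le> lam * ip g g"
proof (rule ccontr)
  assume "\<not> ?thesis"
  then have "(\<Sum>x<q. lam * ip g g) < (\<Sum>x<q. ip (P x g) (P x g))"
    using q by (intro sum_strict_mono) (auto simp: not_le)
  also have "\<dots> \<le> real (r - 1) * ip g g"
    by (rule sum_ip_P_le) (use r PP_eq_0 assms in auto)
  finally show False using q by (simp add: lam_def)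
qed

lemma contract:
  assumes "(\<Sum>v\<in>G. g v) = 0"
  shows "\<exists>xs. length xs = t \<and> set xs \<subseteq> {..<q} \<and> ip (PP xs g) (PP xs g) \<le> lam ^ t * ip g g"
proof (induction t)
  case (Suc t)
  then obtain xs where xs: "length xs = t" "set xs \<subseteq> {..<q}" "ip (PP xs g) (PP xs g) \<le> lam ^ t * ip g g"
    by blast
  have "(\<Sum>v\<in>G. PP xs g v) = 0" using sum_PP[OF xs(2)] assms by simp
  then obtain x where x: "x < q" "ip (P x (PP xs g)) (P x (PP xs g)) \<le> lam * ip (PP xs g) (PP xs g)"
    using contract_once by blast
  have "lam * ip (PP xs g) (PP xs g) \<le> lam * (lam ^ t * ip g g)"
    using xs(3) by (intro mult_left_mono) (auto simp: lam_def)
  then show ?case using x xs(1,2) by (intro exI[of _ "x # xs"]) auto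
qed auto

text \<open>There are at most \<open>(q * q) ^ t\<close> of these vectors, which for small
  \<open>t\<close> is far less than the size of \<open>G\<close>; the search for translations is
  confined to them.\<close>

primrec lsums :: "nat \<Rightarrow> 'v set" where
  "lsums 0 = {zero}"
| "lsums (Suc t) = {d \<oplus> w x a | d x a. d \<in> lsums t \<and> x < q \<and> a < q}"

lemma lsums_G: "lsums t \<subseteq> G"
  by (induction t) (auto simp: zero closed w_in)

text \<open>The right side is the average of the left side over all translations along the
  directions \<open>xs\<close>. A translation not above the average is fixed one direction at a
  time.\<close>

lemma ip_lsum_le:
  "set xs \<subseteq> {..<q} \<Longrightarrow> \<exists>d\<in>lsums (length xs). ip g (\<lambda>v. u (v \<oplus> d)) \<le> ip g (PP xs u)"
proof (induction xs arbitrary: u)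
  case Nil
  have "ip g (\<lambda>v. u (v \<oplus> zero)) = ip g u" by (rule ip_cong) (auto simp: add_zero)
  then show ?case by simp
next
  case (Cons x xs)
  have x: "x < q" and xs: "set xs \<subseteq> {..<q}" using Cons.prems by auto
  define h where "h = PP xs u"
  have "\<exists>a<q. ip g (\<lambda>v. h (v \<oplus> w x a)) \<le> ip g (P x h)"
  proof (rule ccontr)
    assume "\<not> ?thesis"
    then have "(\<Sum>a<q. ip g (P x h)) < (\<Sum>a<q. ip g (\<lambda>v. h (v \<oplus> w x a)))"
      using q by (intro sum_strict_mono) (auto simp: not_le)
    also have "\<dots> = (\<Sum>v\<in>G. \<Sum>a<q. g v * h (v \<oplus> w x a))"
      unfolding ip_def by (rule sum.swap)
    also have "\<dots> = (\<Sum>v\<in>G. q * (g v * P x h v))"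
      using q by (intro sum.cong refl) (simp add: P_def flip: sum_distrib_left)
    also have "\<dots> = q * ip g (P x h)"
      by (simp add: ip_def sum_distrib_left)
    finally show False by simp
  qed
  then obtain a where a: "a < q" "ip g (\<lambda>v. h (v \<oplus> w x a)) \<le> ip g (P x h)" by blast
  \<comment> \<open>Translations commute, so the shift by \<open>w x a\<close> can be moved through
    the averages and absorbed into the function.\<close>
  define u' where "u' = (\<lambda>v. u (v \<oplus> w x a))"
  have shift: "PP ys u (v \<oplus> w x a) = PP ys u' v" if "set ys \<subseteq> {..<q}" "v \<in> G" for ys v
    using that
  proof (induction ys arbitrary: v)
    case (Cons y ys)
    have "PP ys u (v \<oplus> w x a \<oplus> w y b) = PP ys u' (v \<oplus> w y b)" if b: "b < q" for b
    proof -
      have "v \<oplus> w x a \<oplus> w y b = v \<oplus> w y b \<oplus> w x a"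
        using Cons.prems x a b by (intro swap) (auto simp: w_in)
      then show ?thesis using Cons b by (auto simp: closed w_in)
    qed
    then show ?case by (simp add: P_def)
  qed (simp add: u'_def)
  have "ip g (\<lambda>v. h (v \<oplus> w x a)) = ip g (PP xs u')"
    unfolding h_def by (rule ip_cong) (auto simp: shift xs)
  moreover obtain d where d: "d \<in> lsums (length xs)" "ip g (\<lambda>v. u' (v \<oplus> d)) \<le> ip g (PP xs u')"
    using Cons.IH[OF xs] by blast
  moreover have "ip g (\<lambda>v. u' (v \<oplus> d)) = ip g (\<lambda>v. u (v \<oplus> (d \<oplus> w x a)))"
    unfolding u'_def using d lsums_G x a
    by (intro ip_cong refl arg_cong[of _ _ u] assoc) (auto simp: w_in)
  ultimately have "ip g (\<lambda>v. u (v \<oplus> (d \<oplus> w x a))) \<le> ip g (PP (x # xs) u)"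
    using a unfolding h_def by simp
  moreover have "d \<oplus> w x a \<in> lsums (length (x # xs))" using d x a by auto
  ultimately show ?case by blast
qed

text \<open>Subtracting the mean leaves \<open>g\<close>. Some translation does no worse than the
  average along \<open>t\<close> lines, which is the squared norm of the projection
  \<open>PP xs g\<close> and hence at most \<open>lam ^ t\<close> times that of
  \<open>g\<close>.\<close>

lemma correlation:
  fixes f :: "'v \<Rightarrow> real" and m :: real
  assumes f: "\<And>v. v \<in> G \<Longrightarrow> 0 \<le> f v \<and> f v \<le> 1" and m: "(\<Sum>v\<in>G. f v) = m * card G"
  shows "\<exists>d\<in>lsums t. (\<Sum>v\<in>G. f v * f (v \<oplus> d)) \<le> card G * (m\<^sup>2 + lam ^ t)"
proof -
  define g where "g = (\<lambda>v. f v - m)"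
  have g0: "(\<Sum>v\<in>G. g v) = 0" using m by (simp add: g_def sum_subtractf)
  obtain xs where xs: "length xs = t" "set xs \<subseteq> {..<q}" "ip (PP xs g) (PP xs g) \<le> lam ^ t * ip g g"
    using contract[OF g0] by blast
  obtain d where d: "d \<in> lsums t" "ip g (\<lambda>v. g (v \<oplus> d)) \<le> ip g (PP xs g)"
    using ip_lsum_le[OF xs(2)] xs(1) by blast
  have dG: "d \<in> G" using d lsums_G by auto
  have "ip g g \<le> card G"
  proof -
    have "ip g g = (\<Sum>v\<in>G. (f v)\<^sup>2 - 2 * m * f v + m\<^sup>2)"
      unfolding ip_def g_def by (simp add: power2_eq_square algebra_simps)
    also have "\<dots> = (\<Sum>v\<in>G. (f v)\<^sup>2) - 2 * m * (m * card G) + card G * m\<^sup>2"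
      by (simp add: sum.distrib sum_subtractf m flip: sum_distrib_left)
    also have "\<dots> \<le> (\<Sum>v\<in>G. (f v)\<^sup>2)"
      using mult_nonneg_nonneg[of "m * m" "real (card G)"] by (simp add: power2_eq_square algebra_simps)
    also have "\<dots> \<le> (\<Sum>v\<in>G. 1)" using f by (intro sum_mono) (auto simp: power_le_one)
    finally show ?thesis by simp
  qed
  have "ip g (\<lambda>v. g (v \<oplus> d)) \<le> ip (PP xs g) (PP xs g)"
    using d(2) ip_PP_inv[OF xs(2) inv_PP[OF xs(2)], of g g] by simp
  also have "\<dots> \<le> lam ^ t * ip g g" by (rule xs(3))
  also have "\<dots> \<le> lam ^ t * card G" using \<open>ip g g \<le> card G\<close> by (intro mult_left_mono) (auto simp: lam_def)
  finally have le: "ip g (\<lambda>v. g (v \<oplus> d)) \<le> lam ^ t * card G" .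
  have "(\<Sum>v\<in>G. f v * f (v \<oplus> d)) = (\<Sum>v\<in>G. g v * g (v \<oplus> d) + m * f v + m * f (v \<oplus> d) - m\<^sup>2)"
    unfolding g_def by (rule sum.cong) (auto simp: algebra_simps power2_eq_square)
  also have "\<dots> = ip g (\<lambda>v. g (v \<oplus> d)) + m * (m * card G) + m * (m * card G) - card G * m\<^sup>2"
    using sum_shift[OF dG, of f] by (simp add: sum.distrib sum_subtractf ip_def m flip: sum_distrib_left)
  also have "\<dots> \<le> card G * (m\<^sup>2 + lam ^ t)" using le by (simp add: power2_eq_square algebra_simps)
  finally show ?thesis using d(1) by blast
qed

text \<open>Translating by a further \<open>d\<close> doubles the cube and, by \<open>correlation\<close>, squares the mean of the
  product of \<open>f\<close> over it, up to a factor of two.\<close>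

primrec cubes :: "(nat \<Rightarrow> nat) \<Rightarrow> nat \<Rightarrow> 'v list set" where
  "cubes ts 0 = {[zero]}"
| "cubes ts (Suc i) = {C @ map (\<lambda>c. c \<oplus> d) C | C d. C \<in> cubes ts i \<and> d \<in> lsums (ts i)}"

lemma length_cubes: "C \<in> cubes ts i \<Longrightarrow> length C = 2 ^ i"
  by (induction i arbitrary: C) auto

lemma cubes_G: "C \<in> cubes ts i \<Longrightarrow> set C \<subseteq> G"
proof (induction i arbitrary: C)
  case (Suc i)
  then show ?case using lsums_G closed by (auto simp: subset_iff)
qed (auto simp: zero)

text \<open>The bound carries a factor 1/2 beyond \<open>(1/2) ^ 2 ^ I\<close>. Squaring turns it
  into 1/4, and another 1/4 is left for the correlation error that \<open>ts\<close> permits. For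
  the one-point cube the bound is just the mean 1/4.\<close>

lemma cube_exists:
  fixes f :: "'v \<Rightarrow> real"
  assumes f: "\<And>v. v \<in> G \<Longrightarrow> 0 \<le> f v \<and> f v \<le> 1" and f4: "(\<Sum>v\<in>G. f v) \<le> card G / 4"
    and ts: "\<And>i. i < I \<Longrightarrow> lam ^ ts i \<le> (1/4) * (1/4) ^ 2 ^ i"
  shows "\<exists>C\<in>cubes ts I. (\<Sum>v\<in>G. prod_list (map (\<lambda>c. f (v \<oplus> c)) C)) \<le> card G * ((1/2) * (1/2) ^ 2 ^ I)"
  using ts
proof (induction I)
  case 0
  have "(\<Sum>v\<in>G. f (v \<oplus> zero)) = (\<Sum>v\<in>G. f v)" by (rule sum.cong) (auto simp: add_zero)
  then show ?case using f4 by simp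
next
  case (Suc I)
  then obtain C where C: "C \<in> cubes ts I"
    "(\<Sum>v\<in>G. prod_list (map (\<lambda>c. f (v \<oplus> c)) C)) \<le> card G * ((1/2) * (1/2) ^ 2 ^ I)" by auto
  define F where "F = (\<lambda>v. prod_list (map (\<lambda>c. f (v \<oplus> c)) C))"
  have CG: "set C \<subseteq> G" using cubes_G[OF C(1)] .
  have F: "0 \<le> F v \<and> F v \<le> 1" if v: "v \<in> G" for v
  proof -
    have "0 \<le> prod_list (map (\<lambda>c. f (v \<oplus> c)) D) \<and> prod_list (map (\<lambda>c. f (v \<oplus> c)) D) \<le> 1"
      if "set D \<subseteq> G" for D
      using that f v closed by (induction D) (auto intro: mult_le_one)
    then show ?thesis unfolding F_def using CG by blast
  qed
  have G0: "card G > 0" using fin zero by (auto simp: card_gt_0_iff)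
  define m where "m = (\<Sum>v\<in>G. F v) / card G"
  have m: "(\<Sum>v\<in>G. F v) = m * card G" using G0 by (simp add: m_def)
  obtain d where d: "d \<in> lsums (ts I)" "(\<Sum>v\<in>G. F v * F (v \<oplus> d)) \<le> card G * (m\<^sup>2 + lam ^ ts I)"
    using correlation[of F m "ts I"] F m by blast
  have dG: "d \<in> G" using d lsums_G by auto
  have "m \<ge> 0" unfolding m_def using F by (intro divide_nonneg_nonneg sum_nonneg) auto
  moreover have "m \<le> (1/2) * (1/2) ^ 2 ^ I" using C(2) G0 unfolding m_def F_def by (simp add: field_simps)
  ultimately have "m\<^sup>2 \<le> ((1/2) * (1/2) ^ 2 ^ I)\<^sup>2" by (rule power_mono[rotated])
  also have "\<dots> = (1/4) * (1/2) ^ 2 ^ Suc I"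
    by (simp add: power2_eq_square power_mult[symmetric] power_add[symmetric] mult_2)
  finally have m2: "m\<^sup>2 \<le> (1/4) * (1/2) ^ 2 ^ Suc I" .
  have "(1/4::real) ^ 2 ^ I = (1/2) ^ 2 ^ Suc I"
    using power_mult[of "1/2::real" 2 "2 ^ I"] by (simp add: power2_eq_square)
  then have "lam ^ ts I \<le> (1/4) * (1/2) ^ 2 ^ Suc I" using Suc.prems[of I] by simp
  with m2 have "m\<^sup>2 + lam ^ ts I \<le> (1/2) * (1/2) ^ 2 ^ Suc I" by simp
  then have "card G * (m\<^sup>2 + lam ^ ts I) \<le> card G * ((1/2) * (1/2) ^ 2 ^ Suc I)"
    by (rule mult_left_mono) simp
  moreover have "(\<Sum>v\<in>G. prod_list (map (\<lambda>c. f (v \<oplus> c)) (C @ map (\<lambda>c. c \<oplus> d) C))) = (\<Sum>v\<in>G. F v * F (v \<oplus> d))"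
  proof (rule sum.cong[OF refl])
    fix v assume v: "v \<in> G"
    have "f (v \<oplus> (c \<oplus> d)) = f (v \<oplus> d \<oplus> c)" if "c \<in> set C" for c
      using that CG v dG assoc[of v d c] comm[of d c] by auto
    then have eq: "map (\<lambda>c. f (v \<oplus> c)) (map (\<lambda>c. c \<oplus> d) C) = map (\<lambda>c. f (v \<oplus> d \<oplus> c)) C" by simp
    show "prod_list (map (\<lambda>c. f (v \<oplus> c)) (C @ map (\<lambda>c. c \<oplus> d) C)) = F v * F (v \<oplus> d)"
      unfolding F_def map_append prod_list.append eq ..
  qed
  ultimately have "(\<Sum>v\<in>G. prod_list (map (\<lambda>c. f (v \<oplus> c)) (C @ map (\<lambda>c. c \<oplus> d) C)))
      \<le> card G * ((1/2) * (1/2) ^ 2 ^ Suc I)" using d(2) by linarith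
  moreover have "C @ map (\<lambda>c. c \<oplus> d) C \<in> cubes ts (Suc I)" using C(1) d(1) by auto
  ultimately show ?case by blast
qed

end

section \<open>Hitting families\<close>

fun hd0 :: "nat list \<Rightarrow> nat" where
  "hd0 [] = 0"
| "hd0 (x # xs) = x"

lemma hd0_drop: "j < length xs \<Longrightarrow> hd0 (drop j xs) = xs ! j"
  by (metis Cons_nth_drop_Suc hd0.simps(2))

text \<open>The modulus is written \<open>Suc m\<close> so that it is positive for every enumerated
  parameter, prime or not. Indexing by \<open>hd0\<close> and \<open>drop\<close> is total; its
  default 0 has the code \<open>Nl\<close>, which is what \<open>Fst\<close> returns on the empty
  list.\<close>

definition vadd :: "nat \<Rightarrow> nat \<Rightarrow> nat list \<Rightarrow> nat list \<Rightarrow> nat list" where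
  "vadd m r u v = map (\<lambda>j. (hd0 (drop j u) + hd0 (drop j v)) mod Suc m) [0..<r]"

definition null_vec :: "nat \<Rightarrow> nat list" where
  "null_vec r = map (\<lambda>_. 0) [0..<r]"

text \<open>Powers are reduced after every factor, because the unary numeral of \<open>x ^ j\<close>
  would be too long.\<close>

definition gen :: "nat \<Rightarrow> nat \<Rightarrow> nat \<Rightarrow> nat \<Rightarrow> nat list" where
  "gen m r x a = map (\<lambda>j. ((\<lambda>z. (z * x) mod Suc m) ^^ j) a) [0..<r]"

definition vspace :: "nat \<Rightarrow> nat \<Rightarrow> nat list set" where
  "vspace m r = {v. length v = r \<and> set v \<subseteq> {..<Suc m}}"

lemma length_vadd [simp]: "length (vadd m r u v) = r"
  by (simp add: vadd_def)

lemma vadd_nth: "j < r \<Longrightarrow> length u = r \<Longrightarrow> length v = r \<Longrightarrow> vadd m r u v ! j = (u ! j + v ! j) mod Suc m"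
  by (simp add: vadd_def hd0_drop)

lemma vspace_nth: "v \<in> vspace m r \<Longrightarrow> j < r \<Longrightarrow> v ! j < Suc m"
  unfolding vspace_def using nth_mem[of j v] by blast

lemma vspace_length: "v \<in> vspace m r \<Longrightarrow> length v = r"
  by (simp add: vspace_def)

lemma vspaceI: "length v = r \<Longrightarrow> (\<And>j. j < r \<Longrightarrow> v ! j < Suc m) \<Longrightarrow> v \<in> vspace m r"
  by (auto simp: vspace_def in_set_conv_nth)

lemma vspace_eqI: "u \<in> vspace m r \<Longrightarrow> v \<in> vspace m r \<Longrightarrow> (\<And>j. j < r \<Longrightarrow> u ! j = v ! j) \<Longrightarrow> u = v"
  by (rule nth_equalityI) (simp_all add: vspace_length)

lemma vadd_in: "vadd m r u v \<in> vspace m r"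
  by (rule vspaceI) (auto simp: vadd_def)

lemma card_vspace: "card (vspace m r) = Suc m ^ r"
  unfolding vspace_def using card_lists_length_eq[of "{..<Suc m}" r] by (simp add: conj_commute)

lemma finite_vspace: "finite (vspace m r)"
  unfolding vspace_def using finite_lists_length_eq[of "{..<Suc m}" r] by (simp add: conj_commute)

lemma null_vec_in: "null_vec r \<in> vspace m r"
  by (rule vspaceI) (auto simp: null_vec_def)

lemma mult_funpow_mod: "((\<lambda>z. (z * x) mod q) ^^ j) a mod q = (a * x ^ j) mod (q::nat)"
proof (induction j)
  case (Suc j)
  have "((\<lambda>z. (z * x) mod q) ^^ Suc j) a mod q = ((((\<lambda>z. (z * x) mod q) ^^ j) a mod q) * x) mod q"
    by (simp add: mod_mult_left_eq)
  also have "\<dots> = (a * x ^ j * x) mod q" unfolding Suc by (rule mod_mult_left_eq)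
  finally show ?case by (simp only: power_Suc mult.assoc mult.commute[of x])
qed simp

lemma gen_nth:
  assumes "a < Suc m" "j < r"
  shows "gen m r x a ! j = (a * x ^ j) mod Suc m"
proof -
  have "((\<lambda>z. (z * x) mod Suc m) ^^ j) a < Suc m" using assms(1) by (cases j) auto
  then have "((\<lambda>z. (z * x) mod Suc m) ^^ j) a = (a * x ^ j) mod Suc m"
    using mult_funpow_mod[where q = "Suc m" and x = x and j = j and a = a] by (simp only: mod_less)
  then show ?thesis using assms(2) by (simp add: gen_def)
qed

lemma gen_in: "a < Suc m \<Longrightarrow> gen m r x a \<in> vspace m r"
proof (rule vspaceI)
  fix j assume "a < Suc m" "j < r"
  then show "gen m r x a ! j < Suc m" by (subst gen_nth) auto
qed (simp add: gen_def)

text \<open>Vandermonde: testing against the polynomial that vanishes at all nodes but one.\<close>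

lemma vandermonde_mod:
  fixes c y :: "nat \<Rightarrow> int"
  assumes q: "prime q" and y: "\<And>i j. i < r \<Longrightarrow> j < r \<Longrightarrow> i \<noteq> j \<Longrightarrow> \<not> q dvd y i - y j"
    and c: "\<And>j. j < r \<Longrightarrow> q dvd (\<Sum>i<r. c i * y i ^ j)" and k: "k < r"
  shows "q dvd c k"
proof -
  define p where "p = (\<Prod>i\<in>{..<r} - {k}. [:- y i, 1:])"
  have "degree p \<le> card ({..<r} - {k})"
    unfolding p_def using degree_prod_sum_le[of "{..<r} - {k}" "\<lambda>i. [:- y i, 1:]"] by simp
  then have deg: "degree p < r" using k by simp
  have "poly p z = (\<Sum>j<r. coeff p j * z ^ j)" for z
    unfolding poly_altdef using deg
    by (intro sum.mono_neutral_left) (auto simp: coeff_eq_0 not_le)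
  then have "(\<Sum>i<r. c i * poly p (y i)) = (\<Sum>i<r. \<Sum>j<r. coeff p j * (c i * y i ^ j))"
    by (simp add: sum_distrib_left algebra_simps)
  also have "\<dots> = (\<Sum>j<r. coeff p j * (\<Sum>i<r. c i * y i ^ j))"
    by (subst sum.swap) (simp add: sum_distrib_left)
  also have "q dvd \<dots>" using c by (intro dvd_sum) auto
  finally have "q dvd (\<Sum>i<r. c i * poly p (y i))" .
  moreover have "(\<Sum>i<r. c i * poly p (y i)) = c k * poly p (y k)"
  proof -
    have "poly p (y i) = 0" if "i < r" "i \<noteq> k" for i
      unfolding p_def poly_prod using that by (intro prod_zero) auto
    then have "(\<Sum>i<r. c i * poly p (y i)) = (\<Sum>i\<in>{k}. c i * poly p (y i))"
      using k by (intro sum.mono_neutral_right) auto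
    then show ?thesis by simp
  qed
  ultimately have "q dvd c k \<or> q dvd poly p (y k)" using prime_dvd_mult_iff[OF q] by simp
  moreover have "\<not> q dvd poly p (y k)"
  proof
    assume "q dvd poly p (y k)"
    then obtain i where "i \<in> {..<r} - {k}" "q dvd y k - y i"
      unfolding p_def poly_prod using q by (auto simp: prime_dvd_prod_iff)
    then show False using y[of k i] k by auto
  qed
  ultimately show ?thesis by blast
qed

text \<open>\<open>comb r\<close> maps coefficient vectors to combinations of the \<open>r\<close>
  lines. By \<open>vandermonde_mod\<close> it is injective, hence onto the finite space. Adding the
  terms one by one never changes \<open>f\<close>, so its value everywhere is that at the null
  vector.\<close>

lemma gen_span:
  fixes f :: "nat list \<Rightarrow> real"
  assumes q: "prime (Suc m)" and xs: "distinct xs" "set xs \<subseteq> {..<Suc m}" "length xs = r"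
    and f: "\<And>x a v. x \<in> set xs \<Longrightarrow> a < Suc m \<Longrightarrow> v \<in> vspace m r \<Longrightarrow> f (vadd m r v (gen m r x a)) = f v"
    and v: "v \<in> vspace m r"
  shows "f v = f (null_vec r)"
proof -
  define comb where "comb k as = map (\<lambda>j. (\<Sum>i<k. as ! i * xs ! i ^ j) mod Suc m) [0..<r]" for k and as :: "nat list"
  have comb_in: "comb k as \<in> vspace m r" for k as
    by (rule vspaceI) (auto simp: comb_def)
  have comb_f: "f (comb k as) = f (null_vec r)" if "k \<le> r" "as \<in> vspace m r" for k as
    using that(1)
  proof (induction k)
    case 0
    have "comb 0 as = null_vec r" by (simp add: comb_def null_vec_def)
    then show ?case by simp
  next
    case (Suc k)
    have k: "k < r" "as ! k < Suc m" "xs ! k \<in> set xs" using Suc.prems xs(3) vspace_nth[OF that(2)] by auto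
    have "comb (Suc k) as = vadd m r (comb k as) (gen m r (xs ! k) (as ! k))"
    proof (rule vspace_eqI[OF comb_in vadd_in])
      fix j assume j: "j < r"
      have "vadd m r (comb k as) (gen m r (xs ! k) (as ! k)) ! j =
          ((\<Sum>i<k. as ! i * xs ! i ^ j) mod Suc m + (as ! k * xs ! k ^ j) mod Suc m) mod Suc m"
        using j k by (subst vadd_nth) (auto simp: comb_def gen_nth gen_def[THEN arg_cong[where f = length]])
      then show "comb (Suc k) as ! j = vadd m r (comb k as) (gen m r (xs ! k) (as ! k)) ! j"
        using j by (simp add: comb_def mod_add_eq)
    qed
    then show ?case using f[OF k(3,2) comb_in] Suc by simp
  qed
  have "inj_on (comb r) (vspace m r)"
  proof (rule inj_onI)
    fix as bs assume as: "as \<in> vspace m r" and bs: "bs \<in> vspace m r" and eq: "comb r as = comb r bs"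
    have "int (Suc m) dvd int (as ! k) - int (bs ! k)" if k: "k < r" for k
    proof (rule vandermonde_mod[where c = "\<lambda>i. int (as ! i) - int (bs ! i)" and y = "\<lambda>i. int (xs ! i)" and r = r])
      show "prime (int (Suc m))" using q by (simp only: prime_int_nat_transfer nat_int of_nat_0_le_iff simp_thms)
      show "\<not> int (Suc m) dvd int (xs ! i) - int (xs ! j)" if ij: "i < r" "j < r" "i \<noteq> j" for i j
      proof
        assume "int (Suc m) dvd int (xs ! i) - int (xs ! j)"
        then have "[xs ! i = xs ! j] (mod Suc m)" by (simp add: cong_iff_dvd_diff flip: cong_int_iff)
        moreover have "xs ! i < Suc m" "xs ! j < Suc m" using xs ij by (auto simp: subset_iff)
        ultimately have "xs ! i = xs ! j" by (simp add: cong_def)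
        then show False using xs ij by (simp add: nth_eq_iff_index_eq)
      qed
      show "int (Suc m) dvd (\<Sum>i<r. (int (as ! i) - int (bs ! i)) * int (xs ! i) ^ j)" if j: "j < r" for j
      proof -
        have "comb r as ! j = comb r bs ! j" using eq by simp
        then have "[(\<Sum>i<r. as ! i * xs ! i ^ j) = (\<Sum>i<r. bs ! i * xs ! i ^ j)] (mod Suc m)"
          using j by (simp add: comb_def cong_def)
        then have "[int (\<Sum>i<r. as ! i * xs ! i ^ j) = int (\<Sum>i<r. bs ! i * xs ! i ^ j)] (mod int (Suc m))"
          by (simp only: cong_int_iff)
        then show ?thesis by (simp add: cong_iff_dvd_diff left_diff_distrib sum_subtractf)
      qed
    qed (rule k)
    then show "as = bs"
    proof (intro vspace_eqI[OF as bs])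
      fix k assume k: "k < r"
      have "int (Suc m) dvd int (as ! k) - int (bs ! k)" using k by fact
      then have "[as ! k = bs ! k] (mod Suc m)" by (simp add: cong_iff_dvd_diff flip: cong_int_iff)
      then show "as ! k = bs ! k" using vspace_nth[OF as k] vspace_nth[OF bs k] by (simp add: cong_def)
    qed
  qed
  then have "comb r ` vspace m r = vspace m r"
    using endo_inj_surj[OF finite_vspace, of "comb r" m r] comb_in by blast
  then obtain as where "as \<in> vspace m r" "v = comb r as" using v by (metis imageE)
  then show ?thesis using comb_f[of r as] by simp
qed

lemma line_group_vspace:
  assumes q: "prime (Suc m)" and r: "r > 0"
  shows "line_group (vspace m r) (vadd m r) (null_vec r) (Suc m) r (gen m r)"
proof
  show "finite (vspace m r)" by (rule finite_vspace)
  show "null_vec r \<in> vspace m r" by (rule null_vec_in)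
  show "vadd m r u v \<in> vspace m r" for u v by (rule vadd_in)
  show "vadd m r (vadd m r u v) x = vadd m r u (vadd m r v x)"
    if "u \<in> vspace m r" "v \<in> vspace m r" "x \<in> vspace m r" for u v x
    by (rule vspace_eqI[OF vadd_in vadd_in]) (simp add: vadd_nth that[THEN vspace_length] mod_add_left_eq mod_add_right_eq add.assoc)
  show "vadd m r u v = vadd m r v u" if "u \<in> vspace m r" "v \<in> vspace m r" for u v
    by (simp add: vadd_def add.commute)
  show "vadd m r v (null_vec r) = v" if v: "v \<in> vspace m r" for v
  proof (rule vspace_eqI[OF vadd_in v])
    fix j assume j: "j < r"
    then show "vadd m r v (null_vec r) ! j = v ! j"
      using vspace_nth[OF v j] vspace_length[OF v] by (subst vadd_nth) (auto simp: null_vec_def)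
  qed
  show "u = v" if G: "u \<in> vspace m r" "v \<in> vspace m r" "x \<in> vspace m r" and eq: "vadd m r u x = vadd m r v x" for u v x
  proof (rule vspace_eqI[OF G(1,2)])
    fix j assume j: "j < r"
    have "(u ! j + x ! j) mod Suc m = (v ! j + x ! j) mod Suc m"
      using arg_cong[OF eq, of "\<lambda>l. l ! j"] j G[THEN vspace_length] by (simp add: vadd_nth)
    then have "[u ! j = v ! j] (mod Suc m)" by (simp flip: cong_def add: cong_add_rcancel_nat)
    then show "u ! j = v ! j" using vspace_nth[OF G(1) j] vspace_nth[OF G(2) j] by (simp add: cong_def)
  qed
  show "0 < Suc m" by simp
  show "0 < r" by (rule r)
  show "gen m r x a \<in> vspace m r" if "a < Suc m" for x a by (rule gen_in[OF that])
  show "vadd m r (gen m r x a) (gen m r x b) = gen m r x ((a + b) mod Suc m)" if "a < Suc m" "b < Suc m" for x a b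
  proof (rule vspace_eqI[OF vadd_in gen_in])
    fix j assume j: "j < r"
    have len: "length (gen m r x c) = r" for c by (simp add: gen_def)
    show "vadd m r (gen m r x a) (gen m r x b) ! j = gen m r x ((a + b) mod Suc m) ! j"
      using j that by (simp add: vadd_nth len gen_nth mod_add_eq mod_mult_left_eq distrib_right)
  qed simp
  show "f v = f (null_vec r)"
    if "distinct xs" "set xs \<subseteq> {..<Suc m}" "length xs = r"
      "\<And>x a v. x \<in> set xs \<Longrightarrow> a < Suc m \<Longrightarrow> v \<in> vspace m r \<Longrightarrow> f (vadd m r v (gen m r x a)) = f v"
      "v \<in> vspace m r" for xs and f :: "nat list \<Rightarrow> real" and v
    using gen_span[OF q that(1,2,3), of f v] that(4,5) by blast
qed

section \<open>From vectors to residues with fibres of nearly equal size\<close>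

definition hash :: "nat \<Rightarrow> nat \<Rightarrow> nat list \<Rightarrow> nat" where
  "hash m p v = fold (\<lambda>d z. (z * Suc m + d) mod Suc p) v 0"

text \<open>The numeral in base \<open>Suc m\<close> before reduction; it serves to count the fibres
  of \<open>hash\<close>.\<close>

definition code :: "nat \<Rightarrow> nat list \<Rightarrow> nat" where
  "code m v = fold (\<lambda>d z. z * Suc m + d) v 0"

lemma hash_code: "hash m p v = code m v mod Suc p"
proof -
  have "fold (\<lambda>d z. (z * Suc m + d) mod Suc p) v 0 mod Suc p = fold (\<lambda>d z. z * Suc m + d) v 0 mod Suc p"
  proof (induction v rule: rev_induct)
    case (snoc d v)
    then show ?case
      by (simp only: fold_append o_apply fold.simps id_apply mod_mod_trivial) (intro mod_add_cong mod_mult_cong refl)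
  qed simp
  moreover have "fold (\<lambda>d z. (z * Suc m + d) mod Suc p) v 0 < Suc p"
    by (induction v rule: rev_induct) auto
  ultimately show ?thesis by (simp add: hash_def code_def)
qed

lemma code_less: "set v \<subseteq> {..<Suc m} \<Longrightarrow> code m v < Suc m ^ length v"
proof (induction v rule: rev_induct)
  case (snoc d v)
  then have "code m v + 1 \<le> Suc m ^ length v" "d < Suc m" by auto
  then have "(code m v + 1) * Suc m \<le> Suc m ^ length v * Suc m" by (intro mult_le_mono1)
  with \<open>d < Suc m\<close> show ?case by (simp add: code_def algebra_simps)
qed (simp add: code_def)

lemma code_inj:
  "length u = length v \<Longrightarrow> set u \<subseteq> {..<Suc m} \<Longrightarrow> set v \<subseteq> {..<Suc m} \<Longrightarrow> code m u = code m v \<Longrightarrow> u = v"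
proof (induction u arbitrary: v rule: rev_induct)
  case (snoc d u)
  then obtain e w where v: "v = w @ [e]" by (cases v rule: rev_cases) auto
  have de: "d < Suc m" "e < Suc m" using snoc.prems v by auto
  have eq: "code m u * Suc m + d = code m w * Suc m + e" using snoc.prems v by (simp add: code_def)
  have "d = e" using arg_cong[OF eq, of "\<lambda>x. x mod Suc m"] de by (simp del: mult_Suc_right)
  moreover have "code m u = code m w" using arg_cong[OF eq, of "\<lambda>x. x div Suc m"] de by (simp del: mult_Suc_right)
  then have "u = w" using snoc v by auto
  ultimately show ?case using v by simp
qed simp

text \<open>With \<open>N = Suc m ^ r\<close>, a residue class modulo \<open>Suc p\<close> has at
  most \<open>N div Suc p + 1\<close> members below \<open>N\<close>, and
  \<open>Suc p \<le> N\<close> makes the \<open>+ 1\<close> cost at most a factor of two.\<close>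

lemma card_hash_le:
  assumes "Suc p \<le> Suc m ^ r"
  shows "card {v \<in> vspace m r. hash m p v = y} * Suc p \<le> 2 * Suc m ^ r"
proof -
  let ?N = "Suc m ^ r" and ?A = "{v \<in> vspace m r. hash m p v = y}"
  have "inj_on (\<lambda>v. code m v div Suc p) ?A"
  proof (rule inj_onI)
    fix u v assume uv: "u \<in> ?A" "v \<in> ?A" and "code m u div Suc p = code m v div Suc p"
    moreover have "code m u mod Suc p = code m v mod Suc p" using uv by (simp add: hash_code)
    ultimately have "code m u = code m v"
      using div_mult_mod_eq[of "code m u" "Suc p"] div_mult_mod_eq[of "code m v" "Suc p"] by argo
    then show "u = v" using uv code_inj by (auto simp: vspace_def)
  qed
  moreover have "(\<lambda>v. code m v div Suc p) ` ?A \<subseteq> {..?N div Suc p}"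
  proof (rule image_subsetI)
    fix v assume "v \<in> ?A"
    then have "code m v < ?N" using code_less[of v m] by (simp add: vspace_def)
    then show "code m v div Suc p \<in> {..?N div Suc p}" by (simp only: atMost_iff div_le_mono less_imp_le)
  qed
  ultimately have "card ?A \<le> card {..?N div Suc p}" by (rule card_inj_on_le) simp
  then have "card ?A * Suc p \<le> (?N div Suc p + 1) * Suc p" by (intro mult_le_mono1) simp
  also have "\<dots> \<le> ?N + Suc p"
    using div_times_less_eq_dividend[of ?N "Suc p"] by (simp only: distrib_right mult_1 add_le_cancel_right)
  finally show ?thesis using assms by simp
qed

section \<open>Enumeration of vectors, cubes and sublists\<close>

definition vecs :: "nat \<Rightarrow> nat \<Rightarrow> nat \<Rightarrow> nat list list" where
  "vecs cap m r = ((\<lambda>vs. if cap < length vs * Suc m then vs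
     else concat (map (\<lambda>v. map (\<lambda>d. d # v) [0..<Suc m]) vs)) ^^ r) [[]]"

lemma set_vecs:
  assumes "Suc m ^ r \<le> cap"
  shows "set (vecs cap m r) = vspace m r"
proof -
  define ext where "ext = (\<lambda>vs. if cap < length vs * Suc m then vs
     else concat (map (\<lambda>v. map (\<lambda>d. d # v) [0..<Suc m]) vs))"
  have "length ((ext ^^ s) [[]]) = Suc m ^ s \<and> set ((ext ^^ s) [[]]) = vspace m s" if "s \<le> r" for s
    using that
  proof (induction s)
    case 0
    show ?case by (auto simp: vspace_def)
  next
    case (Suc s)
    let ?vs = "(ext ^^ s) [[]]"
    have IH: "length ?vs = Suc m ^ s" "set ?vs = vspace m s" using Suc by auto
    have "Suc m ^ Suc s \<le> Suc m ^ r" using Suc.prems by (intro power_increasing) auto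
    then have le: "\<not> cap < length ?vs * Suc m" using assms IH(1) by (simp add: mult.commute)
    then have eq: "(ext ^^ Suc s) [[]] = concat (map (\<lambda>v. map (\<lambda>d. d # v) [0..<Suc m]) ?vs)"
      by (simp only: funpow.simps o_apply ext_def if_False)
    have "length (concat (map (\<lambda>v. map (\<lambda>d. d # v) [0..<Suc m]) vs)) = length vs * Suc m" for vs :: "nat list list"
      by (induction vs) auto
    moreover have "set (concat (map (\<lambda>v. map (\<lambda>d. d # v) [0..<Suc m]) ?vs)) = vspace m (Suc s)"
    proof -
      have "set (concat (map (\<lambda>v. map (\<lambda>d. d # v) [0..<Suc m]) ?vs)) = {d # v | d v. d < Suc m \<and> v \<in> vspace m s}"
        using IH(2) by (fastforce simp del: upt_Suc)
      also have "\<dots> = vspace m (Suc s)" by (auto simp: vspace_def length_Suc_conv)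
      finally show ?thesis .
    qed
    ultimately show ?case by (simp only: eq IH(1) power_Suc mult.commute simp_thms)
  qed
  then show ?thesis unfolding vecs_def ext_def[symmetric] by blast
qed

text \<open>A candidate is a cube with a pending translation. It may be kept, be doubled by the
  translation, which is then reset, or have a line vector added to the translation.\<close>

definition succs :: "nat \<Rightarrow> nat \<Rightarrow> nat list list \<times> nat list \<Rightarrow> (nat list list \<times> nat list) list" where
  "succs m r cd = cd # (fst cd @ map (\<lambda>c. vadd m r c (snd cd)) (fst cd), null_vec r) #
     concat (map (\<lambda>x. map (\<lambda>a. (fst cd, vadd m r (snd cd) (gen m r x a))) [0..<Suc m]) [0..<Suc m])"

definition cand_step :: "nat \<Rightarrow> nat \<Rightarrow> nat \<Rightarrow> (nat list list \<times> nat list) list \<Rightarrow> (nat list list \<times> nat list) list" where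
  "cand_step cap m r cs = (if cap < length cs * (Suc m * Suc m + 2) then cs else concat (map (succs m r) cs))"

text \<open>Since candidates are kept, \<open>cap\<close> steps include the outcome of every smaller
  number of steps; the number that is needed does not have to be computed.\<close>

definition cands :: "nat \<Rightarrow> nat \<Rightarrow> nat \<Rightarrow> (nat list list \<times> nat list) list" where
  "cands cap m r = (cand_step cap m r ^^ cap) [([null_vec r], null_vec r)]"

abbreviation cand_iter :: "nat \<Rightarrow> nat \<Rightarrow> nat \<Rightarrow> nat \<Rightarrow> (nat list list \<times> nat list) list" where
  "cand_iter cap m r s \<equiv> (cand_step cap m r ^^ s) [([null_vec r], null_vec r)]"

lemma length_succs: "length (succs m r cd) = Suc m * Suc m + 2"
  by (simp add: succs_def length_concat o_def sum_list_triv del: upt_Suc)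

lemma length_cand_iter:
  "(Suc m * Suc m + 2) ^ s \<le> cap \<Longrightarrow> length (cand_iter cap m r s) = (Suc m * Suc m + 2) ^ s"
proof (induction s)
  case (Suc s)
  let ?b = "Suc m * Suc m + 2"
  have "?b ^ s \<le> ?b ^ Suc s" by (rule power_increasing) auto
  then have IH: "length (cand_iter cap m r s) = ?b ^ s" using Suc by linarith
  then have le: "\<not> cap < length (cand_iter cap m r s) * ?b" using Suc.prems by (simp only: power_Suc mult.commute not_less)
  have "length (concat (map (succs m r) cs)) = length cs * ?b" for cs
    by (induction cs) (auto simp: length_succs)
  moreover have "cand_iter cap m r (Suc s) = concat (map (succs m r) (cand_iter cap m r s))"
    using le by (simp only: funpow.simps o_apply cand_step_def if_False)
  ultimately show ?case by (simp only: IH power_Suc mult.commute)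
qed simp

lemma cand_step_succs:
  assumes "(Suc m * Suc m + 2) ^ Suc s \<le> cap" "cd \<in> set (cand_iter cap m r s)" "cd' \<in> set (succs m r cd)"
  shows "cd' \<in> set (cand_iter cap m r (Suc s))"
proof -
  let ?b = "Suc m * Suc m + 2"
  have "?b ^ s \<le> ?b ^ Suc s" by (rule power_increasing) auto
  then have "length (cand_iter cap m r s) = ?b ^ s" using length_cand_iter assms(1) by (meson order_trans)
  then have le: "\<not> cap < length (cand_iter cap m r s) * ?b"
    using assms(1) by (simp only: power_Suc mult.commute not_less)
  then have "cand_iter cap m r (Suc s) = concat (map (succs m r) (cand_iter cap m r s))"
    by (simp only: funpow.simps o_apply cand_step_def if_False)
  then show ?thesis using assms(2,3) by auto
qed

lemma cand_iter_mono: "s \<le> t \<Longrightarrow> set (cand_iter cap m r s) \<subseteq> set (cand_iter cap m r t)"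
proof (induction t rule: dec_induct)
  case (step t)
  have "cd \<in> set (succs m r cd)" for cd by (simp add: succs_def)
  then have "set cs \<subseteq> set (cand_step cap m r cs)" for cs by (auto simp: cand_step_def)
  then have "set (cand_iter cap m r t) \<subseteq> set (cand_iter cap m r (Suc t))" by simp
  then show ?case using step.IH by (rule order_trans[rotated])
qed simp

text \<open>The bound \<open>cap\<close> only serves to keep the enumerations polynomial for unsuitable parameters.\<close>

definition subs :: "nat \<Rightarrow> 'a list \<Rightarrow> 'a list list" where
  "subs cap C = fold (\<lambda>c Ws. if cap < 2 * length Ws then Ws else Ws @ map (\<lambda>W. c # W) Ws) C [[]]"

lemma filter_in_subs:
  assumes "2 ^ length C \<le> cap"
  shows "rev (filter Q C) \<in> set (subs cap C)"
proof -
  have "rev (filter Q C) @ V \<in> set (fold (\<lambda>c Ws. if cap < 2 * length Ws then Ws else Ws @ map (\<lambda>W. c # W) Ws) C Ws)"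
    if "2 ^ length C * length Ws \<le> cap" "V \<in> set Ws" for V Ws
    using that
  proof (induction C arbitrary: V Ws)
    case (Cons c C)
    have "2 * length Ws \<le> 2 ^ length (c # C) * length Ws" by (simp add: mult_le_mono1)
    then have le: "\<not> cap < 2 * length Ws" using Cons.prems(1) by linarith
    let ?Ws = "Ws @ map (\<lambda>W. c # W) Ws"
    have "2 ^ length C * length ?Ws = 2 ^ length (c # C) * length Ws" by simp
    then have "2 ^ length C * length ?Ws \<le> cap" using Cons.prems(1) by (simp only:)
    then have "rev (filter Q C) @ (if Q c then c # V else V) \<in> set (fold (\<lambda>c Ws. if cap < 2 * length Ws then Ws else Ws @ map (\<lambda>W. c # W) Ws) C ?Ws)"
      using Cons.prems(2) by (intro Cons.IH) auto
    then show ?case using le by (auto split: if_splits)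
  qed simp
  from this[of "[[]]" "[]"] show ?thesis using assms by (simp add: subs_def)
qed

text \<open>A cube may contain a vector several times, and the product in \<open>cube_exists\<close>
  counts repetitions. Sublists are therefore compared by counting entries, not by inclusion of
  sets.\<close>

lemma length_filter_subs:
  assumes "W \<in> set (subs cap C)"
  shows "length (filter Q W) \<le> length (filter Q C)"
proof -
  have "\<exists>V0\<in>set Ws. length (filter Q V) \<le> length (filter Q V0) + length (filter Q C)"
    if "V \<in> set (fold (\<lambda>c Ws. if cap < 2 * length Ws then Ws else Ws @ map (\<lambda>W. c # W) Ws) C Ws)" for V Ws
    using that
  proof (induction C arbitrary: Ws)
    case (Cons c C)
    obtain V0 where V0: "V0 \<in> set (if cap < 2 * length Ws then Ws else Ws @ map (\<lambda>W. c # W) Ws)"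
      "length (filter Q V) \<le> length (filter Q V0) + length (filter Q C)"
      using Cons.IH[of "if cap < 2 * length Ws then Ws else Ws @ map (\<lambda>W. c # W) Ws"] Cons.prems by auto
    show ?case
    proof (cases "V0 \<in> set Ws")
      case True
      then show ?thesis using V0(2) by (intro bexI[of _ V0]) auto
    next
      case False
      then obtain W where "W \<in> set Ws" "V0 = c # W" using V0(1) by (auto split: if_splits)
      then show ?thesis using V0(2) by (intro bexI[of _ W]) (auto split: if_splits)
    qed
  qed auto
  from this[of W "[[]]"] show ?thesis using assms by (simp add: subs_def)
qed

text \<open>Position \<open>i\<close> belongs to cell \<open>v\<close> when
  \<open>a * i + hash m p v\<close> falls into a window of \<open>\<tau>\<close> residues, so cells
  may overlap. Groups are lists of positions of terminals rather than of terminals.\<close>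

definition family :: "nat \<Rightarrow> nat \<Rightarrow> nat \<Rightarrow> nat \<Rightarrow> nat \<Rightarrow> nat \<Rightarrow> nat \<Rightarrow> nat list list \<Rightarrow> nat list list" where
  "family cap n m r p a \<tau> C =
    concat (map (\<lambda>v. map (\<lambda>W. filter (\<lambda>i. \<exists>c\<in>set W. (a * i + hash m p (vadd m r v c)) mod Suc p < \<tau>) [0..<n])
      (filter (\<lambda>W. 7 * length C \<le> 8 * length W) (subs cap C))) (vecs cap m r))"

text \<open>Trying all numbers below \<open>cap\<close> finds the primes without a primality test,
  and the multiplier and window without knowledge of the tree.\<close>

definition families :: "nat \<Rightarrow> nat \<Rightarrow> nat list list list" where
  "families cap n = [[0..<n]] #
    concat (map (\<lambda>m. concat (map (\<lambda>r. concat (map (\<lambda>p. concat (map (\<lambda>a. concat (map (\<lambda>\<tau>.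
      map (\<lambda>cd. family cap n m r p a \<tau> (fst cd)) (cands cap m r))
      [0..<cap])) [0..<cap])) [0..<cap])) [0..<cap])) [0..<cap])"

section \<open>Pairwise independent linear functions modulo a prime\<close>

lemma card_shift_less:
  fixes P t c :: nat
  assumes "t \<le> P" "P > 0"
  shows "card {y. y < P \<and> (c + y) mod P < t} = t"
proof -
  let ?f = "\<lambda>y. (c + y) mod P"
  have inj: "inj_on ?f {..<P}"
  proof (rule inj_onI)
    fix x y assume xy: "x \<in> {..<P}" "y \<in> {..<P}" "(c + x) mod P = (c + y) mod P"
    then have "[x = y] (mod P)" by (simp flip: cong_def add: cong_add_lcancel_nat)
    then show "x = y" using xy by (simp add: cong_def)
  qed
  have "?f ` {..<P} = {..<P}" by (rule endo_inj_surj[OF _ _ inj]) (use assms in auto)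
  then have "?f ` {y. y < P \<and> ?f y < t} = {..<t}"
    using assms(1) by (auto 0 3 simp: set_eq_iff image_iff) (metis lessThan_iff order_less_le_trans)
  moreover have "inj_on ?f {y. y < P \<and> ?f y < t}" by (rule inj_on_subset[OF inj]) auto
  ultimately show ?thesis using card_image by fastforce
qed

text \<open>Prescribing both residues gives two linear equations for \<open>(a, y)\<close> with
  determinant \<open>i - j\<close>, which is invertible modulo \<open>P\<close>; so each pair of
  residues in the window is taken at most once.\<close>

lemma card_pair_hits_le:
  fixes P t :: nat
  assumes P: "prime P" and ij: "i < P" "j < P" "i \<noteq> j"
  shows "card {(a, y). a < P \<and> y < P \<and> (a * i + y) mod P < t \<and> (a * j + y) mod P < t} \<le> t * t"
proof -
  let ?S = "{(a, y). a < P \<and> y < P \<and> (a * i + y) mod P < t \<and> (a * j + y) mod P < t}"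
  let ?f = "\<lambda>(a, y). ((a * i + y) mod P, (a * j + y) mod P)"
  have "inj_on ?f ?S"
  proof (rule inj_onI, clarify)
    fix a y b z
    assume b: "a < P" "b < P" "y < P" "z < P"
      and 1: "(a * i + y) mod P = (b * i + z) mod P" and 2: "(a * j + y) mod P = (b * j + z) mod P"
    have "[a * i + y = b * i + z] (mod P)" "[a * j + y = b * j + z] (mod P)"
      using 1 2 by (simp_all only: cong_def)
    then have d: "int P dvd int (a * i + y) - int (b * i + z)" "int P dvd int (a * j + y) - int (b * j + z)"
      by (simp_all only: cong_int_iff flip: cong_iff_dvd_diff)
    have "int P dvd (int (a * i + y) - int (b * i + z)) - (int (a * j + y) - int (b * j + z))"
      using d by (rule dvd_diff)
    also have "\<dots> = (int a - int b) * (int i - int j)" by (simp add: algebra_simps)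
    finally have "int P dvd int a - int b \<or> int P dvd int i - int j"
      using P by (simp only: prime_dvd_mult_iff prime_nat_int_transfer)
    moreover have "\<not> int P dvd int i - int j"
    proof
      assume "int P dvd int i - int j"
      then have "[i = j] (mod P)" by (simp add: cong_iff_dvd_diff flip: cong_int_iff)
      then show False using ij by (simp add: cong_def)
    qed
    ultimately have "[a = b] (mod P)" by (simp add: cong_iff_dvd_diff flip: cong_int_iff)
    then have ab: "a = b" using b by (simp add: cong_def)
    then have "[y = z] (mod P)" using 1 by (simp flip: cong_def add: cong_add_lcancel_nat)
    then show "a = b \<and> y = z" using ab b by (simp add: cong_def)
  qed
  moreover have "?f ` ?S \<subseteq> {..<t} \<times> {..<t}" by auto
  ultimately have "card ?S \<le> card ({..<t} \<times> {..<t})" by (intro card_inj_on_le) auto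
  then show ?thesis by simp
qed

text \<open>Second moment method for the pairwise independent functions \<open>i \<mapsto> (a * i + y) mod P\<close>.\<close>

lemma exists_multiplier:
  fixes P t :: nat
  assumes P: "prime P" and U: "U \<subseteq> {..<P}" and t: "t \<le> P"
  shows "\<exists>a<P. card {y. y < P \<and> (\<forall>i\<in>U. \<not> (a * i + y) mod P < t)} * (card U * t) \<le> P\<^sup>2"
proof (rule ccontr)
  assume no: "\<not> ?thesis"
  define k where "k = card U"
  have P0: "P > 0" using P prime_gt_0_nat by blast
  have finU: "finite U" using U finite_subset by blast
  define h :: "nat \<Rightarrow> nat \<Rightarrow> nat \<Rightarrow> real" where "h a y i = of_bool ((a * i + y) mod P < t)" for a y i
  define Z where "Z a y = (\<Sum>i\<in>U. h a y i)" for a y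
  define \<mu> where "\<mu> = real k * t / P"
  have kt: "real k * t > 0"
  proof (rule ccontr)
    assume "\<not> real k * t > 0"
    then have "k * t = 0" by (simp add: zero_less_mult_iff)
    then show False using no P0 unfolding k_def by auto
  qed
  have S1: "(\<Sum>y<P. Z a y) = k * t" for a
  proof -
    have "(\<Sum>y<P. Z a y) = (\<Sum>i\<in>U. \<Sum>y<P. h a y i)" unfolding Z_def by (rule sum.swap)
    also have "\<dots> = (\<Sum>i\<in>U. real t)"
    proof (rule sum.cong[OF refl])
      fix i
      have "(\<Sum>y<P. h a y i) = card ({..<P} \<inter> {y. (a * i + y) mod P < t})"
        unfolding h_def by (simp add: sum_of_bool_eq)
      also have "{..<P} \<inter> {y. (a * i + y) mod P < t} = {y. y < P \<and> (a * i + y) mod P < t}" by auto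
      finally show "(\<Sum>y<P. h a y i) = t" using card_shift_less[OF t P0] by simp
    qed
    finally show ?thesis by (simp add: k_def)
  qed
  \<comment> \<open>Pairs with \<open>i = j\<close> contribute \<open>k * P * t\<close> in total,
    and every other pair contributes at most \<open>t * t\<close> by pairwise independence.\<close>
  have S2: "(\<Sum>a<P. \<Sum>y<P. (Z a y)\<^sup>2) \<le> k * P * t + (real k * t)\<^sup>2"
  proof -
    have "(\<Sum>a<P. \<Sum>y<P. (Z a y)\<^sup>2) = (\<Sum>(a, y)\<in>{..<P} \<times> {..<P}. \<Sum>i\<in>U. \<Sum>j\<in>U. h a y i * h a y j)"
      unfolding Z_def power2_eq_square sum_product by (rule sum.cartesian_product)
    also have "\<dots> = (\<Sum>i\<in>U. \<Sum>(a, y)\<in>{..<P} \<times> {..<P}. \<Sum>j\<in>U. h a y i * h a y j)"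
      unfolding case_prod_beta by (rule sum.swap)
    also have "\<dots> = (\<Sum>i\<in>U. \<Sum>j\<in>U. \<Sum>(a, y)\<in>{..<P} \<times> {..<P}. h a y i * h a y j)"
      unfolding case_prod_beta by (intro sum.cong refl sum.swap)
    also have "\<dots> \<le> (\<Sum>i\<in>U. \<Sum>j\<in>U. (if i = j then real P * t else 0) + real t * t)"
    proof (intro sum_mono)
      fix i j assume i: "i \<in> U" and j: "j \<in> U"
      show "(\<Sum>(a, y)\<in>{..<P} \<times> {..<P}. h a y i * h a y j) \<le> (if i = j then real P * t else 0) + real t * t"
      proof (cases "i = j")
        case True
        have "(\<Sum>(a, y)\<in>{..<P} \<times> {..<P}. h a y i * h a y i) = (\<Sum>a<P. \<Sum>y<P. h a y i)"
          by (subst sum.cartesian_product[symmetric]) (simp add: h_def)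
        also have "\<dots> = (\<Sum>a<P. real t)"
        proof (rule sum.cong[OF refl])
          fix a
          have "(\<Sum>y<P. h a y i) = card ({..<P} \<inter> {y. (a * i + y) mod P < t})"
            unfolding h_def by (simp add: sum_of_bool_eq)
          also have "{..<P} \<inter> {y. (a * i + y) mod P < t} = {y. y < P \<and> (a * i + y) mod P < t}" by auto
          finally show "(\<Sum>y<P. h a y i) = t" using card_shift_less[OF t P0] by simp
        qed
        finally show ?thesis using True by simp
      next
        case False
        have "(\<Sum>(a, y)\<in>{..<P} \<times> {..<P}. h a y i * h a y j) =
            (\<Sum>(a, y)\<in>{..<P} \<times> {..<P}. of_bool ((a * i + y) mod P < t \<and> (a * j + y) mod P < t))"
          unfolding h_def by (simp add: of_bool_conj)
        also have "\<dots> = card (({..<P} \<times> {..<P}) \<inter> {x. case x of (a, y) \<Rightarrow> (a * i + y) mod P < t \<and> (a * j + y) mod P < t})"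
          unfolding case_prod_beta by (simp add: sum_of_bool_eq)
        also have "({..<P} \<times> {..<P}) \<inter> {x. case x of (a, y) \<Rightarrow> (a * i + y) mod P < t \<and> (a * j + y) mod P < t} =
            {(a, y). a < P \<and> y < P \<and> (a * i + y) mod P < t \<and> (a * j + y) mod P < t}" by auto
        also have "real (card \<dots>) \<le> real (t * t)"
          using card_pair_hits_le[OF P _ _ False] i j U by (intro of_nat_mono) auto
        finally show ?thesis using False by simp
      qed
    qed
    also have "\<dots> = k * P * t + (real k * t)\<^sup>2"
      using finU by (simp add: sum.distrib k_def power2_eq_square algebra_simps)
    finally show ?thesis .
  qed
  have "(\<Sum>a<P. \<Sum>y<P. (Z a y - \<mu>)\<^sup>2) = (\<Sum>a<P. \<Sum>y<P. (Z a y)\<^sup>2) - 2 * \<mu> * (\<Sum>a<P. \<Sum>y<P. Z a y) + P * (P * \<mu>\<^sup>2)"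
    by (simp add: power2_diff sum.distrib sum_subtractf sum_distrib_left algebra_simps)
  also have "\<dots> = (\<Sum>a<P. \<Sum>y<P. (Z a y)\<^sup>2) - (real k * t)\<^sup>2"
    using P0 by (simp add: S1 \<mu>_def power2_eq_square field_simps)
  also have "\<dots> \<le> k * P * t" using S2 by simp
  finally have V: "(\<Sum>a<P. \<Sum>y<P. (Z a y - \<mu>)\<^sup>2) \<le> k * P * t" .
  \<comment> \<open>Chebyshev's argument: where all of \<open>U\<close> is missed, \<open>Z\<close>
    is 0 and deviates from its mean by \<open>\<mu>\<close>. Too many such \<open>y\<close> for
    every \<open>a\<close> would exceed the total variance \<open>V\<close>.\<close>
  have "real k * t < (\<Sum>y<P. (Z a y - \<mu>)\<^sup>2)" if a: "a < P" for a
  proof -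
    let ?M = "{y. y < P \<and> (\<forall>i\<in>U. \<not> (a * i + y) mod P < t)}"
    have "P\<^sup>2 < card ?M * (k * t)" using no a unfolding k_def by auto
    then have "(real P)\<^sup>2 < real (card ?M) * (real k * t)"
      unfolding of_nat_mult[symmetric] of_nat_power[symmetric] of_nat_less_iff .
    then have "real k * t * (real P)\<^sup>2 < real k * t * (real (card ?M) * (real k * t))"
      using kt by (rule mult_strict_left_mono)
    then have "real k * t < real (card ?M) * \<mu>\<^sup>2"
      using P0 by (simp add: \<mu>_def power2_eq_square field_simps)
    also have "\<dots> = (\<Sum>y\<in>?M. (Z a y - \<mu>)\<^sup>2)" by (simp add: Z_def h_def)
    also have "\<dots> \<le> (\<Sum>y<P. (Z a y - \<mu>)\<^sup>2)" by (rule sum_mono2) auto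
    finally show ?thesis .
  qed
  then have "(\<Sum>a<P. real k * t) < (\<Sum>a<P. \<Sum>y<P. (Z a y - \<mu>)\<^sup>2)"
    using P0 by (intro sum_strict_mono) auto
  then have "k * P * t < k * P * real t" using V by (simp add: algebra_simps)
  then show False by simp
qed

lemma half_power_less_imp_less:
  assumes "(1/2 :: real) ^ i < (1/2) ^ j"
  shows "j < i"
proof (rule ccontr)
  assume "\<not> j < i"
  then have "(1/2 :: real) ^ j \<le> (1/2) ^ i" by (intro power_decreasing) auto
  then show False using assms by simp
qed

section \<open>Existence of a family suited to the tree\<close>

context
  fixes m r :: nat
  assumes q: "prime (Suc m)" and r: "r > 0"
begin

interpretation L: line_group "vspace m r" "vadd m r" "null_vec r" "Suc m" r "gen m r"
  by (rule line_group_vspace[OF q r])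

lemma lsums_cand_iter:
  assumes "d \<in> L.lsums t" "(C, null_vec r) \<in> set (cand_iter cap m r s)" "(Suc m * Suc m + 2) ^ (s + t) \<le> cap"
  shows "(C, d) \<in> set (cand_iter cap m r (s + t))"
  using assms(1,3)
proof (induction t arbitrary: d)
  case (Suc t)
  obtain d' x a where d: "d = vadd m r d' (gen m r x a)" "d' \<in> L.lsums t" "x < Suc m" "a < Suc m"
    using Suc.prems(1) by auto
  have "(Suc m * Suc m + 2) ^ (s + t) \<le> (Suc m * Suc m + 2) ^ (s + Suc t)" by (rule power_increasing) auto
  then have "(C, d') \<in> set (cand_iter cap m r (s + t))" using Suc.IH[OF d(2)] Suc.prems(2) by linarith
  moreover have "(C, d) \<in> set (concat (map (\<lambda>x. map (\<lambda>a. (fst (C, d'), vadd m r (snd (C, d')) (gen m r x a)))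
      [0..<Suc m]) [0..<Suc m]))"
    unfolding d(1) using d(3,4) by (auto simp del: upt_Suc intro!: bexI[of _ x] image_eqI[of _ _ a])
  then have "(C, d) \<in> set (succs m r (C, d'))"
    unfolding succs_def by (intro list.set_intros(2))
  ultimately have "(C, d) \<in> set (cand_iter cap m r (Suc (s + t)))"
    using Suc.prems(2) by (intro cand_step_succs) (simp_all only: add_Suc_right)
  then show ?case by (simp only: add_Suc_right)
qed (use assms(2) in simp)

text \<open>Stage \<open>j\<close> takes \<open>ts j\<close> additions to the pending translation
  and one step that doubles the cube.\<close>

lemma cubes_cand_iter:
  assumes "C \<in> L.cubes ts i" "(Suc m * Suc m + 2) ^ (\<Sum>j<i. Suc (ts j)) \<le> cap"
  shows "(C, null_vec r) \<in> set (cand_iter cap m r (\<Sum>j<i. Suc (ts j)))"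
  using assms
proof (induction i arbitrary: C)
  case (Suc i)
  let ?s = "\<Sum>j<i. Suc (ts j)" and ?b = "Suc m * Suc m + 2"
  have s: "(\<Sum>j<Suc i. Suc (ts j)) = Suc (?s + ts i)" by simp
  obtain C' d where C: "C = C' @ map (\<lambda>c. vadd m r c d) C'" "C' \<in> L.cubes ts i" "d \<in> L.lsums (ts i)"
    using Suc.prems(1) by auto
  have "?b ^ ?s \<le> ?b ^ Suc (?s + ts i)" "?b ^ (?s + ts i) \<le> ?b ^ Suc (?s + ts i)"
    by (rule power_increasing; simp)+
  then have le: "?b ^ ?s \<le> cap" "?b ^ (?s + ts i) \<le> cap" "?b ^ Suc (?s + ts i) \<le> cap"
    using Suc.prems(2) unfolding s by linarith+
  have "(C', d) \<in> set (cand_iter cap m r (?s + ts i))"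
    by (rule lsums_cand_iter[OF C(3) Suc.IH[OF C(2) le(1)] le(2)])
  moreover have "(C, null_vec r) \<in> set (succs m r (C', d))"
    unfolding C(1) succs_def by simp
  ultimately show ?case unfolding s by (rule cand_step_succs[OF le(3)])
qed simp

text \<open>The first property of the family holds because every block is rich in cells meeting
  \<open>U\<close>, the second by counting incidences between \<open>X\<close> and the cells. The
  bound on \<open>(Suc m ^ r)\<^sup>2\<close> makes blocks long enough for a union bound over all of
  them.\<close>

lemma family_properties:
  fixes p n k cap I :: nat and ts :: "nat \<Rightarrow> nat"
  assumes p: "prime (Suc p)" "n \<le> Suc p" "Suc p \<le> Suc m ^ r"
    and I: "(Suc m ^ r)\<^sup>2 \<le> 2 ^ (2 ^ I)"
    and ts: "\<And>i. i < I \<Longrightarrow> (real (r - 1) / Suc m) ^ ts i \<le> (1/4) * (1/4) ^ 2 ^ i"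
    and cap: "Suc m ^ r \<le> cap" "2 ^ (2 ^ I) \<le> cap" "(Suc m * Suc m + 2) ^ (\<Sum>j<I. Suc (ts j)) \<le> cap"
    and U: "U \<subseteq> {..<n}" "k \<le> card U" and k: "17 \<le> k"
  obtains a \<tau> C where "a < Suc p" "\<tau> \<le> Suc p" "(C, null_vec r) \<in> set (cands cap m r)"
    "\<And>g. g \<in> set (family cap n m r p a \<tau> C) \<Longrightarrow> set g \<inter> U \<noteq> {}"
    "\<And>X. X \<subseteq> {..<n} \<Longrightarrow> (\<And>g. g \<in> set (family cap n m r p a \<tau> C) \<Longrightarrow> set g \<inter> X \<noteq> {}) \<Longrightarrow> k \<le> 272 * card X"
proof -
  define P where "P = Suc p"
  define N where "N = Suc m ^ r"
  let ?G = "vspace m r"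
  have N: "card ?G = N" "N > 0" unfolding N_def by (simp_all add: card_vspace)
  have finG: "finite ?G" by (rule finite_vspace)
  have P0: "P > 0" by (simp add: P_def)
  have kP: "k \<le> P" using U p(2) card_mono[of "{..<n}" U] unfolding P_def by simp
  \<comment> \<open>Chosen so that on average a window contains at least 16 images of elements of
    \<open>U\<close>. The \<open>+ 1\<close> rounds up and costs at most \<open>k \<le> P\<close>,
    which turns 16 into 17; then \<open>17 \<le> k\<close> yields
    \<open>\<tau> \<le> P\<close>.\<close>
  define \<tau> where "\<tau> = 16 * P div k + 1"
  have "k * (16 * P div k) \<le> 16 * P" by (rule times_div_less_eq_dividend)
  moreover have "16 * P < k * (16 * P div k) + k"
    using dividend_less_times_div[of k "16 * P"] k by simp
  ultimately have \<tau>: "16 * P \<le> k * \<tau>" "k * \<tau> \<le> 17 * P" unfolding \<tau>_def distrib_left using kP by linarith+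
  have "17 * \<tau> \<le> k * \<tau>" using k by (rule mult_le_mono1)
  then have \<tau>P: "\<tau> \<le> P" using \<tau>(2) by linarith
  have UP: "U \<subseteq> {..<P}" using U(1) p(2) unfolding P_def by auto
  obtain a where a: "a < P" "card {y. y < P \<and> (\<forall>i\<in>U. \<not> (a * i + y) mod P < \<tau>)} * (card U * \<tau>) \<le> P\<^sup>2"
    using exists_multiplier[OF p(1)[folded P_def] UP \<tau>P] by blast
  define cell where "cell v = {i. (a * i + hash m p v) mod P < \<tau>}" for v
  define MY where "MY = {y. y < P \<and> (\<forall>i\<in>U. \<not> (a * i + y) mod P < \<tau>)}"
  \<comment> \<open>At most a sixteenth of the residues miss \<open>U\<close>. As fibres of
    \<open>hash\<close> exceed the average by a factor of at most two, at most an eighth of the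
    cells miss \<open>U\<close>.\<close>
  have "card MY * (16 * P) \<le> card MY * (card U * \<tau>)"
  proof (rule mult_le_mono2)
    have "k * \<tau> \<le> card U * \<tau>" using U(2) by (rule mult_le_mono1)
    then show "16 * P \<le> card U * \<tau>" using \<tau>(1) by linarith
  qed
  also have "\<dots> \<le> P * P" using a(2) unfolding MY_def power2_eq_square .
  finally have "P * (16 * card MY) \<le> P * P" by (simp only: mult.commute mult.left_commute)
  then have MY: "16 * card MY \<le> P" using P0 by simp
  have hash_lt: "hash m p v < P" for v by (simp add: hash_code P_def)
  have card_hash: "card {v \<in> ?G. hash m p v = y} * P \<le> 2 * N" for y
    using card_hash_le[OF p(3)] unfolding P_def N_def .
  have card_hash_set: "card {v \<in> ?G. hash m p v \<in> Y} * P \<le> card Y * (2 * N)" if "finite Y" for Y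
  proof -
    have "{v \<in> ?G. hash m p v \<in> Y} = (\<Union>y\<in>Y. {v \<in> ?G. hash m p v = y})" by auto
    then have "card {v \<in> ?G. hash m p v \<in> Y} \<le> (\<Sum>y\<in>Y. card {v \<in> ?G. hash m p v = y})"
      using card_UN_le[OF that] by simp
    then have "card {v \<in> ?G. hash m p v \<in> Y} * P \<le> (\<Sum>y\<in>Y. card {v \<in> ?G. hash m p v = y}) * P"
      by (rule mult_le_mono1)
    also have "\<dots> = (\<Sum>y\<in>Y. card {v \<in> ?G. hash m p v = y} * P)" by (rule sum_distrib_right)
    also have "\<dots> \<le> (\<Sum>y\<in>Y. 2 * N)" by (rule sum_mono) (rule card_hash)
    finally show ?thesis by simp
  qed
  define M where "M = {v \<in> ?G. cell v \<inter> U = {}}"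
  have "M \<subseteq> {v \<in> ?G. hash m p v \<in> MY}" unfolding M_def MY_def cell_def using hash_lt by auto
  then have "card M \<le> card {v \<in> ?G. hash m p v \<in> MY}" by (intro card_mono) (auto simp: finG)
  then have "card M * P \<le> card {v \<in> ?G. hash m p v \<in> MY} * P" by (rule mult_le_mono1)
  also have "\<dots> \<le> card MY * (2 * N)" by (rule card_hash_set) (simp add: MY_def)
  finally have "8 * (card M * P) \<le> 8 * (card MY * (2 * N))" by (rule mult_le_mono2)
  also have "\<dots> = 16 * card MY * N" by simp
  also have "\<dots> \<le> P * N" using MY by (rule mult_le_mono1)
  finally have "P * (8 * card M) \<le> P * N" by (simp only: mult.commute mult.left_commute)
  then have M: "8 * card M \<le> N" using P0 by simp
  \<comment> \<open>The mean of \<open>f\<close> is at most \<open>1/16 + 1/8\<close>, below the 1/4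
    that \<open>cube_exists\<close> allows, while its product over a block falls by a factor of 16
    for each cell that meets \<open>U\<close>.\<close>
  define f where "f v = (if cell v \<inter> U = {} then 1 else 1/16 :: real)" for v
  have f01: "0 \<le> f v \<and> f v \<le> 1" for v by (simp add: f_def)
  have "(\<Sum>v\<in>?G. f v) \<le> (\<Sum>v\<in>?G. 1/16 + of_bool (v \<in> M))"
    by (rule sum_mono) (simp add: f_def M_def)
  also have "\<dots> = N / 16 + card M"
  proof -
    have "?G \<inter> {v. v \<in> M} = M" unfolding M_def by auto
    then show ?thesis using finG by (simp add: sum.distrib sum_of_bool_eq N)
  qed
  also have "\<dots> \<le> card ?G / 4" using M unfolding N by simp
  finally have f4: "(\<Sum>v\<in>?G. f v) \<le> card ?G / 4" .
  obtain C where C: "C \<in> L.cubes ts I"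
    "(\<Sum>v\<in>?G. prod_list (map (\<lambda>c. f (vadd m r v c)) C)) \<le> card ?G * ((1/2) * (1/2) ^ 2 ^ I)"
    using L.cube_exists[OF f01 f4, of I ts] ts unfolding L.lam_def by blast
  define len where "len = length C"
  have len: "len = 2 ^ I" unfolding len_def by (rule L.length_cubes[OF C(1)])
  have CG: "set C \<subseteq> ?G" by (rule L.cubes_G[OF C(1)])
  have hits: "8 * length (filter (\<lambda>c. cell (vadd m r v c) \<inter> U = {}) C) < 7 * len" if v: "v \<in> ?G" for v
  proof -
    let ?Q = "\<lambda>c. cell (vadd m r v c) \<inter> U = {}"
    define h where "h = length (filter (\<lambda>c. \<not> ?Q c) C)"
    have "prod_list (map (\<lambda>c. f (vadd m r v c)) D) = (1/16) ^ length (filter (\<lambda>c. \<not> ?Q c) D)" for D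
      by (induction D) (auto simp: f_def)
    then have "(1/16 :: real) ^ h = prod_list (map (\<lambda>c. f (vadd m r v c)) C)" unfolding h_def by simp
    also have "\<dots> \<le> (\<Sum>v\<in>?G. prod_list (map (\<lambda>c. f (vadd m r v c)) C))"
    proof (rule member_le_sum[OF v _ finG])
      fix u
      show "0 \<le> prod_list (map (\<lambda>c. f (vadd m r u c)) C)" by (rule prod_list_nonneg) (auto simp: f_def)
    qed
    also have "\<dots> \<le> N * ((1/2) * (1/2) ^ len)" using C(2) unfolding N len .
    \<comment> \<open>The hypothesis on \<open>I\<close> bounds the square of \<open>N\<close>,
      hence the squaring; the outcome is \<open>(1/2) ^ (8 * h) < (1/2) ^ len\<close>.\<close>
    finally have "((1/16 :: real) ^ h)\<^sup>2 \<le> (N * ((1/2) * (1/2) ^ len))\<^sup>2" by (rule power_mono) simp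
    also have "\<dots> = (real (N\<^sup>2) / 4) * ((1/2) ^ len * (1/2) ^ len)" by (simp add: power2_eq_square)
    also have "\<dots> \<le> (2 ^ len / 4) * ((1/2) ^ len * (1/2) ^ len)"
    proof (rule mult_right_mono)
      have "real (N\<^sup>2) \<le> real (2 ^ len)" using I unfolding len N_def by (rule of_nat_mono)
      then show "real (N\<^sup>2) / 4 \<le> 2 ^ len / 4" by simp
    qed simp
    also have "\<dots> = (1/2) ^ len / 4" by (simp add: power_divide)
    also have "\<dots> < (1/2 :: real) ^ len" by simp
    also have "((1/16 :: real) ^ h)\<^sup>2 = (1/2) ^ (8 * h)"
    proof -
      have 1: "(1/16 :: real)\<^sup>2 = (1/2) ^ 8" by (simp add: power_divide)
      have "((1/16 :: real) ^ h)\<^sup>2 = ((1/16)\<^sup>2) ^ h" by (simp only: power_mult[symmetric] mult.commute)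
      also have "\<dots> = (1/2) ^ (8 * h)" unfolding 1 by (rule power_mult[symmetric])
      finally show ?thesis .
    qed
    finally have "len < 8 * h" by (rule half_power_less_imp_less)
    moreover have "length (filter ?Q C) + h = len" unfolding h_def len_def by (rule sum_length_filter_compl)
    ultimately show ?thesis by linarith
  qed
  have vecs: "set (vecs cap m r) = ?G" by (rule set_vecs[OF cap(1)])
  have "(C, null_vec r) \<in> set (cands cap m r)"
  proof -
    let ?s = "\<Sum>j<I. Suc (ts j)"
    have "?s < 2 ^ ?s" by (rule less_exp)
    also have "\<dots> \<le> (Suc m * Suc m + 2) ^ ?s" by (rule power_mono) auto
    finally have "?s \<le> cap" using cap(3) by linarith
    then show ?thesis
      using cubes_cand_iter[OF C(1) cap(3)] cand_iter_mono[of ?s cap] unfolding cands_def by blast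
  qed
  moreover have "set g \<inter> U \<noteq> {}" if g: "g \<in> set (family cap n m r p a \<tau> C)" for g
  proof -
    obtain v W where vW: "v \<in> ?G" "W \<in> set (subs cap C)" "7 * length C \<le> 8 * length W"
      "g = filter (\<lambda>i. \<exists>c\<in>set W. (a * i + hash m p (vadd m r v c)) mod Suc p < \<tau>) [0..<n]"
      using g vecs unfolding family_def by auto
    show ?thesis
    proof
      assume "set g \<inter> U = {}"
      then have "filter (\<lambda>c. cell (vadd m r v c) \<inter> U = {}) W = W"
        unfolding vW(4) filter_id_conv cell_def P_def using U(1) by fastforce
      then have "length W \<le> length (filter (\<lambda>c. cell (vadd m r v c) \<inter> U = {}) C)"
        using length_filter_subs[OF vW(2), of "\<lambda>c. cell (vadd m r v c) \<inter> U = {}"] by simp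
      then show False using hits[OF vW(1)] vW(3) unfolding len_def by linarith
    qed
  qed
  moreover have "k \<le> 272 * card X"
    if X: "X \<subseteq> {..<n}" and hit: "\<And>g. g \<in> set (family cap n m r p a \<tau> C) \<Longrightarrow> set g \<inter> X \<noteq> {}" for X
  proof -
    have finX: "finite X" using X finite_subset by blast
    \<comment> \<open>Otherwise the cells missed by \<open>X\<close> make up seven eighths of the
      block, and their union is a group that \<open>X\<close> does not hit.\<close>
    have many: "len < 8 * length (filter (\<lambda>c. cell (vadd m r v c) \<inter> X \<noteq> {}) C)" if v: "v \<in> ?G" for v
    proof (rule ccontr)
      let ?Q = "\<lambda>c. cell (vadd m r v c) \<inter> X = {}"
      assume no: "\<not> ?thesis"
      define W where "W = rev (filter ?Q C)"
      have "length (filter ?Q C) + length (filter (\<lambda>c. \<not> ?Q c) C) = len"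
        unfolding len_def by (rule sum_length_filter_compl)
      then have "7 * length C \<le> 8 * length W" using no unfolding W_def len_def by simp
      moreover have "W \<in> set (subs cap C)"
        unfolding W_def by (rule filter_in_subs) (use cap(2) len in \<open>simp add: len_def\<close>)
      ultimately have "filter (\<lambda>i. \<exists>c\<in>set W. (a * i + hash m p (vadd m r v c)) mod Suc p < \<tau>) [0..<n]
          \<in> set (family cap n m r p a \<tau> C)"
        unfolding family_def using v vecs by auto
      from hit[OF this] obtain i c where "i \<in> X" "c \<in> set W" "i \<in> cell (vadd m r v c)"
        unfolding cell_def P_def by auto
      then show False unfolding W_def by auto
    qed
    define H where "H = card {v \<in> ?G. cell v \<inter> X \<noteq> {}}"
    \<comment> \<open>Translation by any \<open>c\<close> permutes the vectors, so every entry of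
      the cube contributes the same count \<open>H\<close>.\<close>
    have "(\<Sum>v\<in>?G. length (filter (\<lambda>c. cell (vadd m r v c) \<inter> X \<noteq> {}) D)) = length D * H" if "set D \<subseteq> ?G" for D
      using that
    proof (induction D)
      case (Cons c D)
      have "real (\<Sum>v\<in>?G. of_bool (cell (vadd m r v c) \<inter> X \<noteq> {})) = (\<Sum>v\<in>?G. of_bool (cell v \<inter> X \<noteq> {}))"
        using L.sum_shift[of c "\<lambda>v. of_bool (cell v \<inter> X \<noteq> {})"] Cons.prems by simp
      also have "\<dots> = real (card (?G \<inter> {v. cell v \<inter> X \<noteq> {}}))" using finG by (simp add: sum_of_bool_eq)
      also have "?G \<inter> {v. cell v \<inter> X \<noteq> {}} = {v \<in> ?G. cell v \<inter> X \<noteq> {}}" by auto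
      finally have 1: "(\<Sum>v\<in>?G. of_bool (cell (vadd m r v c) \<inter> X \<noteq> {})) = H" unfolding H_def of_nat_eq_iff .
      have "(\<Sum>v\<in>?G. length (filter (\<lambda>c. cell (vadd m r v c) \<inter> X \<noteq> {}) (c # D))) =
         (\<Sum>v\<in>?G. of_bool (cell (vadd m r v c) \<inter> X \<noteq> {}) + length (filter (\<lambda>c. cell (vadd m r v c) \<inter> X \<noteq> {}) D))"
        by (rule sum.cong) auto
      also have "\<dots> = H + length D * H" using 1 Cons by (simp only: sum.distrib) simp
      finally show ?case by simp
    qed simp
    from this[OF CG] have tot: "(\<Sum>v\<in>?G. length (filter (\<lambda>c. cell (vadd m r v c) \<inter> X \<noteq> {}) C)) = len * H"
      unfolding len_def .
    have "(\<Sum>v\<in>?G. len) < (\<Sum>v\<in>?G. 8 * length (filter (\<lambda>c. cell (vadd m r v c) \<inter> X \<noteq> {}) C))"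
      using many finG L.zero by (intro sum_strict_mono) auto
    then have "N * len < 8 * (len * H)" using tot N(1) by (simp add: sum_distrib_left[symmetric])
    then have NH: "N < 8 * H" using len by simp
    \<comment> \<open>Each element of \<open>X\<close> lies in the cells given by
      \<open>\<tau>\<close> residues, and the fibre of each residue has at most
      \<open>2 * N / P\<close> vectors.\<close>
    have "H * P \<le> card X * \<tau> * (2 * N)"
    proof -
      have "{v \<in> ?G. cell v \<inter> X \<noteq> {}} = (\<Union>i\<in>X. {v \<in> ?G. hash m p v \<in> {y. y < P \<and> (a * i + y) mod P < \<tau>}})"
        unfolding cell_def using hash_lt by auto
      then have "H \<le> (\<Sum>i\<in>X. card {v \<in> ?G. hash m p v \<in> {y. y < P \<and> (a * i + y) mod P < \<tau>}})"
        unfolding H_def using card_UN_le[OF finX] by simp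
      then have "H * P \<le> (\<Sum>i\<in>X. card {v \<in> ?G. hash m p v \<in> {y. y < P \<and> (a * i + y) mod P < \<tau>}}) * P"
        by (rule mult_le_mono1)
      also have "\<dots> = (\<Sum>i\<in>X. card {v \<in> ?G. hash m p v \<in> {y. y < P \<and> (a * i + y) mod P < \<tau>}} * P)"
        by (rule sum_distrib_right)
      also have "\<dots> \<le> (\<Sum>i\<in>X. \<tau> * (2 * N))"
      proof (rule sum_mono)
        fix i
        have "card {y. y < P \<and> (a * i + y) mod P < \<tau>} = \<tau>"
          by (rule card_shift_less[OF \<tau>P]) (simp add: P_def)
        then show "card {v \<in> ?G. hash m p v \<in> {y. y < P \<and> (a * i + y) mod P < \<tau>}} * P \<le> \<tau> * (2 * N)"
          using card_hash_set[of "{y. y < P \<and> (a * i + y) mod P < \<tau>}"] by simp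
      qed
      finally show ?thesis by simp
    qed
    moreover have "N * P < 8 * H * P" using NH P0 by (rule mult_strict_right_mono)
    moreover have "8 * (card X * \<tau> * (2 * N)) = N * (16 * card X * \<tau>)" by simp
    ultimately have "N * P < N * (16 * card X * \<tau>)" by linarith
    then have "P < 16 * card X * \<tau>" by simp
    then have "k * P \<le> 16 * card X * (k * \<tau>)" using mult_le_mono2[of P "16 * card X * \<tau>" k] by (simp add: mult.left_commute)
    also have "\<dots> \<le> 16 * card X * (17 * P)" by (rule mult_le_mono2[OF \<tau>(2)])
    finally have "k * P \<le> 272 * card X * P" by simp
    then show ?thesis using P0 by simp
  qed
  ultimately show ?thesis using that[of a \<tau> C] a(1) \<tau>P unfolding P_def by blast
qed

end


section \<open>Parameters of polynomial size\<close>

lemma square_le_power2: "(Suc b)\<^sup>2 \<le> 4 * 2 ^ b"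
proof (induction b)
  case (Suc b)
  show ?case
  proof (cases "b \<ge> 2")
    case True
    then have "2 * 2 \<le> b * b" by (intro mult_le_mono)
    then have "(Suc (Suc b))\<^sup>2 \<le> 2 * (Suc b)\<^sup>2" by (simp add: power2_eq_square)
    then show ?thesis using Suc by simp
  next
    case False
    then have "b = 0 \<or> b = 1" by auto
    then show ?thesis by (auto simp: power2_eq_square)
  qed
qed simp

text \<open>With \<open>n < 2 ^ l \<le> 2 * n\<close> and \<open>l < 2 ^ b \<le> 2 * l\<close>, every quantity below is at most \<open>2 ^ (c * l)\<close> for a
  constant \<open>c\<close>; the exponent 13440 is the largest such \<open>c\<close>.\<close>

lemma parameters:
  assumes n: "n \<ge> 1"
  obtains m r p I ts where "prime (Suc m)" "r > 0" "prime (Suc p)" "n \<le> Suc p" "Suc p \<le> Suc m ^ r"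
    "(Suc m ^ r)\<^sup>2 \<le> 2 ^ (2 ^ I)"
    "\<And>i. i < I \<Longrightarrow> (real (r - 1) / Suc m) ^ ts i \<le> (1/4) * (1/4) ^ 2 ^ i"
    "Suc m ^ r \<le> (2 * n) ^ 13440" "2 ^ (2 ^ I) \<le> (2 * n) ^ 13440"
    "(Suc m * Suc m + 2) ^ (\<Sum>j<I. Suc (ts j)) \<le> (2 * n) ^ 13440" "Suc p < (2 * n) ^ 13440"
proof -
  define B where "B = (2 * n) ^ 13440"
  obtain l' where l': "2 ^ l' \<le> n" "n < 2 ^ (l' + 1)" using ex_power_ivl1[of 2 n] n by auto
  define l where "l = l' + 1"
  have l: "n < 2 ^ l" "2 ^ l \<le> 2 * n" "l \<ge> 1" using l' by (auto simp: l_def)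
  obtain b' where b': "2 ^ b' \<le> l" "l < 2 ^ (b' + 1)" using ex_power_ivl1[of 2 l] l(3) by auto
  define b where "b = b' + 1"
  have b: "l < 2 ^ b" "2 ^ b \<le> 2 * l" "b \<ge> 1" using b' by (auto simp: b_def)
  have "b' < 2 ^ b'" by (rule less_exp)
  then have bl: "b \<le> l" using b' unfolding b_def by linarith
  have bb: "b * b \<le> 4 * l"
  proof -
    have "b * b \<le> 4 * 2 ^ b'" using square_le_power2[of b'] unfolding b_def by (simp only: power2_eq_square Suc_eq_plus1)
    then show ?thesis using b'(1) by linarith
  qed
  have B: "x \<le> B" if "x \<le> 2 ^ e" "e \<le> 13440 * l" for x e
  proof -
    have "x \<le> 2 ^ (13440 * l)" using that(1) power_increasing[OF that(2), of "2::nat"] by linarith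
    also have "\<dots> = (2 ^ l) ^ 13440" by (simp only: power_mult[symmetric] mult.commute)
    also have "\<dots> \<le> B" unfolding B_def by (rule power_mono[OF l(2)]) simp
    finally show ?thesis .
  qed
  \<comment> \<open>\<open>q\<close> exceeds the cube of \<open>2 ^ b > l\<close>, while
    \<open>r - 1\<close> is at most the square of \<open>2 ^ b\<close>; this brings the contraction
    factor down to \<open>(1/2) ^ b\<close>.\<close>
  obtain q :: nat where q: "prime q" "2 ^ (3 * b) < q" "q \<le> 16 * (2 ^ (3 * b))\<^sup>2"
    using exists_prime_between[of "2 ^ (3 * b)"] by auto
  have "16 * (2 ^ (3 * b))\<^sup>2 = (2::nat) ^ (4 + 2 * (3 * b))" by (simp only: power_add power_mult[symmetric] mult.commute) simp
  also have "\<dots> \<le> 2 ^ (10 * b)" by (rule power_increasing) (use b(3) in auto)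
  finally have q2: "q \<le> 2 ^ (10 * b)" using q(3) by linarith
  obtain P where P: "prime P" "n < P" "P \<le> 16 * n\<^sup>2"
    using exists_prime_between[OF n] by auto
  have "16 * n\<^sup>2 \<le> 16 * (2 ^ l)\<^sup>2" using l(1) by (intro mult_le_mono2 power_mono) auto
  also have "\<dots> = 2 ^ (4 + 2 * l)" by (simp only: power_add power_mult[symmetric] mult.commute) simp
  finally have P2: "P \<le> 2 ^ (4 + 2 * l)" using P(3) by linarith
  \<comment> \<open>The least dimension with \<open>l + 2 < b * r\<close>. Then
    \<open>q ^ r \<ge> 2 ^ (3 * (b * r))\<close> is at least \<open>P\<close>, and
    \<open>b * r \<le> 4 * l\<close> keeps \<open>q ^ r\<close> polynomial in
    \<open>n\<close>.\<close>
  define r where "r = (l + 2) div b + 1"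
  have "b * ((l + 2) div b) \<le> l + 2" by (rule times_div_less_eq_dividend)
  moreover have "l + 2 < b + b * ((l + 2) div b)" using dividend_less_times_div[of b "l + 2"] b(3) by simp
  ultimately have br: "l + 2 < b * r" "b * r \<le> l + 2 + b" unfolding r_def distrib_left by linarith+
  \<comment> \<open>\<open>2 ^ I = 128 * 2 ^ b\<close> exceeds \<open>80 * l\<close>, the exponent
    that bounds \<open>(q ^ r)\<^sup>2\<close>, and is at most \<open>256 * l\<close>, so that all
    sublists of a block can be listed.\<close>
  define I where "I = b + 7"
  \<comment> \<open>Each summand contributes a factor of at most \<open>(1/2) ^ b\<close>, so an
    error of \<open>(1/4) * (1/4) ^ 2 ^ i\<close> is reached once \<open>b * ts i\<close> is at
    least \<open>2 + 2 ^ (i + 1)\<close>.\<close>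
  define ts where "ts i = (2 + 2 ^ (i + 1)) div b + 1" for i :: nat
  have bts: "2 + 2 ^ (i + 1) < b * ts i" "b * ts i \<le> 2 + 2 ^ (i + 1) + b" for i
  proof -
    have "b * ((2 + 2 ^ (i + 1)) div b) \<le> 2 + 2 ^ (i + 1)" by (rule times_div_less_eq_dividend)
    moreover have "2 + 2 ^ (i + 1) < b + b * ((2 + 2 ^ (i + 1)) div b)"
      using dividend_less_times_div[of b "2 + 2 ^ (i + 1)"] b(3) by simp
    ultimately show "2 + 2 ^ (i + 1) < b * ts i" "b * ts i \<le> 2 + 2 ^ (i + 1) + b"
      unfolding ts_def distrib_left by linarith+
  qed
  have "q ^ r \<le> (2 ^ (10 * b)) ^ r" by (rule power_mono[OF q2]) simp
  also have "\<dots> = 2 ^ (10 * (b * r))" by (simp only: power_mult[symmetric] mult.assoc)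
  finally have qr: "q ^ r \<le> 2 ^ (10 * (b * r))" .
  have br40: "10 * (b * r) \<le> 40 * l" using br(2) bl l(3) by linarith
  have PI: "(2::nat) ^ I = 128 * 2 ^ b" unfolding I_def by (simp add: power_add)
  show ?thesis
  proof (rule that)
    have q1: "Suc (q - 1) = q" using prime_gt_0_nat[OF q(1)] by simp
    have P1: "Suc (P - 1) = P" using prime_gt_0_nat[OF P(1)] by simp
    show "prime (Suc (q - 1))" unfolding q1 by (rule q(1))
    show "prime (Suc (P - 1))" unfolding P1 by (rule P(1))
    show "r > 0" by (simp add: r_def)
    show "n \<le> Suc (P - 1)" unfolding P1 using P(2) by simp
    show "Suc (P - 1) \<le> Suc (q - 1) ^ r"
    proof -
      have "(2::nat) ^ (4 + 2 * l) \<le> 2 ^ (3 * (b * r))" by (rule power_increasing) (use br in auto)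
      also have "\<dots> = (2 ^ (3 * b)) ^ r" by (simp only: power_mult[symmetric] mult.assoc)
      also have "\<dots> \<le> q ^ r" using q(2) by (intro power_mono) auto
      finally show ?thesis using P2 unfolding q1 P1 by linarith
    qed
    show "(Suc (q - 1) ^ r)\<^sup>2 \<le> 2 ^ 2 ^ I"
    proof -
      have "(q ^ r)\<^sup>2 \<le> (2 ^ (10 * (b * r)))\<^sup>2" by (rule power_mono[OF qr]) simp
      also have "\<dots> = 2 ^ (20 * (b * r))" by (simp only: power_mult[symmetric] mult.commute) (simp add: mult.commute)
      also have "\<dots> \<le> 2 ^ 2 ^ I" using br40 b(1) unfolding PI by (intro power_increasing) auto
      finally show ?thesis unfolding q1 .
    qed
    show "Suc (q - 1) ^ r \<le> (2 * n) ^ 13440"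
      unfolding q1 by (rule B[OF qr, unfolded B_def]) (use br40 in linarith)
    show "2 ^ 2 ^ I \<le> (2 * n) ^ 13440"
    proof (rule B[OF order_refl, unfolded B_def])
      show "2 ^ I \<le> 13440 * l" unfolding PI using b(2) by linarith
    qed
    show "Suc (P - 1) < (2 * n) ^ 13440"
      unfolding P1 Suc_le_eq[symmetric]
    proof (rule B[unfolded B_def])
      have "(2::nat) ^ (4 + 2 * l) < 2 ^ (7 * l)" by (rule power_strict_increasing) (use l(3) in auto)
      then show "Suc P \<le> 2 ^ (7 * l)" using P2 by linarith
    qed simp
    show "(real (r - 1) / Suc (q - 1)) ^ ts i \<le> (1/4) * (1/4) ^ 2 ^ i" if "i < I" for i
    proof -
      have "r - 1 \<le> l + 2" unfolding r_def by simp
      also have "l + 2 \<le> 2 ^ b + 1" using b(1) by linarith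
      also have "2 ^ b + 1 \<le> (2::nat) ^ b * 2 ^ b"
      proof -
        have "(2::nat) ^ b \<ge> 2 ^ 1" by (rule power_increasing) (use b(3) in auto)
        then have "2 ^ b * 2 \<le> (2::nat) ^ b * 2 ^ b" by (intro mult_le_mono2) simp
        moreover have "(1::nat) \<le> 2 ^ b" by simp
        ultimately show ?thesis by linarith
      qed
      finally have "r - 1 \<le> 2 ^ b * 2 ^ b" .
      then have "real (r - 1) \<le> real (2 ^ b * 2 ^ b)" by (rule of_nat_mono)
      moreover have "real (2 ^ b * 2 ^ b * 2 ^ b) \<le> real q"
      proof (rule of_nat_mono)
        have "(2::nat) ^ b * 2 ^ b * 2 ^ b = 2 ^ (3 * b)" by (simp only: power_add[symmetric]) simp
        then show "2 ^ b * 2 ^ b * 2 ^ b \<le> q" using q(2) by linarith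
      qed
      moreover have "q > 0" using q(2) by simp
      ultimately have "real (r - 1) / q \<le> real (2 ^ b * 2 ^ b) / real (2 ^ b * 2 ^ b * 2 ^ b)"
        by (intro frac_le) auto
      then have "real (r - 1) / q \<le> (1/2) ^ b" by (simp add: power_divide)
      then have "(real (r - 1) / q) ^ ts i \<le> ((1/2) ^ b) ^ ts i" by (intro power_mono) auto
      also have "\<dots> = (1/2) ^ (b * ts i)" by (simp only: power_mult)
      also have "\<dots> \<le> (1/2) ^ (2 + 2 ^ (i + 1))" using bts(1)[of i] by (intro power_decreasing) auto
      also have "\<dots> = (1/4) * (1/4) ^ 2 ^ i"
      proof -
        have "(1/2 :: real) ^ 2 ^ (i + 1) = ((1/2)\<^sup>2) ^ 2 ^ i" by (simp only: power_mult[symmetric]) simp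
        then show ?thesis by (simp add: power_add power2_eq_square)
      qed
      finally show ?thesis unfolding q1 .
    qed
    \<comment> \<open>This quantity determines the exponent: from
      \<open>q * q + 2 \<le> 2 ^ (21 * b)\<close>,
      \<open>b * ?S \<le> 2 * 2 ^ I + 32 * (b * b)\<close>, \<open>2 ^ I \<le> 256 * l\<close> and
      \<open>b * b \<le> 4 * l\<close> results \<open>21 * (512 + 128) = 13440\<close>.\<close>
    show "(Suc (q - 1) * Suc (q - 1) + 2) ^ (\<Sum>j<I. Suc (ts j)) \<le> (2 * n) ^ 13440"
      unfolding q1
    proof (rule B[unfolded B_def])
      let ?S = "\<Sum>j<I. Suc (ts j)"
      have "q * q \<le> 2 ^ (10 * b) * 2 ^ (10 * b)" by (rule mult_le_mono[OF q2 q2])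
      also have "\<dots> = 2 ^ (20 * b)" by (simp only: power_add[symmetric]) simp
      finally have "q * q \<le> 2 ^ (20 * b)" .
      moreover have "(2::nat) ^ 1 \<le> 2 ^ (20 * b)" by (rule power_increasing) (use b(3) in auto)
      ultimately have "q * q + 2 \<le> 2 ^ (20 * b) * 2" by simp
      also have "\<dots> = 2 ^ (20 * b + 1)" by simp
      also have "\<dots> \<le> 2 ^ (21 * b)" by (rule power_increasing) (use b(3) in auto)
      finally have "(q * q + 2) ^ ?S \<le> (2 ^ (21 * b)) ^ ?S" by (rule power_mono) simp
      then show "(q * q + 2) ^ ?S \<le> 2 ^ (21 * (b * ?S))" by (simp only: power_mult[symmetric] mult.assoc)
      have "b * ?S = (\<Sum>j<I. b * ts j + b)" by (simp add: sum_distrib_left algebra_simps)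
      also have "\<dots> \<le> (\<Sum>j<I. 2 * 2 ^ j + (2 + 2 * b))"
      proof (rule sum_mono)
        fix j show "b * ts j + b \<le> 2 * 2 ^ j + (2 + 2 * b)" using bts(2)[of j] by simp
      qed
      also have "\<dots> = 2 * (\<Sum>j<I. 2 ^ j) + I * (2 + 2 * b)"
        by (subst sum.distrib) (simp add: sum_distrib_left)
      also have "(\<Sum>j<I. 2 ^ j) \<le> (2::nat) ^ I" using sum_power2[of I] by (simp add: lessThan_atLeast0)
      also have "I * (2 + 2 * b) \<le> 8 * b * (4 * b)"
        unfolding I_def using b(3) by (intro mult_le_mono) auto
      finally have "b * ?S \<le> 2 * 2 ^ I + 32 * (b * b)" by simp
      then show "21 * (b * ?S) \<le> 13440 * l" using PI b(2) bb by linarith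
    qed
  qed
qed

lemma in_concat_mapI: "x \<in> set xs \<Longrightarrow> y \<in> set (f x) \<Longrightarrow> y \<in> set (concat (map f xs))"
  by auto

text \<open>For \<open>k\<close> below 17 the family whose only group consists of all positions will
  do, as a single element makes \<open>272 * card X\<close> large enough.\<close>

lemma families_hitting:
  assumes cap: "(2 * n) ^ 13440 \<le> cap" and U: "U \<subseteq> {..<n}" "k \<le> card U" and k: "1 \<le> k"
  obtains F where "F \<in> set (families cap n)" "\<And>g. g \<in> set F \<Longrightarrow> set g \<inter> U \<noteq> {}"
    "\<And>X. X \<subseteq> {..<n} \<Longrightarrow> (\<And>g. g \<in> set F \<Longrightarrow> set g \<inter> X \<noteq> {}) \<Longrightarrow> k \<le> 272 * card X"
proof (cases "17 \<le> k")
  case False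
  show ?thesis
  proof (rule that[of "[[0..<n]]"])
    show "[[0..<n]] \<in> set (families cap n)" by (simp add: families_def)
    have "card U \<noteq> 0" using U k by linarith
    then have "U \<noteq> {}" by auto
    then show "set g \<inter> U \<noteq> {}" if "g \<in> set [[0..<n]]" for g using that U by (auto simp: atLeast0LessThan)
    show "k \<le> 272 * card X" if "X \<subseteq> {..<n}" "\<And>g. g \<in> set [[0..<n]] \<Longrightarrow> set g \<inter> X \<noteq> {}" for X
    proof -
      have "X \<noteq> {}" "finite X" using that finite_subset by auto
      then have "card X \<ge> 1" by (simp add: Suc_le_eq card_gt_0_iff)
      then show ?thesis using False by linarith
    qed
  qed
next
  case True
  have "card U \<le> n" using card_mono[OF _ U(1)] by simp
  then have n: "n \<ge> 1" using U(2) k by linarith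
  obtain m r p I ts where P: "prime (Suc m)" "r > 0" "prime (Suc p)" "n \<le> Suc p" "Suc p \<le> Suc m ^ r"
    "(Suc m ^ r)\<^sup>2 \<le> 2 ^ (2 ^ I)"
    "\<And>i. i < I \<Longrightarrow> (real (r - 1) / Suc m) ^ ts i \<le> (1/4) * (1/4) ^ 2 ^ i"
    "Suc m ^ r \<le> (2 * n) ^ 13440" "2 ^ (2 ^ I) \<le> (2 * n) ^ 13440"
    "(Suc m * Suc m + 2) ^ (\<Sum>j<I. Suc (ts j)) \<le> (2 * n) ^ 13440" "Suc p < (2 * n) ^ 13440"
    using parameters[OF n] by blast
  have caps: "Suc m ^ r \<le> cap" "2 ^ (2 ^ I) \<le> cap" "(Suc m * Suc m + 2) ^ (\<Sum>j<I. Suc (ts j)) \<le> cap" "Suc p < cap"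
    using P(8-11) cap by linarith+
  obtain a \<tau> C where F: "a < Suc p" "\<tau> \<le> Suc p" "(C, null_vec r) \<in> set (cands cap m r)"
    "\<And>g. g \<in> set (family cap n m r p a \<tau> C) \<Longrightarrow> set g \<inter> U \<noteq> {}"
    "\<And>X. X \<subseteq> {..<n} \<Longrightarrow> (\<And>g. g \<in> set (family cap n m r p a \<tau> C) \<Longrightarrow> set g \<inter> X \<noteq> {}) \<Longrightarrow> k \<le> 272 * card X"
    using family_properties[OF P(1-7) caps(1-3) U True] by blast
  have "2 ^ r \<le> Suc m ^ r" using prime_ge_2_nat[OF P(1)] by (intro power_mono) auto
  then have rcap: "r < cap" using caps(1) less_exp[of r] by linarith
  have "Suc m ^ 1 \<le> Suc m ^ r" by (rule power_increasing) (use P(2) in auto)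
  then have mcap: "m < cap" using caps(1) by simp
  have "family cap n m r p a \<tau> (fst (C, null_vec r)) \<in> set (families cap n)"
    unfolding families_def
    by (rule list.set_intros(2), rule in_concat_mapI[of m], simp add: mcap, rule in_concat_mapI[of r], simp add: rcap,
      rule in_concat_mapI[of p], use caps(4) in simp, rule in_concat_mapI[of a], use F(1) caps(4) in simp,
      rule in_concat_mapI[of \<tau>], use F(2) caps(4) in simp, unfold set_map, rule imageI, rule F(3))
  then show ?thesis using that F(4,5) by simp
qed

section \<open>Enumerating the families in polynomial time\<close>

text \<open>A curried function is programmed once on tuples over \<open>UNIV\<close>; composition
  then supplies arguments that are computed from any \<open>a\<close>.\<close>

lemma pt_lift2:
  assumes "pt UNIV (\<lambda>x. F (fst x) (snd x))" "pt A f" "pt A g"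
  shows "pt A (\<lambda>a. F (f a) (g a))"
  using pt_comp[OF pt_Pair[OF assms(2,3)] assms(1)] by simp

lemma pt_lift3:
  assumes "pt UNIV (\<lambda>x. F (fst x) (fst (snd x)) (snd (snd x)))" "pt A f" "pt A g" "pt A h"
  shows "pt A (\<lambda>a. F (f a) (g a) (h a))"
  using pt_comp[OF pt_Pair[OF assms(2) pt_Pair[OF assms(3,4)]] assms(1)] by simp

lemma pt_lift4:
  assumes "pt UNIV (\<lambda>x. F (fst x) (fst (snd x)) (fst (snd (snd x))) (snd (snd (snd x))))"
    "pt A f" "pt A g" "pt A h" "pt A k"
  shows "pt A (\<lambda>a. F (f a) (g a) (h a) (k a))"
  using pt_comp[OF pt_Pair[OF assms(2) pt_Pair[OF assms(3) pt_Pair[OF assms(4,5)]]] assms(1)] by simp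

lemma pt_hd0 [pt_intros]: "pt A xs \<Longrightarrow> pt A (\<lambda>a. hd0 (xs a))"
proof (rule pt_exp[of A xs "Fst (Var 0)"])
  show "evl (Fst (Var 0)) (st (enc (xs a))) = enc (hd0 (xs a))" for a by (cases "xs a") auto
qed

lemma pt_vadd_UNIV: "pt UNIV (\<lambda>x. vadd (fst x) (fst (snd x)) (fst (snd (snd x))) (snd (snd (snd x))))"
  unfolding vadd_def by (intro pt_intros)

lemmas pt_vadd [pt_intros] = pt_lift4[OF pt_vadd_UNIV]

lemma pt_null_vec [pt_intros]: "pt A r \<Longrightarrow> pt A (\<lambda>a. null_vec (r a))"
  unfolding null_vec_def by (intro pt_intros)

lemma pt_modpow_UNIV: "pt UNIV (\<lambda>x. ((\<lambda>z. (z * fst x) mod Suc (fst (snd x))) ^^ fst (snd (snd x))) (snd (snd (snd x))))"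
proof (rule pt_funpow_raw)
  show "pbd UNIV (\<lambda>x :: nat \<times> nat \<times> nat \<times> nat. sz (fst (snd x)) + sz (snd (snd (snd x))))"
    by (intro pbd_add pt_pbd pt_intros)
  show "sz (((\<lambda>z. (z * fst x) mod Suc (fst (snd x))) ^^ i) (snd (snd (snd x)))) \<le>
      sz (fst (snd x)) + sz (snd (snd (snd x)))" for x :: "nat \<times> nat \<times> nat \<times> nat" and i
  proof (cases i)
    case (Suc j)
    have "((\<lambda>z. (z * fst x) mod Suc (fst (snd x))) ^^ i) (snd (snd (snd x))) \<le> fst (snd x)"
      unfolding Suc by (simp add: mod_Suc_le_divisor)
    then show ?thesis by simp
  qed simp
qed (intro pt_intros)+

lemmas pt_modpow [pt_intros] = pt_lift4[OF pt_modpow_UNIV]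

lemma pt_gen_UNIV: "pt UNIV (\<lambda>x. gen (fst x) (fst (snd x)) (fst (snd (snd x))) (snd (snd (snd x))))"
  unfolding gen_def by (intro pt_intros)

lemmas pt_gen [pt_intros] = pt_lift4[OF pt_gen_UNIV]

lemma pt_hash_UNIV: "pt UNIV (\<lambda>x. hash (fst x) (fst (snd x)) (snd (snd x)))"
  unfolding hash_def
proof (rule pt_fold_raw)
  show "pbd UNIV (\<lambda>x :: nat \<times> nat \<times> nat list. sz (fst (snd x)))" by (intro pt_pbd pt_intros)
  show "sz (fold (\<lambda>d z. (z * Suc (fst x) + d) mod Suc (fst (snd x))) ys 0) \<le> sz (fst (snd x))"
    for x :: "nat \<times> nat \<times> nat list" and ys
  proof (cases ys rule: rev_cases)
    case (snoc zs d)
    then have "fold (\<lambda>d z. (z * Suc (fst x) + d) mod Suc (fst (snd x))) ys 0 \<le> fst (snd x)"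
      by (simp only: fold_append o_apply fold.simps id_apply mod_Suc_le_divisor)
    then show ?thesis by simp
  qed simp
qed (intro pt_intros)+

lemmas pt_hash [pt_intros] = pt_lift3[OF pt_hash_UNIV]

lemma sz_vector_le:
  assumes "length v \<le> r" "set v \<subseteq> {..<Suc m}"
  shows "sz v \<le> r * (2 * m + 2) + 1"
proof -
  have "sz v \<le> length v * Suc (2 * m + 1) + 1"
    by (rule sz_list_le) (use assms(2) in auto)
  also have "\<dots> = length v * (2 * m + 2) + 1" by simp
  also have "\<dots> \<le> r * (2 * m + 2) + 1" using assms(1) by (intro add_mono mult_le_mono1 order_refl)
  finally show ?thesis .
qed

lemma pt_vecs_UNIV: "pt UNIV (\<lambda>x. vecs (fst x) (fst (snd x)) (snd (snd x)))"
  unfolding vecs_def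
proof (rule pt_funpow_raw)
  show "pbd UNIV (\<lambda>x :: nat \<times> nat \<times> nat.
      (fst x + 1) * Suc (snd (snd x) * (2 * fst (snd x) + 2) + 1) + 1)"
  proof (rule pbd_mono)
    show "pbd UNIV (\<lambda>x :: nat \<times> nat \<times> nat.
      (sz (fst x) + 1) * Suc (sz (snd (snd x)) * (2 * sz (fst (snd x)) + 2) + 1) + 1)"
      by (intro pbd_add pbd_mult pbd_Suc pbd_const pt_pbd pt_intros)
    show "(fst x + 1) * Suc (snd (snd x) * (2 * fst (snd x) + 2) + 1) + 1 \<le>
      (sz (fst x) + 1) * Suc (sz (snd (snd x)) * (2 * sz (fst (snd x)) + 2) + 1) + 1" for x :: "nat \<times> nat \<times> nat"
      by (intro add_mono mult_le_mono Suc_le_mono[THEN iffD2] order_refl) simp_all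
  qed
  fix x :: "nat \<times> nat \<times> nat" and i
  assume i: "i \<le> snd (snd x)"
  define f where "f = (\<lambda>vs. if fst x < length vs * Suc (fst (snd x)) then vs
      else concat (map (\<lambda>v. map (\<lambda>d. d # v) [0..<Suc (fst (snd x))]) vs))"
  have "length ((f ^^ i) [[]]) \<le> fst x + 1 \<and> (\<forall>v\<in>set ((f ^^ i) [[]]). length v \<le> i \<and> set v \<subseteq> {..<Suc (fst (snd x))})"
  proof (induction i)
    case (Suc i)
    let ?vs = "(f ^^ i) [[]]"
    show ?case
    proof (cases "fst x < length ?vs * Suc (fst (snd x))")
      case True
      then have "(f ^^ Suc i) [[]] = ?vs" by (simp only: funpow.simps o_apply f_def if_True)
      then show ?thesis using Suc by fastforce
    next
      case False
      then have eq: "(f ^^ Suc i) [[]] = concat (map (\<lambda>v. map (\<lambda>d. d # v) [0..<Suc (fst (snd x))]) ?vs)"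
        by (simp only: funpow.simps o_apply f_def if_False)
      have "length (concat (map (\<lambda>v. map (\<lambda>d. d # v) [0..<Suc (fst (snd x))]) ?vs)) = length ?vs * Suc (fst (snd x))"
        by (simp add: length_concat o_def sum_list_triv del: upt_Suc)
      then have "length ((f ^^ Suc i) [[]]) \<le> fst x + 1" using False unfolding eq by linarith
      moreover have "\<forall>v\<in>set ((f ^^ Suc i) [[]]). length v \<le> Suc i \<and> set v \<subseteq> {..<Suc (fst (snd x))}"
        unfolding eq using Suc by (auto simp del: upt_Suc)
      ultimately show ?thesis by blast
    qed
  qed simp
  note * = this
  have "sz ((f ^^ i) [[]]) \<le> length ((f ^^ i) [[]]) * Suc (snd (snd x) * (2 * fst (snd x) + 2) + 1) + 1"
    by (rule sz_list_le, rule sz_vector_le) (use * i in fastforce)+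
  also have "\<dots> \<le> (fst x + 1) * Suc (snd (snd x) * (2 * fst (snd x) + 2) + 1) + 1"
    using * by (intro add_mono mult_le_mono1 order_refl) blast
  finally show "sz (((\<lambda>vs. if fst x < length vs * Suc (fst (snd x)) then vs
      else concat (map (\<lambda>v. map (\<lambda>d. d # v) [0..<Suc (fst (snd x))]) vs)) ^^ i) [[]])
      \<le> (fst x + 1) * Suc (snd (snd x) * (2 * fst (snd x) + 2) + 1) + 1" unfolding f_def .
qed (intro pt_intros)+

lemmas pt_vecs [pt_intros] = pt_lift3[OF pt_vecs_UNIV]

lemma pt_succs_UNIV: "pt UNIV (\<lambda>x. succs (fst x) (fst (snd x)) (snd (snd x)))"
  unfolding succs_def by (intro pt_intros)

lemmas pt_succs [pt_intros] = pt_lift3[OF pt_succs_UNIV]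

definition small_cand :: "nat \<Rightarrow> nat \<Rightarrow> nat \<Rightarrow> nat list list \<times> nat list \<Rightarrow> bool" where
  "small_cand l m r cd \<longleftrightarrow> length (fst cd) \<le> l \<and> set (fst cd) \<subseteq> vspace m r \<and> snd cd \<in> vspace m r"

lemma small_cand_succs:
  assumes "small_cand l m r cd" "cd' \<in> set (succs m r cd)"
  shows "small_cand (2 * l) m r cd'"
  using assms unfolding small_cand_def succs_def
  by (auto simp: vadd_in null_vec_in simp del: upt_Suc)

lemma small_cand_mono: "small_cand l m r cd \<Longrightarrow> l \<le> l' \<Longrightarrow> small_cand l' m r cd"
  unfolding small_cand_def by auto

text \<open>A step at most doubles the length of a cube but, when it acts at all, multiplies the
  number of candidates by at least two. So cubes are never longer than the list of candidates, which
  the cap controls.\<close>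

lemma cand_iter_small:
  "length (cand_iter cap m r i) \<le> cap + 1 \<and>
   (\<forall>cd\<in>set (cand_iter cap m r i). small_cand (length (cand_iter cap m r i)) m r cd)"
proof (induction i)
  case 0
  show ?case by (simp add: small_cand_def null_vec_in)
next
  case (Suc i)
  let ?cs = "cand_iter cap m r i"
  show ?case
  proof (cases "cap < length ?cs * (Suc m * Suc m + 2)")
    case True
    then have "cand_iter cap m r (Suc i) = ?cs" by (simp only: funpow.simps o_apply cand_step_def if_True)
    then show ?thesis using Suc by simp
  next
    case False
    then have eq: "cand_iter cap m r (Suc i) = concat (map (succs m r) ?cs)"
      by (simp only: funpow.simps o_apply cand_step_def if_False)
    have len: "length (concat (map (succs m r) cs)) = length cs * (Suc m * Suc m + 2)" for cs
      by (induction cs) (auto simp: length_succs)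
    have "2 * length ?cs \<le> length ?cs * (Suc m * Suc m + 2)" by simp
    then have "small_cand (length (cand_iter cap m r (Suc i))) m r cd'"
      if "cd' \<in> set (cand_iter cap m r (Suc i))" for cd'
      using that Suc small_cand_succs small_cand_mono unfolding eq len set_concat set_map by blast
    moreover have "length (cand_iter cap m r (Suc i)) \<le> cap + 1" using False unfolding eq len by linarith
    ultimately show ?thesis by blast
  qed
qed

lemma sz_small_cand:
  assumes "small_cand l m r cd"
  shows "sz cd \<le> l * Suc (r * (2 * m + 2) + 1) + 1 + (r * (2 * m + 2) + 1) + 1"
proof -
  have v: "sz v \<le> r * (2 * m + 2) + 1" if "v \<in> vspace m r" for v
    using that by (intro sz_vector_le) (auto simp: vspace_def)
  have "sz (fst cd) \<le> length (fst cd) * Suc (r * (2 * m + 2) + 1) + 1"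
    by (rule sz_list_le) (use assms v in \<open>auto simp: small_cand_def simp del: sz_nat\<close>)
  also have "\<dots> \<le> l * Suc (r * (2 * m + 2) + 1) + 1"
    using assms by (intro add_mono mult_le_mono1 order_refl) (simp add: small_cand_def)
  finally show ?thesis using v[of "snd cd"] assms by (simp add: small_cand_def)
qed

lemma pt_cands_UNIV: "pt UNIV (\<lambda>x. cands (fst x) (fst (snd x)) (snd (snd x)))"
  unfolding cands_def
proof (rule pt_funpow_raw)
  let ?B = "\<lambda>c r m :: nat. (c + 1) * Suc ((c + 1) * Suc (r * (2 * m + 2) + 1) + 1 + (r * (2 * m + 2) + 1) + 1) + 1"
  show "pbd UNIV (\<lambda>x :: nat \<times> nat \<times> nat. ?B (sz (fst x)) (sz (snd (snd x))) (sz (fst (snd x))))"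
    by (intro pbd_add pbd_mult pbd_Suc pbd_const pt_pbd pt_intros)
  fix x :: "nat \<times> nat \<times> nat" and i
  let ?cs = "cand_iter (fst x) (fst (snd x)) (snd (snd x)) i"
  have 1: "length ?cs \<le> fst x + 1" "\<And>cd. cd \<in> set ?cs \<Longrightarrow> small_cand (fst x + 1) (fst (snd x)) (snd (snd x)) cd"
    using cand_iter_small small_cand_mono by blast+
  have "sz ?cs \<le> length ?cs * Suc ((fst x + 1) * Suc (snd (snd x) * (2 * fst (snd x) + 2) + 1) + 1 +
      (snd (snd x) * (2 * fst (snd x) + 2) + 1) + 1) + 1"
    by (rule sz_list_le) (rule sz_small_cand[OF 1(2)])
  also have "\<dots> \<le> ?B (fst x) (snd (snd x)) (fst (snd x))"
    using 1(1) by (intro add_mono mult_le_mono1 order_refl)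
  also have "\<dots> \<le> ?B (sz (fst x)) (sz (snd (snd x))) (sz (fst (snd x)))"
    by (intro add_mono mult_le_mono Suc_le_mono[THEN iffD2] order_refl) simp_all
  finally show "sz ?cs \<le> ?B (sz (fst x)) (sz (snd (snd x))) (sz (fst (snd x)))" .
next
  show "pt (UNIV \<times> UNIV) (\<lambda>p. cand_step (fst (fst p)) (fst (snd (fst p))) (snd (snd (fst p))) (snd p))"
    unfolding cand_step_def by (intro pt_intros)
qed (intro pt_intros)+

lemmas pt_cands [pt_intros] = pt_lift3[OF pt_cands_UNIV]

lemma pt_subs_UNIV: "pt UNIV (\<lambda>x. subs (fst x) (snd x :: 'a::encodable list))"
  unfolding subs_def
proof (rule pt_fold_raw)
  show "pbd UNIV (\<lambda>x :: nat \<times> 'a list. (sz (fst x) + 1) * Suc (sz (snd x)) + 1)"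
    by (intro pbd_add pbd_mult pbd_Suc pbd_const pt_pbd pt_intros)
  fix x :: "nat \<times> 'a list" and ys zs
  assume x: "snd x = ys @ zs"
  let ?f = "fold (\<lambda>c Ws. if fst x < 2 * length Ws then Ws else Ws @ map (\<lambda>W. c # W) Ws)"
  have "length (?f ys [[]]) \<le> fst x + 1 \<and> (\<forall>W\<in>set (?f ys [[]]). sz W \<le> sz ys)"
  proof (induction ys rule: rev_induct)
    case (snoc c ys)
    have "Suc (sz (ys @ [c])) = sz ys + sz [c]" by (rule sz_append)
    then have "sz (ys @ [c]) = sz ys + sz c + 1" by simp
    then show ?case using snoc by (auto simp: le_SucI trans_le_add1)
  qed simp
  note * = this
  have "sz (?f ys [[]]) \<le> length (?f ys [[]]) * Suc (sz ys) + 1" by (rule sz_list_le) (use * in blast)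
  also have "\<dots> \<le> (sz (fst x) + 1) * Suc (sz (snd x)) + 1"
  proof (intro add_mono mult_le_mono order_refl)
    show "length (?f ys [[]]) \<le> sz (fst x) + 1" using * by simp
    show "Suc (sz ys) \<le> Suc (sz (snd x))" using sz_append[of ys zs] dsize_ge_1[of "enc zs"] unfolding x by linarith
  qed
  finally show "sz (?f ys [[]]) \<le> (sz (fst x) + 1) * Suc (sz (snd x)) + 1" .
qed (intro pt_intros)+

lemmas pt_subs [pt_intros] = pt_lift2[OF pt_subs_UNIV]

lemma pt_family_UNIV: "pt UNIV (\<lambda>x. family (fst x) (fst (snd x)) (fst (snd (snd x))) (fst (snd (snd (snd x))))
   (fst (snd (snd (snd (snd x))))) (fst (snd (snd (snd (snd (snd x))))))
   (fst (snd (snd (snd (snd (snd (snd x))))))) (snd (snd (snd (snd (snd (snd (snd x))))))))"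
  unfolding family_def by (intro pt_intros)

lemma pt_family [pt_intros]:
  assumes "pt A cap" "pt A n" "pt A m" "pt A r" "pt A p" "pt A b" "pt A t" "pt A C"
  shows "pt A (\<lambda>a. family (cap a) (n a) (m a) (r a) (p a) (b a) (t a) (C a))"
proof -
  have "pt A (\<lambda>a. (cap a, n a, m a, r a, p a, b a, t a, C a))" by (intro pt_Pair assms)
  from pt_comp[OF this pt_family_UNIV] show ?thesis by simp
qed

lemma pt_families_UNIV: "pt UNIV (\<lambda>x. families (fst x) (snd x))"
  unfolding families_def by (intro pt_intros)

lemmas pt_families [pt_intros] = pt_lift2[OF pt_families_UNIV]

section \<open>The algorithm\<close>

text \<open>Vertices remain the codes found in the input; the algorithm compares them but never
  decodes them.\<close>

type_synonym edges = "(data \<times> data) list"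
type_synonym dtree = "data list \<times> edges"

definition sym_edges :: "edges \<Rightarrow> edges" where
  "sym_edges es = es @ map (\<lambda>e. (snd e, fst e)) es"

definition attach :: "data \<times> data \<Rightarrow> dtree \<Rightarrow> dtree" where
  "attach e t = (if fst e \<in> set (fst t) \<and> snd e \<notin> set (fst t) then (snd e # fst t, e # snd t) else t)"

text \<open>A pass over the edges that changes anything adds a vertex, and a grown tree has at most
  \<open>Suc (length (sym_edges es))\<close> vertices, so this many passes reach a fixed point. The
  result is a tree for any list \<open>es\<close>.\<close>

definition span :: "data \<Rightarrow> edges \<Rightarrow> dtree" where
  "span r es = (fold attach (sym_edges es) ^^ Suc (length (sym_edges es))) ([r], [])"

text \<open>Counts list entries rather than distinct edges and so is additive under concatenation of
  edge lists.\<close>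

definition degree_at :: "data \<Rightarrow> edges \<Rightarrow> nat" where
  "degree_at v es = length (filter (\<lambda>e. fst e = v \<or> snd e = v) es)"

definition maxdeg :: "dtree \<Rightarrow> nat" where
  "maxdeg t = fold max (map (\<lambda>v. degree_at v (snd t)) (fst t)) 0"

definition pick :: "dtree list \<Rightarrow> dtree list" where
  "pick ts = first (filter (\<lambda>t. \<forall>t'\<in>set ts. maxdeg t \<le> maxdeg t') ts)"

definition covered :: "data list \<Rightarrow> dtree \<Rightarrow> nat" where
  "covered S t = length (filter (\<lambda>s. s \<in> set (fst t)) S)"

definition in_vertices :: "data \<Rightarrow> data list" where
  "in_vertices x = data_list (dfst (dfst x))"

definition in_edges :: "data \<Rightarrow> edges" where
  "in_edges x = map (\<lambda>e. (dfst e, dsnd e)) (data_list (dsnd (dfst x)))"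

definition in_terminals :: "data \<Rightarrow> data list" where
  "in_terminals x = remdups (data_list (dfst (dsnd x)))"

text \<open>Converting the binary number \<open>k\<close> to unary is only affordable up to a cap; above the number of terminals
  its exact value does not matter.\<close>

definition in_bound :: "data \<Rightarrow> nat" where
  "in_bound x = fold (\<lambda>b z. min (Suc (length (in_terminals x))) (2 * z + (if b = Nl then 0 else 1)))
     (rev (data_list (dsnd (dsnd x)))) 0"

text \<open>The groups are intersected with the vertex set so that this is an instance for every \<open>r\<close>, \<open>S\<close> and \<open>F\<close>.\<close>

definition gst_input :: "data \<Rightarrow> data \<Rightarrow> data list \<Rightarrow> nat list list \<Rightarrow> data" where
  "gst_input x r S F = Pr (dfst x) (enc (map (filter (\<lambda>s. s \<in> set (in_vertices x)))
     ([r] # map (\<lambda>g. concat (map (\<lambda>i. first (drop i S)) g)) F)))"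

text \<open>Of the oracle's answer only the edge list is read, with edges accepted in either
  orientation; the vertices are recovered by reachability from \<open>r\<close>.\<close>

definition out_tree :: "data \<Rightarrow> data \<Rightarrow> data \<Rightarrow> dtree" where
  "out_tree x r y = span r (filter (\<lambda>e. e \<in> set (sym_edges (in_edges x)))
     (map (\<lambda>e. (dfst e, dsnd e)) (data_list (dsnd y))))"

definition enum_cap :: "nat \<Rightarrow> nat" where
  "enum_cap n = (2 * n) ^ 13440"

definition candidates :: "(data \<Rightarrow> data) \<Rightarrow> data \<Rightarrow> data \<Rightarrow> data list \<Rightarrow> dtree list" where
  "candidates orc x r S = map (\<lambda>F. out_tree x r (orc (gst_input x r S F)))
     (families (enum_cap (length S)) (length S))"

type_synonym rstate = "data list \<times> nat \<times> edges"

text \<open>The guarantee of \<open>families_hitting\<close> is tested on the tree itself, so it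
  does not matter from which family the tree of least degree comes.\<close>

definition select :: "(data \<Rightarrow> data) \<Rightarrow> data \<Rightarrow> data \<Rightarrow> rstate \<Rightarrow> dtree list" where
  "select orc x r s = pick (filter (\<lambda>t. fst (snd s) \<le> 272 * covered (fst s) t) (candidates orc x r (fst s)))"

definition update :: "dtree \<Rightarrow> rstate \<Rightarrow> rstate" where
  "update t s = (filter (\<lambda>v. v \<notin> set (fst t)) (fst s), fst (snd s) - covered (fst s) t, snd t @ snd (snd s))"

text \<open>Folding over a list of at most one tree leaves the state unchanged if no candidate
  qualifies, which may happen for a root outside the optimal tree.\<close>

definition round :: "(data \<Rightarrow> data) \<Rightarrow> data \<Rightarrow> data \<Rightarrow> rstate \<Rightarrow> rstate" where
  "round orc x r s = (if fst (snd s) = 0 then s else fold update (select orc x r s) s)"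

definition rounds :: "(data \<Rightarrow> data) \<Rightarrow> data \<Rightarrow> data \<Rightarrow> nat \<Rightarrow> rstate" where
  "rounds orc x r j = (round orc x r ^^ j) (in_terminals x, in_bound x, [])"

text \<open>As many rounds as terminals suffice: for a root in the optimal tree each round lowers a
  positive bound, and later rounds do nothing. The degree is charged to the potential
  \<open>ratio\<close>, not to this number of rounds.\<close>

definition solve :: "(data \<Rightarrow> data) \<Rightarrow> data \<Rightarrow> dtree list" where
  "solve orc x = pick (filter (\<lambda>t. in_bound x \<le> covered (in_terminals x) t)
     (map (\<lambda>r. span r (snd (snd (rounds orc x r (length (in_terminals x)))))) (in_vertices x)))"

text \<open>The first component of the code of a singleton list is the code of its element.\<close>

definition solution :: "(data \<Rightarrow> data) \<Rightarrow> data \<Rightarrow> data" where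
  "solution orc x = dfst (enc (solve orc x))"

text \<open>Trees obtained from \<open>r\<close> by attaching leaves along edges of
  \<open>es\<close>. It forgets the order in which \<open>span\<close> scans the edges and so
  supports induction on the tree.\<close>

inductive grown :: "data \<Rightarrow> edges \<Rightarrow> dtree \<Rightarrow> bool" for r es where
  start: "grown r es ([r], [])"
| grow: "grown r es t \<Longrightarrow> e \<in> set (sym_edges es) \<Longrightarrow> fst e \<in> set (fst t) \<Longrightarrow> snd e \<notin> set (fst t) \<Longrightarrow>
    grown r es (snd e # fst t, e # snd t)"

lemma grown_step: "grown r es t \<Longrightarrow> e \<in> set (sym_edges es) \<Longrightarrow> grown r es (attach e t)"
  unfolding attach_def by (auto intro: grown.grow)

lemma grown_fold: "grown r es t \<Longrightarrow> set xs \<subseteq> set (sym_edges es) \<Longrightarrow> grown r es (fold attach xs t)"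
proof (induction xs arbitrary: t)
  case (Cons x xs)
  have "grown r es (fold attach xs (attach x t))"
    by (rule Cons.IH[OF grown_step]) (use Cons.prems in auto)
  then show ?case by simp
qed simp

lemma grown_funpow: "grown r es ((fold attach (sym_edges es) ^^ n) ([r], []))"
  by (induction n) (auto intro: grown.start grown_fold)

lemma grown_span: "grown r es (span r es)"
  unfolding span_def by (rule grown_funpow)

lemma grown_mono:
  assumes "grown r es t" "set (sym_edges es) \<subseteq> set (sym_edges es')"
  shows "grown r es' t"
  using assms by (induction rule: grown.induct) (auto intro: grown.intros)

lemma sym_edges_mono: "set es \<subseteq> set (sym_edges es') \<Longrightarrow> set (sym_edges es) \<subseteq> set (sym_edges es')"
  by (fastforce simp: sym_edges_def)

lemma grown_distinct: "grown r es t \<Longrightarrow> distinct (fst t)"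
  by (induction rule: grown.induct) auto

lemma grown_vertices: "grown r es t \<Longrightarrow> set (fst t) \<subseteq> insert r (snd ` set (sym_edges es))"
  by (induction rule: grown.induct) auto

lemma grown_edges: "grown r es t \<Longrightarrow> set (snd t) \<subseteq> set (sym_edges es)"
  by (induction rule: grown.induct) auto

lemma grown_length: "grown r es t \<Longrightarrow> length (fst t) = Suc (length (snd t))"
  by (induction rule: grown.induct) auto

lemma grown_length_le:
  assumes "grown r es t"
  shows "length (fst t) \<le> Suc (length (sym_edges es))"
proof -
  have "length (fst t) = card (set (fst t))" using grown_distinct[OF assms] by (simp add: distinct_card)
  also have "\<dots> \<le> card (insert r (snd ` set (sym_edges es)))"
    by (rule card_mono[OF _ grown_vertices[OF assms]]) simp
  also have "\<dots> \<le> Suc (card (snd ` set (sym_edges es)))" by (rule card_insert_le_m1) auto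
  also have "card (snd ` set (sym_edges es)) \<le> length (sym_edges es)"
    by (meson card_image_le card_length finite_set order_trans)
  finally show ?thesis by simp
qed

lemma sz_grown:
  assumes "grown r es t"
  shows "sz t \<le> 4 * (sz (sym_edges es) + 1) * (sz r + sz (sym_edges es) + 2) + 4"
proof -
  let ?n = "sz (sym_edges es)" and ?B = "sz r + sz (sym_edges es)"
  have n: "length (fst t) \<le> ?n + 1" "length (snd t) \<le> ?n + 1"
    using grown_length_le[OF assms] grown_length[OF assms] length_le_sz[of "sym_edges es"] by linarith+
  have e: "sz e \<le> ?n" if "e \<in> set (sym_edges es)" for e using that by (rule sz_member)
  then have e2: "sz (snd e) \<le> ?n" if "e \<in> set (sym_edges es)" for e
    using e[OF that] by simp
  have "sz (fst t) \<le> length (fst t) * Suc ?B + 1"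
    by (rule sz_list_le) (use grown_vertices[OF assms] e2 in \<open>fastforce simp: trans_le_add2\<close>)
  also have "\<dots> \<le> (?n + 1) * Suc ?B + 1" using n by (intro add_mono mult_le_mono1 order_refl)
  finally have 1: "sz (fst t) \<le> (?n + 1) * Suc ?B + 1" .
  have "sz (snd t) \<le> length (snd t) * Suc ?B + 1"
    by (rule sz_list_le) (use grown_edges[OF assms] e in \<open>fastforce simp: trans_le_add2\<close>)
  also have "\<dots> \<le> (?n + 1) * Suc ?B + 1" using n by (intro add_mono mult_le_mono1 order_refl)
  finally have 2: "sz (snd t) \<le> (?n + 1) * Suc ?B + 1" .
  define Y where "Y = (?n + 1) * (?B + 2)"
  have "(?n + 1) * Suc ?B \<le> Y" unfolding Y_def by (intro mult_le_mono2) simp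
  moreover have "sz t = Suc (sz (fst t) + sz (snd t))" by simp
  ultimately have "sz t \<le> 4 * Y + 4" using 1 2 by linarith
  then show ?thesis unfolding Y_def by (simp only: mult.assoc)
qed

section \<open>Running time of the algorithm\<close>

lemma pt_sym_edges [pt_intros]: "pt A es \<Longrightarrow> pt A (\<lambda>a. sym_edges (es a))"
  unfolding sym_edges_def by (intro pt_intros)

lemma pt_span_UNIV: "pt UNIV (\<lambda>x. span (fst x) (snd x))"
  unfolding span_def
proof (rule pt_funpow_raw)
  show "pbd UNIV (\<lambda>x :: data \<times> edges. 4 * (sz (sym_edges (snd x)) + 1) * (sz (fst x) + sz (sym_edges (snd x)) + 2) + 4)"
    by (intro pbd_add pbd_mult pbd_const pt_pbd pt_intros)
  show "sz ((fold attach (sym_edges (snd x)) ^^ i) ([fst x], [])) \<le>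
      4 * (sz (sym_edges (snd x)) + 1) * (sz (fst x) + sz (sym_edges (snd x)) + 2) + 4" for x :: "data \<times> edges" and i
    by (rule sz_grown[OF grown_funpow])
  show "pt (UNIV \<times> UNIV) (\<lambda>p :: (data \<times> edges) \<times> dtree. fold attach (sym_edges (snd (fst p))) (snd p))"
  proof (rule pt_fold)
    show "pt ((UNIV \<times> UNIV) \<times> UNIV) (\<lambda>p :: ((data \<times> edges) \<times> dtree) \<times> (data \<times> data) \<times> dtree. attach (fst (snd p)) (snd (snd p)))"
      unfolding attach_def by (intro pt_intros)
    show "pbd (UNIV \<times> UNIV) (\<lambda>p :: (data \<times> edges) \<times> dtree. 2 * sz (sym_edges (snd (fst p))) + 2)"
      by (intro pbd_add pbd_mult pbd_const pt_pbd pt_intros)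
    show "sz (attach e t) \<le> sz t + (2 * sz (sym_edges (snd (fst p))) + 2)"
      if "e \<in> set (sym_edges (snd (fst p)))" for p :: "(data \<times> edges) \<times> dtree" and e t
      using sz_member[OF that] by (simp add: attach_def)
  qed (intro pt_intros)+
qed (intro pt_intros)+

lemmas pt_span [pt_intros] = pt_lift2[OF pt_span_UNIV]

lemma pt_degree_at_UNIV: "pt UNIV (\<lambda>x. degree_at (fst x) (snd x))"
  unfolding degree_at_def by (intro pt_intros)

lemmas pt_degree_at [pt_intros] = pt_lift2[OF pt_degree_at_UNIV]

lemma pt_maxdeg_UNIV: "pt UNIV maxdeg"
  unfolding maxdeg_def
proof (rule pt_fold)
  show "pbd UNIV (\<lambda>t. sz (map (\<lambda>v. degree_at v (snd t)) (fst t)))" by (intro pt_pbd pt_intros)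
  show "sz (max d y) \<le> sz y + sz (map (\<lambda>v. degree_at v (snd t)) (fst t))"
    if "d \<in> set (map (\<lambda>v. degree_at v (snd t)) (fst t))" for t :: dtree and d y
    using sz_member[OF that] by (simp add: max_def)
qed (intro pt_intros)+

lemma pt_maxdeg [pt_intros]: "pt A t \<Longrightarrow> pt A (\<lambda>a. maxdeg (t a))"
  by (rule pt_comp[OF _ pt_maxdeg_UNIV]) auto

lemma pt_pick_UNIV: "pt UNIV pick"
  unfolding pick_def by (intro pt_intros)

lemma pt_pick [pt_intros]: "pt A ts \<Longrightarrow> pt A (\<lambda>a. pick (ts a))"
  by (rule pt_comp[OF _ pt_pick_UNIV]) auto

lemma pt_covered_UNIV: "pt UNIV (\<lambda>x. covered (fst x) (snd x))"
  unfolding covered_def by (intro pt_intros)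

lemmas pt_covered [pt_intros] = pt_lift2[OF pt_covered_UNIV]

lemma pt_remdups [pt_intros]:
  assumes "pt A xs"
  shows "pt A (\<lambda>a. remdups (xs a))"
proof -
  have "pt A (\<lambda>a. fold (\<lambda>x ys. if x \<in> set ys then ys else x # ys) (rev (xs a)) [])"
  proof (rule pt_fold)
    show "pbd A (\<lambda>a. Suc (sz (xs a)))" by (intro pbd_Suc pt_pbd assms)
    show "sz (if x \<in> set ys then ys else x # ys) \<le> sz ys + Suc (sz (xs a))" if "x \<in> set (rev (xs a))" for a x ys
      using sz_member[of x "xs a"] that by simp
  qed (intro pt_intros assms)+
  moreover have "fold (\<lambda>x ys. if x \<in> set ys then ys else x # ys) (rev us) [] = remdups us" for us :: "'b list"
    by (induction us) auto
  ultimately show ?thesis by simp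
qed

lemma pt_Pr [pt_intros]: "pt A f \<Longrightarrow> pt A g \<Longrightarrow> pt A (\<lambda>a. Pr (f a) (g a))"
  by (rule pt_exp[OF pt_Pair, of A f g "Var 0"]) auto

lemma pt_in_vertices [pt_intros]: "pt A x \<Longrightarrow> pt A (\<lambda>a. in_vertices (x a))"
  unfolding in_vertices_def by (intro pt_intros)

lemma pt_in_edges [pt_intros]: "pt A x \<Longrightarrow> pt A (\<lambda>a. in_edges (x a))"
  unfolding in_edges_def by (intro pt_intros)

lemma pt_in_terminals [pt_intros]: "pt A x \<Longrightarrow> pt A (\<lambda>a. in_terminals (x a))"
  unfolding in_terminals_def by (intro pt_intros)

lemma pt_in_bound_UNIV: "pt UNIV in_bound"
  unfolding in_bound_def
proof (rule pt_fold_raw)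
  show "pbd UNIV (\<lambda>x. sz (Suc (length (in_terminals x))))" by (intro pt_pbd pt_intros)
  show "sz (fold (\<lambda>b z. min (Suc (length (in_terminals x))) (2 * z + (if b = Nl then 0 else 1))) ys 0)
      \<le> sz (Suc (length (in_terminals x)))" for x and ys :: "data list"
  proof (cases ys rule: rev_cases)
    case (snoc zs d)
    then have "fold (\<lambda>b z. min (Suc (length (in_terminals x))) (2 * z + (if b = Nl then 0 else 1))) ys 0 \<le> Suc (length (in_terminals x))"
      by (simp only: fold_append o_apply fold.simps id_apply min.cobounded1)
    then show ?thesis unfolding sz_nat by (intro add_mono mult_le_mono2 order_refl)
  qed simp
qed (intro pt_intros)+

lemma pt_in_bound [pt_intros]: "pt A x \<Longrightarrow> pt A (\<lambda>a. in_bound (x a))"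
  by (rule pt_comp[OF _ pt_in_bound_UNIV]) auto

lemma pt_gst_input_UNIV: "pt UNIV (\<lambda>x. gst_input (fst x) (fst (snd x)) (fst (snd (snd x))) (snd (snd (snd x))))"
  unfolding gst_input_def by (intro pt_intros)

lemmas pt_gst_input [pt_intros] = pt_lift4[OF pt_gst_input_UNIV]

lemma pt_out_tree_UNIV: "pt UNIV (\<lambda>x. out_tree (fst x) (fst (snd x)) (snd (snd x)))"
  unfolding out_tree_def by (intro pt_intros)

lemmas pt_out_tree [pt_intros] = pt_lift3[OF pt_out_tree_UNIV]

lemma grown_out_tree: "grown r (in_edges x) (out_tree x r y)"
  unfolding out_tree_def by (rule grown_mono[OF grown_span sym_edges_mono]) auto

lemma set_pick: "set (pick ts) \<subseteq> set ts"
  unfolding pick_def first_def using set_take_subset[of 1] by fastforce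

lemma length_pick: "length (pick ts) \<le> 1"
  by (simp add: pick_def first_def)

lemma grown_select: "t \<in> set (select orc x r s) \<Longrightarrow> grown r (in_edges x) t"
  unfolding select_def candidates_def by (drule subsetD[OF set_pick]) (auto intro: grown_out_tree)

lemma sz_filter: "sz (filter P xs) \<le> sz xs"
  by (induction xs) auto

context
  fixes orc :: "data \<Rightarrow> data" and D A :: "data set"
  assumes orc: "pt D orc" and A: "\<And>x r S F. x \<in> A \<Longrightarrow> gst_input x r S F \<in> D"
begin

lemma pt_enum_cap: "pt X n \<Longrightarrow> pt X (\<lambda>a. enum_cap (n a))"
  unfolding enum_cap_def by (intro pt_intros)

text \<open>The only place where the oracle is called; all its queries lie in \<open>D\<close>, the
  set on which it is known to be polynomial.\<close>

lemma pt_candidates: "pt (A \<times> UNIV) (\<lambda>p. candidates orc (fst p) (fst (snd p)) (snd (snd p)))"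
  unfolding candidates_def
proof (rule pt_map)
  show "pt (A \<times> UNIV) (\<lambda>p :: data \<times> data \<times> data list. families (enum_cap (length (snd (snd p)))) (length (snd (snd p))))"
    by (intro pt_enum_cap pt_intros)
  have "pt ((A \<times> UNIV) \<times> UNIV) (\<lambda>p :: (data \<times> data \<times> data list) \<times> nat list list.
      orc (gst_input (fst (fst p)) (fst (snd (fst p))) (snd (snd (fst p))) (snd p)))"
  proof (rule pt_comp[OF _ orc])
    show "pt ((A \<times> UNIV) \<times> UNIV) (\<lambda>p :: (data \<times> data \<times> data list) \<times> nat list list.
      gst_input (fst (fst p)) (fst (snd (fst p))) (snd (snd (fst p))) (snd p))" by (intro pt_intros)
  qed (auto intro: A)
  then show "pt ((A \<times> UNIV) \<times> UNIV) (\<lambda>p :: (data \<times> data \<times> data list) \<times> nat list list.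
      out_tree (fst (fst p)) (fst (snd (fst p)))
        (orc (gst_input (fst (fst p)) (fst (snd (fst p))) (snd (snd (fst p))) (snd p))))"
    by (intro pt_out_tree pt_fst pt_snd pt_id)
qed

lemma pt_select: "pt (A \<times> UNIV) (\<lambda>p. select orc (fst p) (fst (snd p)) (snd (snd p)))"
proof -
  have "pt (A \<times> UNIV) (\<lambda>p :: data \<times> data \<times> rstate. (fst p, fst (snd p), fst (snd (snd p))))"
    by (intro pt_intros)
  from pt_comp[OF this pt_candidates]
  have "pt (A \<times> UNIV) (\<lambda>p :: data \<times> data \<times> rstate. candidates orc (fst p) (fst (snd p)) (fst (snd (snd p))))"
    by auto
  then have "pt (A \<times> UNIV) (\<lambda>p :: data \<times> data \<times> rstate. filter (\<lambda>t. fst (snd (snd (snd p))) \<le> 272 * covered (fst (snd (snd p))) t)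
      (candidates orc (fst p) (fst (snd p)) (fst (snd (snd p)))))"
    by (rule pt_filter) (intro pt_intros)
  then show ?thesis unfolding select_def by (rule pt_pick)
qed

lemma pt_update_UNIV: "pt UNIV (\<lambda>x. update (fst x) (snd x))"
  unfolding update_def by (intro pt_intros)

lemmas pt_update = pt_lift2[OF pt_update_UNIV]

lemma sz_update: "sz (update t s) \<le> sz s + sz t"
proof -
  have "Suc (sz (snd t @ snd (snd s))) = sz (snd t) + sz (snd (snd s))" by (rule sz_append)
  moreover have "sz (filter (\<lambda>v. v \<notin> set (fst t)) (fst s)) \<le> sz (fst s)" by (rule sz_filter)
  moreover have "sz (fst (snd s) - covered (fst s) t) \<le> sz (fst (snd s))" by simp
  ultimately show ?thesis unfolding update_def enc_prod_def fst_conv snd_conv dsize.simps by linarith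
qed

definition tree_size_bound :: "data \<times> data \<Rightarrow> nat" where
  "tree_size_bound x = 4 * (sz (sym_edges (in_edges (fst x))) + 1) * (sz (snd x) + sz (sym_edges (in_edges (fst x))) + 2) + 4"

lemma pbd_tree_size_bound: "pbd X tree_size_bound"
  unfolding tree_size_bound_def by (intro pbd_add pbd_mult pbd_const pt_pbd pt_intros)

lemma sz_select: "t \<in> set (select orc x r s) \<Longrightarrow> sz t \<le> tree_size_bound (x, r)"
  unfolding tree_size_bound_def fst_conv snd_conv by (rule sz_grown[OF grown_select])

text \<open>The added tree is bounded in terms of the input and the root, not of the current state,
  so the state grows only linearly with the number of rounds.\<close>

lemma sz_round: "sz (round orc x r s) \<le> sz s + tree_size_bound (x, r)"
proof -
  have "length (select orc x r s) \<le> 1" unfolding select_def by (rule length_pick)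
  then consider "select orc x r s = []" | t where "select orc x r s = [t]"
    by (cases "select orc x r s") auto
  then show ?thesis
  proof cases
    case (2 t)
    then have "sz (update t s) \<le> sz s + tree_size_bound (x, r)"
      using sz_update[of t s] sz_select[of t x r s] by simp
    then show ?thesis using 2 by (simp add: round_def del: enc_prod_def)
  qed (simp add: round_def del: enc_prod_def)
qed

lemma pt_round: "pt (A \<times> UNIV) (\<lambda>p. round orc (fst p) (fst (snd p)) (snd (snd p)))"
  unfolding round_def
proof (rule pt_If)
  show "pt (A \<times> UNIV) (\<lambda>p :: data \<times> data \<times> rstate. fst (snd (snd (snd p))) = 0)" by (intro pt_intros)
  show "pt (A \<times> UNIV) (\<lambda>p :: data \<times> data \<times> rstate. snd (snd p))" by (intro pt_intros)
  show "pt (A \<times> UNIV) (\<lambda>p :: data \<times> data \<times> rstate. fold update (select orc (fst p) (fst (snd p)) (snd (snd p))) (snd (snd p)))"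
  proof (rule pt_fold[OF pt_select])
    show "pt (A \<times> UNIV) (\<lambda>p :: data \<times> data \<times> rstate. snd (snd p))" by (intro pt_intros)
    show "pt ((A \<times> UNIV) \<times> UNIV) (\<lambda>p :: (data \<times> data \<times> rstate) \<times> dtree \<times> rstate. update (fst (snd p)) (snd (snd p)))"
      by (intro pt_update pt_intros)
    have "pt (A \<times> UNIV) (\<lambda>p :: data \<times> data \<times> rstate. (fst p, fst (snd p)))" by (intro pt_intros)
    from pbd_comp[OF pbd_tree_size_bound pt_pbd[OF this]]
    show "pbd (A \<times> UNIV) (\<lambda>p :: data \<times> data \<times> rstate. tree_size_bound (fst p, fst (snd p)))" by blast
    show "sz (update t s) \<le> sz s + tree_size_bound (fst p, fst (snd p))"
      if "t \<in> set (select orc (fst p) (fst (snd p)) (snd (snd p)))" for p :: "data \<times> data \<times> rstate" and t s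
      using sz_update[of t s] sz_select[OF that] by simp
  qed
qed

lemma pt_solution: "pt A (solution orc)"
proof -
  have round: "pt ((A \<times> UNIV) \<times> UNIV) (\<lambda>p. round orc (fst (fst p)) (snd (fst p)) (snd p))"
  proof -
    have "pt ((A \<times> UNIV) \<times> UNIV) (\<lambda>p :: (data \<times> data) \<times> rstate. (fst (fst p), snd (fst p), snd p))"
      by (intro pt_intros)
    from pt_comp[OF this pt_round] show ?thesis by auto
  qed
  have "pt (A \<times> UNIV) (\<lambda>p. rounds orc (fst p) (snd p) (length (in_terminals (fst p))))"
    unfolding rounds_def
  proof (rule pt_funpow[OF _ _ round pbd_tree_size_bound])
    show "pt (A \<times> UNIV) (\<lambda>p :: data \<times> data. length (in_terminals (fst p)))" by (intro pt_intros)
    show "pt (A \<times> UNIV) (\<lambda>p :: data \<times> data. (in_terminals (fst p), in_bound (fst p), [] :: edges))" by (intro pt_intros)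
    show "sz (round orc (fst p) (snd p) s) \<le> sz s + tree_size_bound p" for p s
      using sz_round[of "fst p" "snd p" s] by simp
  qed
  then have "pt (A \<times> UNIV) (\<lambda>p. span (snd p) (snd (snd (rounds orc (fst p) (snd p) (length (in_terminals (fst p)))))))"
    by (intro pt_span pt_snd pt_id)
  from pt_map[OF pt_in_vertices[OF pt_id] this]
  have "pt A (\<lambda>x. map (\<lambda>r. span r (snd (snd (rounds orc x r (length (in_terminals x)))))) (in_vertices x))" .
  then have "pt A (\<lambda>x. filter (\<lambda>t. in_bound x \<le> covered (in_terminals x) t)
      (map (\<lambda>r. span r (snd (snd (rounds orc x r (length (in_terminals x)))))) (in_vertices x)))"
    by (rule pt_filter) (intro pt_intros)
  from pt_dfst[OF pt_enc[OF pt_pick[OF this]]] show ?thesis unfolding solution_def solve_def .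
qed

end

section \<open>Exchange between the two notions of polynomial-time computation\<close>

lemma runs_clear:
  "runs (fold (\<lambda>v c. Seq c (Assign v (Const Nl))) vs Skip) s (2 * length vs + 1) (\<lambda>v. if v \<in> set vs then Nl else s v)"
proof (induction vs rule: rev_induct)
  case Nil
  show ?case unfolding runs_def using exec.Skip[of s] by auto
next
  case (snoc w vs)
  have "runs (Assign w (Const Nl)) (\<lambda>v. if v \<in> set vs then Nl else s v) 2 (\<lambda>v. if v \<in> set (vs @ [w]) then Nl else s v)"
    by (rule runs_Assign) auto
  from runs_Seq[OF snoc this] show ?case by simp
qed

text \<open>An arbitrary program may leave values behind; afterwards all variables that it can
  touch, except variable 0, are reset to \<open>Nl\<close>, as \<open>pt\<close> demands.\<close>

lemma pt_of_computes:
  fixes p :: "nat poly"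
  assumes "\<And>x. x \<in> D \<Longrightarrow> \<exists>t. computes c x t (f x) \<and> t \<le> poly p (dsize x)"
  shows "pt D f"
proof (rule ptI)
  let ?vs = "[1..<com_bound c]"
  let ?c = "Seq c (fold (\<lambda>v c. Seq c (Assign v (Const Nl))) ?vs Skip)"
  show "pbd D (\<lambda>x. poly p (sz x) + (2 * length ?vs + 1))"
    by (intro pbd_add pbd_poly pbd_sz pbd_const)
  fix x assume "x \<in> D"
  then obtain t s' where t: "exec c (st x) t s'" "s' 0 = f x" "t \<le> poly p (dsize x)"
    using assms unfolding computes_def st_def by blast
  have "runs c (st x) (poly p (sz x)) s'" using t(1,3) unfolding runs_def by auto
  from runs_Seq[OF this runs_clear[of ?vs]]
  have "runs ?c (st x) (poly p (sz x) + (2 * length ?vs + 1)) (\<lambda>v. if v \<in> set ?vs then Nl else s' v)" .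
  moreover have "(\<lambda>v. if v \<in> set ?vs then Nl else s' v) = st (f x)"
  proof
    fix v
    show "(if v \<in> set ?vs then Nl else s' v) = st (f x) v"
      using exec_unused[OF t(1), of v] t(2) by (cases "v = 0") auto
  qed
  ultimately show "runs ?c (st (enc x)) (poly p (sz x) + (2 * length ?vs + 1)) (st (enc (f x)))" by simp
qed

lemma computes_of_pt:
  fixes f :: "data \<Rightarrow> data"
  assumes "pt A f"
  shows "\<exists>c (p :: nat poly). \<forall>x\<in>A. \<exists>t. computes c x t (f x) \<and> t \<le> poly p (dsize x)"
proof -
  obtain c b where cb: "pbd A b" "\<And>a. a \<in> A \<Longrightarrow> runs c (st (enc a)) (b a) (st (enc (f a)))"
    using assms unfolding pt_def by blast
  obtain p where p: "\<And>a. a \<in> A \<Longrightarrow> b a \<le> poly p (sz a)" using cb(1) unfolding pbd_def by blast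
  have "\<exists>t. computes c x t (f x) \<and> t \<le> poly p (dsize x)" if x: "x \<in> A" for x
  proof -
    obtain t where "t \<le> b x" "exec c (st x) t (st (f x))"
      using cb(2)[OF x] unfolding runs_def by auto
    then have "computes c x t (f x)" "t \<le> poly p (dsize x)"
      unfolding computes_def st_def[symmetric] using p[OF x] by auto
    then show ?thesis by blast
  qed
  then show ?thesis by blast
qed

section \<open>Correctness\<close>

lemma fold_max_ge: "x \<in> set xs \<Longrightarrow> x \<le> fold max xs (a::nat)"
  using Max.set_eq_fold[of a xs] Max_ge[of "set (a # xs)" x] by simp

lemma fold_max_le: "(\<And>x. x \<in> set xs \<Longrightarrow> x \<le> B) \<Longrightarrow> a \<le> B \<Longrightarrow> fold max xs a \<le> (B::nat)"
  by (induction xs arbitrary: a) auto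

lemma degree_le_maxdeg: "v \<in> set (fst t) \<Longrightarrow> degree_at v (snd t) \<le> maxdeg t"
  unfolding maxdeg_def by (rule fold_max_ge) auto

lemma maxdeg_le: "(\<And>v. v \<in> set (fst t) \<Longrightarrow> degree_at v (snd t) \<le> B) \<Longrightarrow> maxdeg t \<le> B"
  unfolding maxdeg_def by (rule fold_max_le) auto

lemma pick_min:
  assumes "ts \<noteq> []"
  obtains t where "pick ts = [t]" "t \<in> set ts" "\<And>t'. t' \<in> set ts \<Longrightarrow> maxdeg t \<le> maxdeg t'"
proof -
  let ?fs = "filter (\<lambda>t. \<forall>t'\<in>set ts. maxdeg t \<le> maxdeg t') ts"
  have "arg_min_on maxdeg (set ts) \<in> set ?fs"
    using assms arg_min_if_finite[of "set ts" maxdeg] by (auto simp: not_less)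
  then obtain t us where t: "?fs = t # us" by (cases ?fs) auto
  then have "pick ts = [t]" by (simp add: pick_def)
  moreover have "t \<in> set ?fs" using t by simp
  ultimately show ?thesis using that by auto
qed

text \<open>A pass that adds nothing has compared every edge with the same vertex set, which is
  therefore closed under the edges.\<close>

lemma fold_attach_cases:
  "length (fst t) < length (fst (fold attach es t)) \<or>
   (fold attach es t = t \<and> (\<forall>e\<in>set es. fst e \<in> set (fst t) \<longrightarrow> snd e \<in> set (fst t)))"
proof (induction es arbitrary: t)
  case (Cons e es)
  show ?case
  proof (cases "attach e t = t")
    case True
    then have "fst e \<in> set (fst t) \<longrightarrow> snd e \<in> set (fst t)"
      by (auto simp: attach_def prod_eq_iff split: if_splits)
    then show ?thesis using Cons[of t] True by simp
  next
    case False
    then have "length (fst t) < length (fst (attach e t))" by (simp add: attach_def split: if_splits)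
    then show ?thesis using Cons[of "attach e t"] by auto
  qed
qed simp

lemma span_closed:
  assumes "e \<in> set (sym_edges es)" "fst e \<in> set (fst (span r es))"
  shows "snd e \<in> set (fst (span r es))"
proof -
  let ?f = "fold attach (sym_edges es)" and ?n = "length (sym_edges es)"
  \<comment> \<open>As long as no fixed point is reached, \<open>i\<close> passes leave at least
    \<open>Suc i\<close> vertices, which is impossible for \<open>i = Suc ?n\<close>.\<close>
  have fix_or: "?f ((?f ^^ i) ([r], [])) = (?f ^^ i) ([r], []) \<or> Suc i \<le> length (fst ((?f ^^ i) ([r], [])))" for i
  proof (induction i)
    case (Suc i)
    let ?t = "(?f ^^ i) ([r], [])"
    show ?case
    proof (cases "?f ?t = ?t")
      case False
      then have "Suc i \<le> length (fst ?t)" "length (fst ?t) < length (fst (?f ?t))"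
        using Suc fold_attach_cases[of ?t "sym_edges es"] by auto
      then show ?thesis by simp
    qed simp
  qed simp
  have "length (fst (span r es)) \<le> Suc ?n" by (rule grown_length_le[OF grown_span])
  then have "?f (span r es) = span r es"
    using fix_or[of "Suc ?n"] unfolding span_def by linarith
  then show ?thesis using fold_attach_cases[of "span r es" "sym_edges es"] assms by auto
qed

lemma span_reach:
  assumes "(r, v) \<in> (set (sym_edges es))\<^sup>*"
  shows "v \<in> set (fst (span r es))"
  using assms
proof (induction rule: rtrancl_induct)
  case base
  have "r \<in> set (fst t)" if "grown r es t" for t using that by induction auto
  then show ?case using grown_span by blast
next
  case (step u v)
  then show ?case using span_closed[of "(u, v)"] by simp
qed

lemma sym_edges_set: "set (sym_edges es) = set es \<union> (set es)\<inverse>"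
  by (force simp: sym_edges_def)

lemma grown_reach:
  assumes "grown r es t" "v \<in> set (fst t)"
  shows "(r, v) \<in> (set (sym_edges (snd t)))\<^sup>*"
  using assms
proof (induction arbitrary: v rule: grown.induct)
  case (grow t e)
  have mono: "(set (sym_edges (snd t)))\<^sup>* \<subseteq> (set (sym_edges (e # snd t)))\<^sup>*"
    by (rule rtrancl_mono) (auto simp: sym_edges_set)
  show ?case
  proof (cases "v \<in> set (fst t)")
    case True
    then show ?thesis using grow mono by auto
  next
    case False
    then have v: "v = snd e" using grow.prems by simp
    have "(r, fst e) \<in> (set (sym_edges (e # snd t)))\<^sup>*" using grow mono by auto
    moreover have "(fst e, snd e) \<in> set (sym_edges (e # snd t))" by (simp add: sym_edges_set)
    ultimately show ?thesis unfolding v by (simp add: rtrancl.rtrancl_into_rtrancl)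
  qed
qed simp

definition uset :: "edges \<Rightarrow> data set set" where
  "uset es = (\<lambda>e. {fst e, snd e}) ` set es"

lemma uset_sym_edges: "uset (sym_edges es) = uset es"
  by (simp add: uset_def sym_edges_def image_Un image_image insert_commute)

lemma finite_uset: "finite (uset es)"
  by (simp add: uset_def)

lemma card_uset_le_degree_at: "card {p \<in> uset es. v \<in> p} \<le> degree_at v es"
proof -
  have "{p \<in> uset es. v \<in> p} = (\<lambda>e. {fst e, snd e}) ` set (filter (\<lambda>e. fst e = v \<or> snd e = v) es)"
    by (auto simp: uset_def)
  also have "card \<dots> \<le> length (filter (\<lambda>e. fst e = v \<or> snd e = v) es)"
    by (rule order_trans[OF card_image_le card_length]) simp
  finally show ?thesis by (simp add: degree_at_def)
qed

lemma degree_at_append: "degree_at v (es @ fs) = degree_at v es + degree_at v fs"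
  by (simp add: degree_at_def)

lemma grown_endpoints: "grown r es t \<Longrightarrow> e \<in> set (snd t) \<Longrightarrow> fst e \<in> set (fst t) \<and> snd e \<in> set (fst t)"
  by (induction rule: grown.induct) auto

lemma degree_at_outside:
  assumes "grown r es t" "v \<notin> set (fst t)"
  shows "degree_at v (snd t) = 0"
proof -
  have "\<not> (fst e = v \<or> snd e = v)" if "e \<in> set (snd t)" for e
    using grown_endpoints[OF assms(1) that] assms(2) by auto
  then show ?thesis by (simp add: degree_at_def filter_empty_conv)
qed

text \<open>Every attached edge has an endpoint that was not in the tree before, so no undirected
  edge is listed twice and counting entries is exact.\<close>

lemma grown_degree_eq:
  assumes "grown r es t"
  shows "degree_at v (snd t) = card {p \<in> uset (snd t). v \<in> p}"
  using assms
proof (induction rule: grown.induct)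
  case start
  show ?case by (simp add: degree_at_def uset_def)
next
  case (grow t e)
  let ?p = "{fst e, snd e}"
  have new: "?p \<notin> uset (snd t)"
    using grown_endpoints[OF grow.hyps(1)] grow.hyps(4) unfolding uset_def by (fastforce simp: doubleton_eq_iff)
  have u: "uset (e # snd t) = insert ?p (uset (snd t))" by (simp add: uset_def)
  show ?case
  proof (cases "v \<in> ?p")
    case True
    then have "{p \<in> uset (e # snd t). v \<in> p} = insert ?p {p \<in> uset (snd t). v \<in> p}" unfolding u by auto
    then have "card {p \<in> uset (e # snd t). v \<in> p} = Suc (card {p \<in> uset (snd t). v \<in> p})"
      using new finite_uset by simp
    then show ?thesis using True grow.IH by (auto simp: degree_at_def)
  next
    case False
    then have "{p \<in> uset (e # snd t). v \<in> p} = {p \<in> uset (snd t). v \<in> p}" unfolding u by auto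
    then show ?thesis using False grow.IH by (auto simp: degree_at_def)
  qed
qed

lemma grown_degree_le:
  assumes "grown r es t"
  shows "degree_at v (snd t) \<le> card {p \<in> uset es. v \<in> p}"
  unfolding grown_degree_eq[OF assms]
proof (rule card_mono)
  have "uset (snd t) \<subseteq> uset (sym_edges es)"
    using grown_edges[OF assms] unfolding uset_def by auto
  then show "{p \<in> uset (snd t). v \<in> p} \<subseteq> {p \<in> uset es. v \<in> p}" unfolding uset_sym_edges by auto
qed (simp add: finite_uset)

subsection \<open>Representations\<close>

lemma inj_enc_nat: "inj enc_nat"
proof (rule injI)
  show "m = n" if "enc_nat m = enc_nat n" for m n
    using that
  proof (induction m arbitrary: n rule: enc_nat.induct)
    case 1
    then show ?case by (cases n) auto
  next
    case (2 m)
    then obtain n' where n: "n = Suc n'" by (cases n) auto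
    have "Suc m div 2 = Suc n' div 2" using 2 unfolding n by auto
    moreover have "odd (Suc m) \<longleftrightarrow> odd (Suc n')" using 2(2) unfolding n by (auto split: if_splits)
    ultimately have "Suc m = Suc n'" using odd_two_times_div_two_succ even_two_times_div_two by metis
    then show ?case using n by simp
  qed
qed

definition dec :: "data \<Rightarrow> nat" where
  "dec = inv enc_nat"

lemma dec_enc [simp]: "dec (enc_nat n) = n"
  by (simp add: dec_def inj_enc_nat)

lemma dec_inj: "d \<in> range enc_nat \<Longrightarrow> d' \<in> range enc_nat \<Longrightarrow> dec d = dec d' \<Longrightarrow> d = d'"
  by auto

lemma enc_list_data_list [simp]: "enc_list (data_list d) = d"
  by (induction d) auto

lemma data_list_enc [simp]: "data_list (enc xs) = map enc xs"
  by (simp add: enc_list_def)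

text \<open>Reduces representation of a vertex set to the set of list entries, whatever their order
  and repetitions.\<close>

lemma rep_set_nat: "rep_set rep_nat d A \<longleftrightarrow> set (data_list d) = enc_nat ` A"
proof
  assume "rep_set rep_nat d A"
  then obtain ds as where d: "d = enc_list ds" "list_all2 rep_nat ds as" "set as = A"
    unfolding rep_set_def by blast
  have "ds = map enc_nat as"
    using d(2) by (induction rule: list_all2_induct) (auto simp: rep_nat_def)
  with d show "set (data_list d) = enc_nat ` A" by auto
next
  assume *: "set (data_list d) = enc_nat ` A"
  have "list_all2 rep_nat (data_list d) (map dec (data_list d))"
    using * by (auto simp: list_all2_conv_all_nth rep_nat_def dest!: nth_mem)
  moreover have "set (map dec (data_list d)) = A" using * by (auto simp: image_image)
  ultimately show "rep_set rep_nat d A"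
    unfolding rep_set_def
    by (intro exI[of _ "data_list d"] exI[of _ "map dec (data_list d)"]) (simp only: enc_list_data_list simp_thms)
qed

lemma rep_set_edgeD:
  assumes "rep_set rep_edge d E"
  shows "\<And>e. e \<in> set (data_list d) \<Longrightarrow> \<exists>u v. e = Pr (enc_nat u) (enc_nat v) \<and> {u, v} \<in> E"
    and "\<And>p. p \<in> E \<Longrightarrow> \<exists>u v. p = {u, v} \<and> Pr (enc_nat u) (enc_nat v) \<in> set (data_list d)"
proof -
  obtain ds as where d: "d = enc_list ds" "list_all2 rep_edge ds as" "set as = E"
    using assms unfolding rep_set_def by blast
  have "(\<forall>e\<in>set ds. \<exists>p\<in>set as. rep_edge e p) \<and> (\<forall>p\<in>set as. \<exists>e\<in>set ds. rep_edge e p)"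
    using d(2) by (induction rule: list_all2_induct) auto
  then show "\<And>e. e \<in> set (data_list d) \<Longrightarrow> \<exists>u v. e = Pr (enc_nat u) (enc_nat v) \<and> {u, v} \<in> E"
    and "\<And>p. p \<in> E \<Longrightarrow> \<exists>u v. p = {u, v} \<and> Pr (enc_nat u) (enc_nat v) \<in> set (data_list d)"
    using d unfolding rep_edge_def by fastforce+
qed

definition graph_of :: "dtree \<Rightarrow> graph" where
  "graph_of t = (dec ` set (fst t), (\<lambda>e. {dec (fst e), dec (snd e)}) ` set (snd t))"

lemma rep_graph_enc:
  assumes "set (fst t) \<subseteq> range enc_nat"
    "\<And>e. e \<in> set (snd t) \<Longrightarrow> fst e \<in> range enc_nat \<and> snd e \<in> range enc_nat"
  shows "rep_graph (enc t) (graph_of t)"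
proof -
  have "rep_set rep_nat (enc (fst t)) (dec ` set (fst t))"
    unfolding rep_set_nat using assms(1) by (force simp: image_image)
  moreover have "rep_set rep_edge (enc (snd t)) ((\<lambda>e. {dec (fst e), dec (snd e)}) ` set (snd t))"
  proof -
    have "list_all2 rep_edge (map enc (snd t)) (map (\<lambda>e. {dec (fst e), dec (snd e)}) (snd t))"
      unfolding list_all2_map1 list_all2_map2
    proof (rule list.rel_refl_strong)
      fix e assume "e \<in> set (snd t)"
      then obtain u v where "fst e = enc_nat u" "snd e = enc_nat v" using assms(2) by blast
      then show "rep_edge (enc e) {dec (fst e), dec (snd e)}" unfolding rep_edge_def by auto
    qed
    then show ?thesis unfolding rep_set_def enc_list_def
      by (intro exI[of _ "map enc (snd t)"] exI[of _ "map (\<lambda>e. {dec (fst e), dec (snd e)}) (snd t)"])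
        (simp only: set_map simp_thms)
  qed
  ultimately show ?thesis unfolding rep_graph_def graph_of_def by simp
qed

text \<open>Truncation at \<open>M\<close> may be applied after every binary digit, since a value
  that has reached \<open>M\<close> stays there; this keeps the conversion to unary short.\<close>

lemma min_double: "min M (2 * min M (n div 2) + (if odd n then 1 else 0)) = min M (n::nat)"
proof (cases "M \<le> n div 2")
  case True
  then show ?thesis by (auto simp: min_def)
next
  case False
  have "2 * (n div 2) + (if odd n then 1 else 0) = n" by simp
  then show ?thesis using False by (simp add: min_def)
qed

lemma in_bound_eq:
  assumes "dsnd (dsnd x) = enc_nat k"
  shows "in_bound x = min (Suc (length (in_terminals x))) k"
proof -
  have "foldr (\<lambda>b z. min M (2 * z + (if b = Nl then 0 else 1))) (data_list (enc_nat k)) 0 = min M k" for M k :: nat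
  proof (induction k rule: enc_nat.induct)
    case (2 n)
    have bit: "(if (if odd (Suc n) then Pr Nl Nl else Nl) = Nl then 0 else 1) = (if odd (Suc n) then 1 else (0::nat))"
      by (cases "odd (Suc n)") simp_all
    show ?case
      by (simp only: enc_nat.simps data_list.simps foldr.simps o_apply 2 bit min_double)
  qed simp
  then show ?thesis unfolding in_bound_def assms by (simp add: foldr_conv_fold)
qed

subsection \<open>Trees\<close>

lemma tree_singleton: "is_tree ({v}, {})"
  by (auto simp: is_tree_def simple_graph_def connected_graph_def is_cycle_def intro!: exI[of _ 0])

lemma tree_add_leaf:
  assumes T: "is_tree (V, E)" and u: "u \<in> V" and v: "v \<notin> V"
  shows "is_tree (insert v V, insert {u, v} E)"
proof -
  have sg: "finite V" "E \<subseteq> {{u, v} | u v. u \<in> V \<and> v \<in> V \<and> u \<noteq> v}"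
    and con: "\<And>a b. a \<in> V \<Longrightarrow> b \<in> V \<Longrightarrow> (a, b) \<in> {(x, y). {x, y} \<in> E}\<^sup>*"
    and acyc: "\<And>p. \<not> is_cycle E p"
    using T by (auto simp: is_tree_def simple_graph_def connected_graph_def)
  have uv: "u \<noteq> v" using u v by blast
  have Ev: "v \<notin> p" if "p \<in> E" for p using sg(2) that v by fastforce
  let ?E = "insert {u, v} E" and ?V = "insert v V"
  have "simple_graph (?V, ?E)"
    using sg u uv unfolding simple_graph_def by fastforce
  moreover have "connected_graph (?V, ?E)"
  proof -
    let ?R = "{(x, y). {x, y} \<in> ?E}\<^sup>*"
    have mono: "(a, b) \<in> ?R" if "a \<in> V" "b \<in> V" for a b
      using con[OF that] rtrancl_mono[of "{(x, y). {x, y} \<in> E}" "{(x, y). {x, y} \<in> ?E}"] by auto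
    have e: "(u, v) \<in> ?R" "(v, u) \<in> ?R" by (auto simp: insert_commute)
    have "(a, b) \<in> ?R" if "a \<in> ?V" "b \<in> ?V" for a b
    proof -
      have "(a, u) \<in> ?R" using that(1) mono[OF _ u] e by auto
      moreover have "(u, b) \<in> ?R" using that(2) mono[OF u] e by auto
      ultimately show ?thesis by (rule rtrancl_trans)
    qed
    then show ?thesis unfolding connected_graph_def by blast
  qed
  moreover have "\<not> is_cycle ?E p" for p
  proof
    assume cyc: "is_cycle ?E p"
    define n where "n = length p"
    have n: "3 \<le> n" "distinct p" and edge: "\<And>j. j < n \<Longrightarrow> {p ! j, p ! (Suc j mod n)} \<in> ?E"
      using cyc unfolding is_cycle_def n_def by auto
    show False
    proof (cases "v \<in> set p")
      case False
      have "{p ! j, p ! (Suc j mod n)} \<in> E" if j: "j < n" for j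
      proof -
        have "p ! j \<in> set p" "p ! (Suc j mod n) \<in> set p" using j n unfolding n_def by (auto intro!: nth_mem mod_less_divisor)
        then have "v \<notin> {p ! j, p ! (Suc j mod n)}" using False by auto
        then show ?thesis using edge[OF j] by auto
      qed
      then have "is_cycle E p" using n unfolding is_cycle_def n_def by auto
      then show False using acyc by blast
    next
      case True
      then obtain j where j: "j < n" "p ! j = v" unfolding n_def by (auto simp: in_set_conv_nth)
      have other: "p ! i = u" if "{v, p ! i} \<in> ?E" "p ! i \<noteq> v" for i
        using that Ev[of "{v, p ! i}"] uv by (auto simp: doubleton_eq_iff)
      \<comment> \<open>The neighbours of \<open>v\<close> on the cycle, distinct because the cycle
        has at least three vertices; yet both have to be \<open>u\<close>.\<close>
      define i where "i = (if j = 0 then n - 1 else j - 1)"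
      define l where "l = Suc j mod n"
      have il: "i < n" "l < n" "Suc i mod n = j" "i \<noteq> j" "l \<noteq> j" "i \<noteq> l"
        using j n unfolding i_def l_def by (auto simp: mod_Suc split: if_splits)
      have neq: "p ! i \<noteq> v" "p ! l \<noteq> v"
        using il j n unfolding n_def by (auto simp: nth_eq_iff_index_eq)
      have "{v, p ! l} \<in> ?E" using edge[OF j(1)] j(2) unfolding l_def by simp
      then have "p ! l = u" using other neq by blast
      moreover have "{v, p ! i} \<in> ?E" using edge[OF il(1)] il(3) j(2) by (simp add: insert_commute)
      then have "p ! i = u" using other neq by blast
      ultimately show False using il n nth_eq_iff_index_eq[of p i l] unfolding n_def by simp
    qed
  qed
  ultimately show ?thesis unfolding is_tree_def by auto
qed

lemma grown_subtree:
  assumes t: "grown r es t" and r: "r \<in> enc_nat ` V"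
    and es: "\<And>e. e \<in> set (sym_edges es) \<Longrightarrow> \<exists>u v. e = (enc_nat u, enc_nat v) \<and> u \<in> V \<and> v \<in> V \<and> {u, v} \<in> E"
  shows "graph_of t \<in> subtrees (V, E) \<and> set (fst t) \<subseteq> enc_nat ` V"
  using t
proof (induction rule: grown.induct)
  case start
  then show ?case using r by (auto simp: subtrees_def graph_of_def tree_singleton)
next
  case (grow t e)
  obtain u v where e: "e = (enc_nat u, enc_nat v)" "u \<in> V" "v \<in> V" "{u, v} \<in> E"
    using es[OF grow.hyps(2)] by blast
  have tr: "is_tree (dec ` set (fst t), (\<lambda>e. {dec (fst e), dec (snd e)}) ` set (snd t))"
    using grow.IH by (simp add: subtrees_def graph_of_def)
  have "u \<in> dec ` set (fst t)" using grow.hyps(3) e(1) by (force intro: image_eqI[of _ _ "enc_nat u"])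
  moreover have "v \<notin> dec ` set (fst t)" using grow.hyps(4) e(1) grow.IH by auto
  ultimately have "is_tree (insert v (dec ` set (fst t)), insert {u, v} ((\<lambda>e. {dec (fst e), dec (snd e)}) ` set (snd t)))"
    by (rule tree_add_leaf[OF tr])
  then show ?case using grow.IH e by (simp add: subtrees_def graph_of_def)
qed

lemma max_degree_graph_of:
  assumes "fst t \<noteq> []" "set (fst t) \<subseteq> range enc_nat"
    "\<And>e. e \<in> set (snd t) \<Longrightarrow> fst e \<in> range enc_nat \<and> snd e \<in> range enc_nat"
  shows "max_degree (graph_of t) \<le> maxdeg t"
  unfolding max_degree_def graph_of_def case_prod_conv
proof (rule Max.boundedI)
  fix d assume "d \<in> (\<lambda>v. card {e \<in> (\<lambda>e. {dec (fst e), dec (snd e)}) ` set (snd t). v \<in> e}) ` dec ` set (fst t)"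
  then obtain w where w: "w \<in> set (fst t)"
    "d = card {e \<in> (\<lambda>e. {dec (fst e), dec (snd e)}) ` set (snd t). dec w \<in> e}" by auto
  have "{e \<in> (\<lambda>e. {dec (fst e), dec (snd e)}) ` set (snd t). dec w \<in> e} \<subseteq>
      (\<lambda>e. {dec (fst e), dec (snd e)}) ` set (filter (\<lambda>e. fst e = w \<or> snd e = w) (snd t))"
  proof
    fix q assume "q \<in> {e \<in> (\<lambda>e. {dec (fst e), dec (snd e)}) ` set (snd t). dec w \<in> e}"
    then obtain e where e: "e \<in> set (snd t)" "q = {dec (fst e), dec (snd e)}" "dec w = dec (fst e) \<or> dec w = dec (snd e)"
      by auto
    have "w \<in> range enc_nat" using w(1) assms(2) by blast
    then have "fst e = w \<or> snd e = w" using e(3) assms(3)[OF e(1)] dec_inj by metis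
    then show "q \<in> (\<lambda>e. {dec (fst e), dec (snd e)}) ` set (filter (\<lambda>e. fst e = w \<or> snd e = w) (snd t))"
      using e by auto
  qed
  then have "d \<le> card ((\<lambda>e. {dec (fst e), dec (snd e)}) ` set (filter (\<lambda>e. fst e = w \<or> snd e = w) (snd t)))"
    unfolding w(2) by (rule card_mono[rotated]) simp
  also have "\<dots> \<le> length (filter (\<lambda>e. fst e = w \<or> snd e = w) (snd t))"
    by (rule order_trans[OF card_image_le card_length]) simp
  also have "\<dots> \<le> maxdeg t" using degree_le_maxdeg[OF w(1)] by (simp add: degree_at_def)
  finally show "d \<le> maxdeg t" .
qed (use assms(1) in auto)

section \<open>A logarithmic potential for the number of rounds\<close>

definition ratio :: "nat \<Rightarrow> real" where
  "ratio k = (if k = 0 then 0 else 272 * (1 + ln (real k)))"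

lemma ratio_nonneg: "0 \<le> ratio k"
proof (cases "k = 0")
  case False
  then have "0 \<le> ln (real k)" by simp
  then show ?thesis by (simp add: ratio_def)
qed (simp add: ratio_def)

text \<open>By \<open>ln (1 - c / k) \<le> - c / k \<le> - 1 / 272\<close>, a round lowers
  \<open>272 * ln k\<close> by at least one. The additive 272 for positive arguments, against the
  value 0 at 0, pays for the last round.\<close>

lemma ratio_step:
  assumes "1 \<le> k" "k \<le> 272 * c"
  shows "1 + ratio (k - c) \<le> ratio k"
proof (cases "k \<le> c")
  case True
  have "0 \<le> ln (real k)" using assms(1) by simp
  then show ?thesis using True assms(1) by (simp add: ratio_def)
next
  case False
  then have pos: "0 < real (k - c)" "0 < real k" by auto
  have "ln (real (k - c)) - ln (real k) = ln (real (k - c) / real k)"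
    using pos by (simp add: ln_div)
  also have "\<dots> \<le> real (k - c) / real k - 1" using pos by (intro ln_le_minus_one) simp
  also have "\<dots> = - (real c / real k)" using False pos by (simp add: of_nat_diff field_simps)
  also have "\<dots> \<le> - (1 / 272)"
  proof -
    have "real k \<le> 272 * real c" using assms(2) by linarith
    then show ?thesis using pos by (simp add: field_simps)
  qed
  finally show ?thesis using False pos by (simp add: ratio_def)
qed

lemma ratio_bigo: "ratio \<in> O(\<lambda>k. ln (real k))"
proof (rule bigoI[of _ 544])
  have "norm (ratio k) \<le> 544 * norm (ln (real k))" if k: "3 \<le> k" for k
  proof -
    \<comment> \<open>From 3 on the logarithm is at least 1 and absorbs the additive term, at the
      price of doubling 272 to 544.\<close>
    have "exp 1 \<le> real k" using exp_le k by linarith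
    then have "1 \<le> ln (real k)" using k by (subst ln_ge_iff) auto
    then show ?thesis using k by (simp add: ratio_def)
  qed
  then show "eventually (\<lambda>k. norm (ratio k) \<le> 544 * norm (ln (real k))) at_top"
    unfolding eventually_at_top_linorder by blast
qed

section \<open>The rounds, measured against a fixed tree\<close>

lemma length_filter_split: "length (filter P xs) \<le> length (filter P (filter (\<lambda>v. v \<notin> B) xs)) + length (filter (\<lambda>v. v \<in> B) xs)"
  by (induction xs) auto

lemma rep_groups:
  assumes "\<And>g. g \<in> set gs \<Longrightarrow> set g \<subseteq> enc_nat ` V"
  shows "rep_set (rep_set rep_nat) (enc gs) ((\<lambda>g. dec ` set g) ` set gs)"
proof -
  have "list_all2 (rep_set rep_nat) (map enc gs) (map (\<lambda>g. dec ` set g) gs)"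
    unfolding list_all2_map1 list_all2_map2
  proof (rule list.rel_refl_strong)
    fix g assume "g \<in> set gs"
    then show "rep_set rep_nat (enc g) (dec ` set g)"
      unfolding rep_set_nat using assms[of g] by (force simp: image_image)
  qed
  moreover have "enc gs = enc_list (map enc gs)" by (rule enc_list_def)
  ultimately show ?thesis unfolding rep_set_def[of "rep_set rep_nat"]
    by (intro exI[of _ "map enc gs"] exI[of _ "map (\<lambda>g. dec ` set g) gs"]) (simp only: set_map simp_thms)
qed

text \<open>\<open>VT\<close> and \<open>ET\<close> form the tree to compare with, later an optimal
  one, which the algorithm does not know. The oracle's guarantee is relative to this tree instead of
  the optimum of the group problem: it covers the queries whose groups \<open>VT\<close> hits and
  says nothing about others.\<close>

locale steiner_instance =
  fixes V :: "nat set" and E :: "nat set set" and S :: "nat set" and k :: nat and x :: data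
    and orc :: "data \<Rightarrow> data" and \<rho> :: real and VT :: "nat set" and ET :: "nat set set"
  assumes graph: "simple_graph (V, E)" and S: "S \<subseteq> V" and k: "1 \<le> k"
    and rep_G: "rep_graph (dfst x) (V, E)" and rep_S: "rep_set rep_nat (dfst (dsnd x)) S"
    and rep_k: "dsnd (dsnd x) = enc_nat k"
    and orc: "\<And>z \<S>. rep_set (rep_set rep_nat) z \<S> \<Longrightarrow> finite \<S> \<Longrightarrow> (\<And>A. A \<in> \<S> \<Longrightarrow> A \<subseteq> V) \<Longrightarrow>
      (\<And>A. A \<in> \<S> \<Longrightarrow> VT \<inter> A \<noteq> {}) \<Longrightarrow>
      \<exists>T\<in>subtrees (V, E). (\<forall>A\<in>\<S>. fst T \<inter> A \<noteq> {}) \<and> rep_graph (orc (Pr (dfst x) z)) T \<and>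
        real (max_degree T) \<le> \<rho> * real (max_degree (VT, ET))"
    and T: "(VT, ET) \<in> subtrees (V, E)" "k \<le> card (VT \<inter> S)" and \<rho>: "0 \<le> \<rho>"
begin

abbreviation b :: "nat \<Rightarrow> data" where "b \<equiv> enc_nat"

definition D :: real where "D = \<rho> * real (max_degree (VT, ET))"

lemma D_nonneg: "0 \<le> D"
  using \<rho> by (simp add: D_def)

lemma vertices: "set (in_vertices x) = b ` V"
  using rep_G unfolding rep_graph_def in_vertices_def rep_set_nat by auto

lemma edge_rep: "rep_set rep_edge (dsnd (dfst x)) E"
  using rep_G unfolding rep_graph_def by auto

lemma edgesD:
  assumes "e \<in> set (sym_edges (in_edges x))"
  shows "\<exists>u v. e = (b u, b v) \<and> u \<in> V \<and> v \<in> V \<and> {u, v} \<in> E"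
proof -
  have E: "\<exists>u v. e = (b u, b v) \<and> u \<in> V \<and> v \<in> V \<and> {u, v} \<in> E" if e: "e \<in> set (in_edges x)" for e
  proof -
    obtain d where d: "d \<in> set (data_list (dsnd (dfst x)))" "e = (dfst d, dsnd d)"
      using e unfolding in_edges_def by auto
    obtain u v where uv: "d = Pr (b u) (b v)" "{u, v} \<in> E" using rep_set_edgeD(1)[OF edge_rep d(1)] by blast
    have "E \<subseteq> Pow V" using graph unfolding simple_graph_def by auto
    then have "{u, v} \<subseteq> V" using uv(2) by auto
    then show ?thesis using d uv by auto
  qed
  have "e \<in> set (in_edges x) \<or> (snd e, fst e) \<in> set (in_edges x)"
    using assms by (auto simp: sym_edges_set)
  then show ?thesis
  proof
    assume "(snd e, fst e) \<in> set (in_edges x)"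
    from E[OF this] obtain u v where "snd e = b u" "fst e = b v" "u \<in> V" "v \<in> V" "{u, v} \<in> E" by auto
    then show ?thesis by (intro exI[of _ v] exI[of _ u]) (auto simp: prod_eq_iff insert_commute)
  qed (rule E)
qed

lemma edgesI:
  assumes "{u, v} \<in> E"
  shows "(b u, b v) \<in> set (sym_edges (in_edges x))"
proof -
  obtain u' v' where uv: "{u, v} = {u', v'}" "Pr (b u') (b v') \<in> set (data_list (dsnd (dfst x)))"
    using rep_set_edgeD(2)[OF edge_rep assms] by blast
  then have "(b u', b v') \<in> set (in_edges x)" unfolding in_edges_def by force
  then show ?thesis using uv(1) by (auto simp: sym_edges_set doubleton_eq_iff)
qed

lemma finite_V: "finite V"
  using graph by (simp add: simple_graph_def)

lemma terminals: "set (in_terminals x) = b ` S" "distinct (in_terminals x)"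
  using rep_S unfolding in_terminals_def rep_set_nat by auto

lemma length_terminals: "length (in_terminals x) = card S"
  using terminals by (metis card_image distinct_card inj_enc_nat inj_on_subset subset_UNIV)

lemma k_le: "k \<le> length (in_terminals x)"
  using T(2) card_mono[of S "VT \<inter> S"] finite_subset[OF S finite_V] unfolding length_terminals by simp

lemma bound: "in_bound x = k"
  using in_bound_eq[OF rep_k] k_le by simp

text \<open>For an answer that represents a subtree, the filter in \<open>out_tree\<close> discards
  nothing, and connectivity lets the span reach all its vertices. Degrees do not grow, because the
  span uses each undirected edge at most once.\<close>

lemma oracle_tree:
  assumes T': "(V', E') \<in> subtrees (V, E)" and rep: "rep_graph y (V', E')" and r: "r0 \<in> V'"
  shows "\<And>v. v \<in> V' \<Longrightarrow> b v \<in> set (fst (out_tree x (b r0) y))"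
    and "maxdeg (out_tree x (b r0) y) \<le> max_degree (V', E')"
proof -
  define es where "es = filter (\<lambda>e. e \<in> set (sym_edges (in_edges x))) (map (\<lambda>e. (dfst e, dsnd e)) (data_list (dsnd y)))"
  have span: "out_tree x (b r0) y = span (b r0) es" unfolding out_tree_def es_def ..
  have tree: "simple_graph (V', E')" "connected_graph (V', E')" "V' \<subseteq> V" "E' \<subseteq> E"
    using T' by (auto simp: subtrees_def is_tree_def)
  have fin: "finite V'" "E' \<subseteq> {{u, v} | u v. u \<in> V' \<and> v \<in> V' \<and> u \<noteq> v}"
    using tree(1) by (auto simp: simple_graph_def)
  have "E' \<subseteq> Pow V'" using fin(2) by auto
  then have finE: "finite E'" using fin(1) finite_subset by blast
  have rE: "rep_set rep_edge (dsnd y) E'" using rep unfolding rep_graph_def by auto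
  have es1: "\<exists>u v. e = (b u, b v) \<and> {u, v} \<in> E'" if e: "e \<in> set es" for e
  proof -
    obtain d where "d \<in> set (data_list (dsnd y))" "e = (dfst d, dsnd d)" using e unfolding es_def by auto
    then show ?thesis using rep_set_edgeD(1)[OF rE] by fastforce
  qed
  have es2: "(b u, b v) \<in> set (sym_edges es)" if e: "{u, v} \<in> E'" for u v
  proof -
    obtain u' v' where uv: "{u, v} = {u', v'}" "Pr (b u') (b v') \<in> set (data_list (dsnd y))"
      using rep_set_edgeD(2)[OF rE e] by blast
    have "{u', v'} \<in> E" using e uv(1) tree(4) by auto
    then have "(b u', b v') \<in> set es" unfolding es_def using uv(2) edgesI by force
    then show ?thesis using uv(1) by (auto simp: sym_edges_set doubleton_eq_iff)
  qed
  show "b v \<in> set (fst (out_tree x (b r0) y))" if v: "v \<in> V'" for v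
  proof -
    have "(r0, v) \<in> {(x, y). {x, y} \<in> E'}\<^sup>*" using tree(2) r v unfolding connected_graph_def by auto
    then have "(b r0, b v) \<in> (set (sym_edges es))\<^sup>*"
      by (induction rule: rtrancl_induct) (auto dest!: es2 intro: rtrancl_into_rtrancl)
    then show ?thesis unfolding span by (rule span_reach)
  qed
  show "maxdeg (out_tree x (b r0) y) \<le> max_degree (V', E')"
  proof (rule maxdeg_le)
    fix w
    have "degree_at w (snd (out_tree x (b r0) y)) \<le> card {p \<in> uset es. w \<in> p}"
      unfolding span by (rule grown_degree_le[OF grown_span])
    also have "\<dots> \<le> max_degree (V', E')"
    proof (cases "{p \<in> uset es. w \<in> p} = {}")
      case True
      show ?thesis unfolding True by simp
    next
      case False
      then obtain e where e: "e \<in> set es" "w \<in> {fst e, snd e}" unfolding uset_def by auto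
      from es1[OF e(1)] obtain u v where uv: "e = (b u, b v)" "{u, v} \<in> E'" by blast
      have "\<exists>z\<in>V'. w = b z" using e(2) uv \<open>E' \<subseteq> Pow V'\<close> by auto
      then obtain z where z: "z \<in> V'" "w = b z" by blast
      have "{p \<in> uset es. w \<in> p} \<subseteq> (\<lambda>p. b ` p) ` {p \<in> E'. z \<in> p}"
      proof
        fix p assume "p \<in> {p \<in> uset es. w \<in> p}"
        then obtain e where e: "e \<in> set es" "p = {fst e, snd e}" "w \<in> p" unfolding uset_def by auto
        from es1[OF e(1)] obtain u v where uv: "e = (b u, b v)" "{u, v} \<in> E'" by blast
        have "z \<in> {u, v}" using e(2,3) z(2) uv(1) injD[OF inj_enc_nat] by auto
        moreover have "p = b ` {u, v}" using e(2) uv(1) by simp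
        ultimately show "p \<in> (\<lambda>p. b ` p) ` {p \<in> E'. z \<in> p}" using uv(2) by blast
      qed
      then have "card {p \<in> uset es. w \<in> p} \<le> card ((\<lambda>p. b ` p) ` {p \<in> E'. z \<in> p})"
        by (rule card_mono[rotated]) (simp add: finE)
      also have "\<dots> \<le> card {p \<in> E'. z \<in> p}" by (rule card_image_le) (simp add: finE)
      also have "\<dots> \<le> max_degree (V', E')"
        unfolding max_degree_def case_prod_conv by (rule Max_ge) (use fin(1) z(1) in auto)
      finally show ?thesis .
    qed
    finally show "degree_at w (snd (out_tree x (b r0) y)) \<le> max_degree (V', E')" .
  qed
qed

text \<open>The family suited to \<open>VT\<close> is among those enumerated. \<open>VT\<close> hits
  all its groups, so the oracle's guarantee applies, and the tree it returns hits them too and must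
  cover many terminals.\<close>

lemma good_candidate:
  assumes r: "r0 \<in> VT" and S': "set S' \<subseteq> b ` S" and k': "1 \<le> k'" "k' \<le> length (filter (\<lambda>s. s \<in> b ` VT) S')"
  shows "\<exists>t\<in>set (candidates orc x (b r0) S'). k' \<le> 272 * covered S' t \<and> real (maxdeg t) \<le> D"
proof -
  define n where "n = length S'"
  \<comment> \<open>Families speak about positions in \<open>S'\<close>, so the trees enter through
    the positions of their terminals.\<close>
  define U where "U = {i. i < n \<and> S' ! i \<in> b ` VT}"
  have U: "U \<subseteq> {..<n}" "k' \<le> card U"
    using k'(2) unfolding U_def n_def by (auto simp: length_filter_conv_card)
  obtain F where F: "F \<in> set (families (enum_cap n) n)" "\<And>g. g \<in> set F \<Longrightarrow> set g \<inter> U \<noteq> {}"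
    "\<And>X. X \<subseteq> {..<n} \<Longrightarrow> (\<And>g. g \<in> set F \<Longrightarrow> set g \<inter> X \<noteq> {}) \<Longrightarrow> k' \<le> 272 * card X"
    using families_hitting[OF order_refl U k'(1)] unfolding enum_cap_def by blast
  have VTV: "VT \<subseteq> V" using T(1) by (simp add: subtrees_def)
  define grp where "grp g = concat (map (\<lambda>i. first (drop i S')) g)" for g
  define groups where "groups = map (filter (\<lambda>s. s \<in> set (in_vertices x))) ([b r0] # map grp F)"
  have input: "gst_input x (b r0) S' F = Pr (dfst x) (enc groups)"
    unfolding gst_input_def groups_def grp_def ..
  have first_drop: "first (drop i S') = (if i < n then [S' ! i] else [])" for i
    unfolding first_def n_def by (simp add: take_Suc hd_drop_conv_nth)
  have set_grp: "set (grp g) = {S' ! i | i. i \<in> set g \<and> i < n}" for g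
    unfolding grp_def by (auto simp: first_drop split: if_splits)
  have gV: "set A \<subseteq> b ` V" if A: "A \<in> set groups" for A
  proof -
    obtain g where "A = filter (\<lambda>s. s \<in> set (in_vertices x)) g" using A unfolding groups_def set_map by blast
    then show ?thesis using vertices by auto
  qed
  let ?SS = "(\<lambda>g. dec ` set g) ` set groups"
  have rep: "rep_set (rep_set rep_nat) (enc groups) ?SS"
    using gV by (rule rep_groups)
  have sub: "A \<subseteq> V" if "A \<in> ?SS" for A
    using that gV by fastforce
  have hit: "VT \<inter> A \<noteq> {}" if A: "A \<in> ?SS" for A
  proof -
    obtain g where g: "g \<in> set groups" "A = dec ` set g" using A by blast
    have "\<exists>v\<in>VT. b v \<in> set g"
    proof (cases "g = filter (\<lambda>s. s \<in> set (in_vertices x)) [b r0]")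
      case True
      then show ?thesis using r VTV vertices by auto
    next
      case False
      then obtain f where f: "f \<in> set F" "g = filter (\<lambda>s. s \<in> set (in_vertices x)) (grp f)"
        using g(1) unfolding groups_def by auto
      obtain i where i: "i \<in> set f" "i \<in> U" using F(2)[OF f(1)] by blast
      then obtain v where v: "v \<in> VT" "S' ! i = b v" unfolding U_def by auto
      have "b v \<in> set (grp f)" unfolding set_grp using i v(2) U by force
      then show ?thesis using v(1) VTV vertices f(2) by auto
    qed
    then obtain v where "v \<in> VT" "b v \<in> set g" by blast
    then have "v \<in> A" unfolding g(2) by (intro image_eqI[of _ _ "b v"]) auto
    then show ?thesis using \<open>v \<in> VT\<close> by blast
  qed
  obtain T' where T': "T' \<in> subtrees (V, E)" "\<forall>A\<in>?SS. fst T' \<inter> A \<noteq> {}"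
    "rep_graph (orc (Pr (dfst x) (enc groups))) T'" "real (max_degree T') \<le> D"
    using orc[OF rep _ sub hit] unfolding D_def by auto
  obtain V' E' where VE: "T' = (V', E')" by (cases T')
  define t where "t = out_tree x (b r0) (orc (gst_input x (b r0) S' F))"
  \<comment> \<open>The group \<open>{r0}\<close> puts the root into the oracle's tree, so that it
    is shared by the trees of all rounds.\<close>
  have "b r0 \<in> set (in_vertices x)" using r VTV vertices by auto
  then have "{r0} \<in> ?SS" unfolding groups_def by simp
  from bspec[OF T'(2) this] have r0: "r0 \<in> V'" using VE by simp
  note ot = oracle_tree[OF T'(1)[unfolded VE] T'(3)[unfolded VE] r0, folded input, folded t_def]
  have "k' \<le> 272 * card {i. i < length S' \<and> S' ! i \<in> set (fst t)}"
  proof (rule F(3))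
    fix g assume g: "g \<in> set F"
    then have "grp g \<in> set ([b r0] # map grp F)" by simp
    then have "dec ` set (filter (\<lambda>s. s \<in> set (in_vertices x)) (grp g)) \<in> ?SS"
      unfolding groups_def set_map by (intro imageI)
    from bspec[OF T'(2) this]
    obtain v where v: "v \<in> V'" "v \<in> dec ` set (filter (\<lambda>s. s \<in> set (in_vertices x)) (grp g))"
      unfolding VE fst_conv by blast
    then obtain s where s: "s \<in> set (grp g)" "s \<in> b ` V" "v = dec s" using vertices by auto
    then have "s = b v" by auto
    then have "s \<in> set (fst t)" using ot(1)[OF v(1)] by simp
    then show "set g \<inter> {i. i < length S' \<and> S' ! i \<in> set (fst t)} \<noteq> {}"
      using s(1) unfolding set_grp n_def by auto
  qed (auto simp: n_def)
  then have "k' \<le> 272 * covered S' t" unfolding covered_def length_filter_conv_card .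
  moreover have "real (maxdeg t) \<le> D" using ot(2) T'(4) unfolding VE by simp
  moreover have "t \<in> set (candidates orc x (b r0) S')"
    unfolding candidates_def t_def using F(1) unfolding n_def by simp
  ultimately show ?thesis by blast
qed

text \<open>Among the terminals left, \<open>VT\<close> still contains as many as are missing, which
  makes the next round succeed. The potential pays \<open>D\<close> for every round to come. By the
  last conjunct, at least \<open>k\<close> minus the current bound terminals have left the list, and
  by the one before it these are reachable from \<open>r\<close>.\<close>

definition good :: "data \<Rightarrow> rstate \<Rightarrow> bool" where
  "good r s \<longleftrightarrow> set (fst s) \<subseteq> b ` S \<and> fst (snd s) \<le> length (filter (\<lambda>v. v \<in> b ` VT) (fst s)) \<and>
    (\<forall>v. real (degree_at v (snd (snd s))) + D * ratio (fst (snd s)) \<le> D * ratio k) \<and>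
    (\<forall>v. v \<in> b ` S \<longrightarrow> v \<notin> set (fst s) \<longrightarrow> (r, v) \<in> (set (sym_edges (snd (snd s))))\<^sup>*) \<and>
    k + length (fst s) \<le> fst (snd s) + length (in_terminals x)"

lemma good_start: "good r (in_terminals x, in_bound x, [])"
proof -
  have "length (filter (\<lambda>v. v \<in> b ` VT) (in_terminals x)) = card (b ` VT \<inter> b ` S)"
  proof -
    have "length (filter (\<lambda>v. v \<in> b ` VT) (in_terminals x)) = card (set (filter (\<lambda>v. v \<in> b ` VT) (in_terminals x)))"
      using terminals(2) by (simp only: distinct_card distinct_filter)
    also have "set (filter (\<lambda>v. v \<in> b ` VT) (in_terminals x)) = b ` VT \<inter> b ` S" using terminals(1) by auto
    finally show ?thesis .
  qed
  also have "b ` VT \<inter> b ` S = b ` (VT \<inter> S)" using inj_enc_nat by (simp add: image_Int)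
  also have "card \<dots> = card (VT \<inter> S)" using inj_enc_nat by (simp add: card_image inj_on_def)
  finally show ?thesis using T(2) terminals(1) unfolding good_def bound by (simp add: degree_at_def)
qed

lemma good_round:
  assumes r: "r0 \<in> VT" and s: "good (b r0) s" and pos: "fst (snd s) \<noteq> 0"
  shows "good (b r0) (round orc x (b r0) s) \<and> fst (snd (round orc x (b r0) s)) < fst (snd s)"
proof -
  obtain S' k' acc where seq: "s = (S', k', acc)" by (cases s)
  have k': "1 \<le> k'" using pos seq by simp
  have s': "set S' \<subseteq> b ` S" "k' \<le> length (filter (\<lambda>v. v \<in> b ` VT) S')"
    "\<And>v. real (degree_at v acc) + D * ratio k' \<le> D * ratio k"
    "\<And>v. v \<in> b ` S \<Longrightarrow> v \<notin> set S' \<Longrightarrow> (b r0, v) \<in> (set (sym_edges acc))\<^sup>*"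
    "k + length S' \<le> k' + length (in_terminals x)"
    using s unfolding good_def seq by auto
  define ts where "ts = filter (\<lambda>t. k' \<le> 272 * covered S' t) (candidates orc x (b r0) S')"
  obtain t0 where t0: "t0 \<in> set ts" "real (maxdeg t0) \<le> D"
    using good_candidate[OF r s'(1) k' s'(2)] unfolding ts_def by auto
  then have "ts \<noteq> []" by auto
  then obtain t where t: "pick ts = [t]" "t \<in> set ts" "\<And>t'. t' \<in> set ts \<Longrightarrow> maxdeg t \<le> maxdeg t'"
    using pick_min by blast
  have sel: "select orc x (b r0) s = [t]" unfolding select_def seq using t(1) by (simp add: ts_def)
  then have grown: "grown (b r0) (in_edges x) t" using grown_select[of t orc x "b r0" s] by simp
  have step: "round orc x (b r0) s = update t s" unfolding round_def sel using pos by simp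
  define c where "c = covered S' t"
  have c: "k' \<le> 272 * c" using t(2) unfolding ts_def c_def by simp
  then have c0: "c \<noteq> 0" using k' by auto
  have maxt: "real (maxdeg t) \<le> D" using t(3)[OF t0(1)] t0(2) by linarith
  have len: "length (filter (\<lambda>v. v \<notin> set (fst t)) S') + c = length S'"
    unfolding c_def covered_def using sum_length_filter_compl[of "\<lambda>v. v \<in> set (fst t)" S'] by simp
  have upd: "update t s = (filter (\<lambda>v. v \<notin> set (fst t)) S', k' - c, snd t @ acc)"
    unfolding update_def seq c_def by simp
  \<comment> \<open>Only \<open>c\<close> terminals are removed, so at most \<open>c\<close> of them
    belong to \<open>VT\<close>.\<close>
  have "k' - c \<le> length (filter (\<lambda>v. v \<in> b ` VT) (filter (\<lambda>v. v \<notin> set (fst t)) S'))"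
    using s'(2) length_filter_split[of "\<lambda>v. v \<in> b ` VT" S' "set (fst t)"] unfolding c_def covered_def by linarith
  moreover have "real (degree_at v (snd t @ acc)) + D * ratio (k' - c) \<le> D * ratio k" for v
  proof -
    have "real (degree_at v (snd t)) \<le> D"
      using degree_le_maxdeg[of v t] degree_at_outside[OF grown, of v] maxt D_nonneg by (cases "v \<in> set (fst t)") auto
    \<comment> \<open>The drop of the potential pays for the degree that this round adds.\<close>
    moreover have "D * (1 + ratio (k' - c)) \<le> D * ratio k'"
      using ratio_step[OF k' c] D_nonneg by (rule mult_left_mono)
    ultimately show ?thesis using s'(3)[of v] unfolding degree_at_append by (simp add: distrib_left)
  qed
  moreover have "(b r0, v) \<in> (set (sym_edges (snd t @ acc)))\<^sup>*"
    if v: "v \<in> b ` S" "v \<notin> set (filter (\<lambda>v. v \<notin> set (fst t)) S')" for v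
  proof (cases "v \<in> set (fst t)")
    case True
    have "(set (sym_edges (snd t)))\<^sup>* \<subseteq> (set (sym_edges (snd t @ acc)))\<^sup>*"
      by (rule rtrancl_mono) (auto simp: sym_edges_set)
    then show ?thesis using grown_reach[OF grown True] by blast
  next
    case False
    then have "v \<notin> set S'" using v(2) by simp
    moreover have "(set (sym_edges acc))\<^sup>* \<subseteq> (set (sym_edges (snd t @ acc)))\<^sup>*"
      by (rule rtrancl_mono) (auto simp: sym_edges_set)
    ultimately show ?thesis using s'(4)[OF v(1)] by blast
  qed
  moreover have "k + length (filter (\<lambda>v. v \<notin> set (fst t)) S') \<le> k' - c + length (in_terminals x)"
    using s'(5) len by linarith
  moreover have "set (filter (\<lambda>v. v \<notin> set (fst t)) S') \<subseteq> b ` S" using s'(1) by auto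
  ultimately have "good (b r0) (update t s)" unfolding upd good_def by auto
  moreover have "fst (snd (update t s)) < fst (snd s)"
  proof -
    have "fst (snd (update t s)) = k' - c" unfolding upd by simp
    moreover have "fst (snd s) = k'" unfolding seq by simp
    ultimately show ?thesis using k' c0 by linarith
  qed
  ultimately show ?thesis unfolding step by blast
qed

lemma good_rounds:
  assumes r: "r0 \<in> VT"
  shows "good (b r0) (rounds orc x (b r0) j) \<and> (fst (snd (rounds orc x (b r0) j)) = 0 \<or> fst (snd (rounds orc x (b r0) j)) + j \<le> k)"
proof (induction j)
  case 0
  show ?case using good_start by (simp add: rounds_def bound)
next
  case (Suc j)
  let ?s = "rounds orc x (b r0) j"
  have eq: "rounds orc x (b r0) (Suc j) = round orc x (b r0) ?s" by (simp add: rounds_def)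
  show ?case
  proof (cases "fst (snd ?s) = 0")
    case True
    then have "round orc x (b r0) ?s = ?s" by (simp add: round_def)
    then show ?thesis using Suc True unfolding eq by simp
  next
    case False
    then show ?thesis using good_round[OF r _ False] Suc unfolding eq by auto
  qed
qed

lemma rounds_edges: "set (snd (snd (rounds orc x r j))) \<subseteq> set (sym_edges (in_edges x))"
proof (induction j)
  case 0
  show ?case by (simp add: rounds_def)
next
  case (Suc j)
  let ?s = "rounds orc x r j"
  have eq: "rounds orc x r (Suc j) = round orc x r ?s" by (simp add: rounds_def)
  have "set (snd (snd (fold update ts s))) \<subseteq> set (sym_edges (in_edges x))"
    if "\<And>t. t \<in> set ts \<Longrightarrow> grown r (in_edges x) t" "set (snd (snd s)) \<subseteq> set (sym_edges (in_edges x))" for ts s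
    using that
  proof (induction ts arbitrary: s)
    case (Cons t ts)
    have "set (snd (snd (update t s))) \<subseteq> set (sym_edges (in_edges x))"
      using Cons.prems grown_edges[of r "in_edges x" t] by (auto simp: update_def)
    then show ?case using Cons by simp
  qed simp
  from this[of "select orc x r ?s" ?s] show ?case
    using Suc grown_select unfolding eq round_def by auto
qed

text \<open>Some root lies in \<open>VT\<close>, and for it the rounds succeed. The tree returned
  may belong to another root, but it passed the same count of terminals and its degree is no
  larger.\<close>

lemma solution_correct:
  "\<exists>T'\<in>subtrees (V, E). k \<le> card (fst T' \<inter> S) \<and> rep_graph (solution orc x) T' \<and>
     real (max_degree T') \<le> \<rho> * real (max_degree (VT, ET)) * ratio k"
proof -
  let ?n = "length (in_terminals x)"
  define tree where "tree r = span r (snd (snd (rounds orc x r ?n)))" for r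
  define ts where "ts = filter (\<lambda>t. in_bound x \<le> covered (in_terminals x) t) (map tree (in_vertices x))"
  have solve: "solve orc x = pick ts" unfolding solve_def ts_def tree_def ..
  have "VT \<noteq> {}" using T(1) by (auto simp: subtrees_def is_tree_def connected_graph_def)
  then obtain r0 where r0: "r0 \<in> VT" by blast
  have r0V: "b r0 \<in> set (in_vertices x)" using r0 T(1) vertices by (auto simp: subtrees_def)
  define acc where "acc = snd (snd (rounds orc x (b r0) ?n))"
  have k0: "fst (snd (rounds orc x (b r0) ?n)) = 0"
    using good_rounds[OF r0, of ?n] k_le k by linarith
  have good: "\<And>v. real (degree_at v acc) \<le> D * ratio k"
    "\<And>v. v \<in> b ` S \<Longrightarrow> v \<notin> set (fst (rounds orc x (b r0) ?n)) \<Longrightarrow> (b r0, v) \<in> (set (sym_edges acc))\<^sup>*"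
    "k + length (fst (rounds orc x (b r0) ?n)) \<le> ?n"
    using good_rounds[OF r0, of ?n] k0 unfolding good_def acc_def by (auto simp: ratio_def)
  have t0: "tree (b r0) \<in> set ts"
  proof -
    let ?R = "fst (rounds orc x (b r0) ?n)"
    have "length (filter (\<lambda>v. v \<in> set ?R) (in_terminals x)) = card (set (filter (\<lambda>v. v \<in> set ?R) (in_terminals x)))"
      using terminals(2) by (simp only: distinct_card distinct_filter)
    also have "\<dots> \<le> card (set ?R)" by (rule card_mono) auto
    also have "\<dots> \<le> length ?R" by (rule card_length)
    finally have "length (filter (\<lambda>v. v \<in> set ?R) (in_terminals x)) \<le> length ?R" .
    then have "k \<le> length (filter (\<lambda>v. v \<notin> set ?R) (in_terminals x))"
      using good(3) sum_length_filter_compl[of "\<lambda>v. v \<in> set ?R" "in_terminals x"] by linarith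
    also have "\<dots> \<le> covered (in_terminals x) (tree (b r0))"
    proof -
      have "v \<in> set (fst (tree (b r0)))" if "v \<in> set (in_terminals x)" "v \<notin> set ?R" for v
        unfolding tree_def acc_def[symmetric] by (rule span_reach[OF good(2)]) (use that terminals(1) in auto)
      then have "{i. i < length (in_terminals x) \<and> in_terminals x ! i \<notin> set ?R} \<subseteq>
          {i. i < length (in_terminals x) \<and> in_terminals x ! i \<in> set (fst (tree (b r0)))}"
        using nth_mem by blast
      then show ?thesis unfolding covered_def length_filter_conv_card by (rule card_mono[rotated]) simp
    qed
    finally show ?thesis unfolding ts_def bound using r0V by simp
  qed
  then have "ts \<noteq> []" by auto
  then obtain t where t: "pick ts = [t]" "t \<in> set ts" "\<And>t'. t' \<in> set ts \<Longrightarrow> maxdeg t \<le> maxdeg t'"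
    using pick_min by blast
  have "real (maxdeg (tree (b r0))) \<le> D * ratio k"
  proof -
    \<comment> \<open>\<open>maxdeg_le\<close> takes a natural number as its bound, hence the
      floor.\<close>
    have "maxdeg (tree (b r0)) \<le> nat \<lfloor>D * ratio k\<rfloor>"
    proof (rule maxdeg_le)
      fix v
      have "degree_at v (snd (tree (b r0))) \<le> degree_at v acc"
        unfolding tree_def acc_def[symmetric]
        by (rule order_trans[OF grown_degree_le[OF grown_span] card_uset_le_degree_at])
      then show "degree_at v (snd (tree (b r0))) \<le> nat \<lfloor>D * ratio k\<rfloor>"
        using good(1)[of v] by linarith
    qed
    moreover have "0 \<le> D * ratio k" using D_nonneg ratio_nonneg by simp
    ultimately show ?thesis by linarith
  qed
  then have deg: "real (maxdeg t) \<le> D * ratio k" using t(3)[OF t0] by linarith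
  obtain r where r: "r \<in> set (in_vertices x)" "t = tree r" and cov: "k \<le> covered (in_terminals x) t"
    using t(2) unfolding ts_def bound by auto
  have gr: "grown r (in_edges x) t"
    unfolding r(2) tree_def by (rule grown_mono[OF grown_span sym_edges_mono[OF rounds_edges]])
  have sub: "graph_of t \<in> subtrees (V, E)" "set (fst t) \<subseteq> b ` V"
    using grown_subtree[OF gr _ edgesD] r(1) vertices by auto
  have ends: "fst e \<in> range b \<and> snd e \<in> range b" if "e \<in> set (snd t)" for e
    using grown_endpoints[OF gr that] sub(2) by auto
  have rng: "set (fst t) \<subseteq> range b" using sub(2) by auto
  have "solution orc x = enc t" unfolding solution_def solve t(1) by simp
  then have rep: "rep_graph (solution orc x) (graph_of t)"
    using rep_graph_enc[OF rng ends] by simp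
  have "fst t \<noteq> []" using grown_length[OF gr] by auto
  from max_degree_graph_of[OF this rng ends]
  have md: "real (max_degree (graph_of t)) \<le> \<rho> * real (max_degree (VT, ET)) * ratio k"
    using deg unfolding D_def by linarith
  have "covered (in_terminals x) t = card (set (filter (\<lambda>s. s \<in> set (fst t)) (in_terminals x)))"
    unfolding covered_def using terminals(2) by (simp only: distinct_card distinct_filter)
  also have "set (filter (\<lambda>s. s \<in> set (fst t)) (in_terminals x)) = set (fst t) \<inter> b ` S" using terminals(1) by auto
  also have "\<dots> \<subseteq> b ` (fst (graph_of t) \<inter> S)"
    unfolding graph_of_def by (auto intro!: imageI IntI) (force intro: image_eqI)
  then have "card (set (fst t) \<inter> b ` S) \<le> card (b ` (fst (graph_of t) \<inter> S))"
    by (rule card_mono[rotated]) (simp add: graph_of_def)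
  also have "\<dots> \<le> card (fst (graph_of t) \<inter> S)" by (rule card_image_le) (simp add: graph_of_def)
  finally have "k \<le> card (fst (graph_of t) \<inter> S)" using cov by linarith
  then show ?thesis using sub(1) rep md by blast
qed

end

section \<open>Transfer of the approximation algorithm\<close>

lemma computes_deterministic: "computes c x t y \<Longrightarrow> computes c x t' y' \<Longrightarrow> y' = y"
  unfolding computes_def using exec_deterministic by metis

lemma opt_attained:
  assumes "feas P i \<noteq> {}"
  obtains s where "s \<in> feas P i" "cost P s = opt P i"
proof -
  have "Inf (cost P ` feas P i) \<in> cost P ` feas P i" using assms by (intro Inf_nat_def1) simp
  then show ?thesis using that unfolding opt_def by (metis imageE)
qed

lemma opt_le: "s \<in> feas P i \<Longrightarrow> opt P i \<le> cost P s"
  unfolding opt_def by (rule cINF_lower) simp_all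

theorem theorem1:
  shows "\<exists>f :: nat \<Rightarrow> real. f \<in> O(\<lambda>k. ln (real k)) \<and>
    (\<forall>\<rho> :: nat \<Rightarrow> real. (\<forall>n. 1 \<le> \<rho> n) \<longrightarrow>
      poly_time_approximable group_steiner_tree (\<lambda>((V, E), \<S>). \<rho> (card V)) \<longrightarrow>
      poly_time_approximable steiner_k_tree (\<lambda>((V, E), S, k). \<rho> (card V) * f k))"
proof (intro exI[of _ ratio] conjI allI impI)
  show "ratio \<in> O(\<lambda>k. ln (real k))" by (rule ratio_bigo)
  fix \<rho> :: "nat \<Rightarrow> real"
  assume \<rho>: "\<forall>n. 1 \<le> \<rho> n"
    and "poly_time_approximable group_steiner_tree (\<lambda>((V, E), \<S>). \<rho> (card V))"
  then obtain c p where c: "\<And>V E \<S> z. inst group_steiner_tree ((V, E), \<S>) \<Longrightarrow> in_rep group_steiner_tree z ((V, E), \<S>) \<Longrightarrow>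
      \<exists>t y. computes c z t y \<and> t \<le> poly p (dsize z) \<and> (feas group_steiner_tree ((V, E), \<S>) \<noteq> {} \<longrightarrow>
        (\<exists>T\<in>feas group_steiner_tree ((V, E), \<S>). out_rep group_steiner_tree y T \<and>
          real (cost group_steiner_tree T) \<le> \<rho> (card V) * real (opt group_steiner_tree ((V, E), \<S>))))"
    unfolding poly_time_approximable_def approx_alg_def by fastforce
  \<comment> \<open>By determinism this is the output of \<open>c\<close> wherever \<open>c\<close>
    halts; elsewhere the value is arbitrary, so polynomial time is claimed on \<open>Dom\<close>
    only.\<close>
  define orc where "orc z = (SOME y. \<exists>t. computes c z t y)" for z
  have orc_eq: "orc z = y" if "computes c z t y" for z t y
  proof -
    have "\<exists>t. computes c z t (orc z)" unfolding orc_def by (rule someI[of _ y]) (use that in blast)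
    then show ?thesis using computes_deterministic that by blast
  qed
  define Dom where "Dom = {z. \<exists>V E \<S>. inst group_steiner_tree ((V, E), \<S>) \<and> in_rep group_steiner_tree z ((V, E), \<S>)}"
  have pt_orc: "pt Dom orc"
  proof (rule pt_of_computes)
    fix z assume "z \<in> Dom"
    then obtain t y where "computes c z t y" "t \<le> poly p (dsize z)" unfolding Dom_def using c by blast
    then show "\<exists>t. computes c z t (orc z) \<and> t \<le> poly p (dsize z)" using orc_eq by auto
  qed
  define A where "A = {x. \<exists>V E S k. inst steiner_k_tree ((V, E), S, k) \<and> in_rep steiner_k_tree x ((V, E), S, k)}"
  have "gst_input x r S' F \<in> Dom" if xA: "x \<in> A" for x r S' F
  proof -
    obtain V E where G: "simple_graph (V, E)" "rep_graph (dfst x) (V, E)"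
      using xA unfolding A_def steiner_k_tree_def by auto
    have V: "set (in_vertices x) = enc_nat ` V"
      using G(2) unfolding rep_graph_def in_vertices_def rep_set_nat by auto
    define groups where "groups = map (filter (\<lambda>s. s \<in> set (in_vertices x))) ([r] # map (\<lambda>g. concat (map (\<lambda>i. first (drop i S')) g)) F)"
    have gV: "set g \<subseteq> enc_nat ` V" if g: "g \<in> set groups" for g
    proof -
      obtain g' where "g = filter (\<lambda>s. s \<in> set (in_vertices x)) g'" using g unfolding groups_def set_map by blast
      then show ?thesis using V by auto
    qed
    have "rep_set (rep_set rep_nat) (enc groups) ((\<lambda>g. dec ` set g) ` set groups)"
      using gV by (rule rep_groups)
    moreover have "B \<subseteq> V" if "B \<in> (\<lambda>g. dec ` set g) ` set groups" for B using that gV by fastforce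
    ultimately have "inst group_steiner_tree ((V, E), (\<lambda>g. dec ` set g) ` set groups)"
      "in_rep group_steiner_tree (gst_input x r S' F) ((V, E), (\<lambda>g. dec ` set g) ` set groups)"
      using G unfolding group_steiner_tree_def gst_input_def groups_def[symmetric] by auto
    then show ?thesis unfolding Dom_def by blast
  qed
  from pt_solution[OF pt_orc this] have "pt A (solution orc)" by blast
  from computes_of_pt[OF this] obtain c' p' where
    c': "\<And>x. x \<in> A \<Longrightarrow> \<exists>t. computes c' x t (solution orc x) \<and> t \<le> poly p' (dsize x)" by blast
  have "approx_alg steiner_k_tree (\<lambda>((V, E), S, k). \<rho> (card V) * ratio k) c'"
    unfolding approx_alg_def
  proof (intro exI[of _ p'] allI impI)
    fix i :: "graph \<times> nat set \<times> nat" and x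
    assume i: "inst steiner_k_tree i" "in_rep steiner_k_tree x i"
    obtain V E S k where ieq: "i = ((V, E), S, k)" by (metis prod.collapse)
    have xA: "x \<in> A" unfolding A_def using i unfolding ieq by blast
    obtain t where t: "computes c' x t (solution orc x)" "t \<le> poly p' (dsize x)" using c'[OF xA] by blast
    have I: "simple_graph (V, E)" "S \<subseteq> V" "1 \<le> k" "rep_graph (dfst x) (V, E)" "rep_set rep_nat (dfst (dsnd x)) S"
      "dsnd (dsnd x) = enc_nat k"
      using i unfolding ieq steiner_k_tree_def by (auto simp: rep_nat_def)
    have "\<exists>s\<in>feas steiner_k_tree i. out_rep steiner_k_tree (solution orc x) s \<and>
        real (cost steiner_k_tree s) \<le> \<rho> (card V) * ratio k * real (opt steiner_k_tree i)"
      if ne: "feas steiner_k_tree i \<noteq> {}"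
    proof -
      obtain T where Topt: "T \<in> feas steiner_k_tree i" "cost steiner_k_tree T = opt steiner_k_tree i"
        using opt_attained[OF ne] .
      obtain VT ET where Teq: "T = (VT, ET)" by (cases T)
      have T: "(VT, ET) \<in> subtrees (V, E)" "k \<le> card (VT \<inter> S)" "max_degree (VT, ET) = opt steiner_k_tree i"
        using Topt unfolding Teq ieq steiner_k_tree_def by auto
      have "steiner_instance V E S k x orc (\<rho> (card V)) VT ET"
      proof
        fix z \<S>
        assume z: "rep_set (rep_set rep_nat) z \<S>" "finite \<S>" "\<And>B. B \<in> \<S> \<Longrightarrow> B \<subseteq> V" "\<And>B. B \<in> \<S> \<Longrightarrow> VT \<inter> B \<noteq> {}"
        \<comment> \<open>The query keeps the graph, so the ratio is evaluated at the same
          \<open>card V\<close>.\<close>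
        let ?z = "Pr (dfst x) z" and ?i = "((V, E), \<S>)"
        have inst: "inst group_steiner_tree ?i" "in_rep group_steiner_tree ?z ?i"
          using I z unfolding group_steiner_tree_def by auto
        have feas: "(VT, ET) \<in> feas group_steiner_tree ?i" using T(1) z(4) unfolding group_steiner_tree_def by auto
        obtain t y T' where y: "computes c ?z t y" "T' \<in> feas group_steiner_tree ?i" "out_rep group_steiner_tree y T'"
          "real (cost group_steiner_tree T') \<le> \<rho> (card V) * real (opt group_steiner_tree ?i)"
          using c[OF inst] feas by blast
        \<comment> \<open>The optimal tree hits all groups of this query and is therefore feasible
          for the group instance.\<close>
        have "opt group_steiner_tree ?i \<le> max_degree (VT, ET)"
          using opt_le[OF feas] unfolding group_steiner_tree_def by simp
        then have "\<rho> (card V) * real (opt group_steiner_tree ?i) \<le> \<rho> (card V) * real (max_degree (VT, ET))"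
          using \<rho> by (intro mult_left_mono) (auto intro: order_trans[of 0 1])
        then show "\<exists>T\<in>subtrees (V, E). (\<forall>B\<in>\<S>. fst T \<inter> B \<noteq> {}) \<and> rep_graph (orc ?z) T \<and>
            real (max_degree T) \<le> \<rho> (card V) * real (max_degree (VT, ET))"
          using y(2,3,4) orc_eq[OF y(1)] unfolding group_steiner_tree_def by (intro bexI[of _ T']) auto
      qed (use I T \<rho> in \<open>auto intro: order_trans[of 0 1]\<close>)
      from steiner_instance.solution_correct[OF this]
      obtain T' where T': "T' \<in> subtrees (V, E)" "k \<le> card (fst T' \<inter> S)" "rep_graph (solution orc x) T'"
        "real (max_degree T') \<le> \<rho> (card V) * real (opt steiner_k_tree i) * ratio k"
        unfolding T(3) by blast
      have cost: "cost steiner_k_tree = max_degree" "out_rep steiner_k_tree = rep_graph"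
        by (simp_all add: steiner_k_tree_def)
      have "T' \<in> feas steiner_k_tree i" using T'(1,2) unfolding ieq steiner_k_tree_def by simp
      moreover have "real (max_degree T') \<le> \<rho> (card V) * ratio k * real (opt steiner_k_tree i)"
        using T'(4) by (simp only: mult.assoc mult.commute[of "ratio k"])
      ultimately show ?thesis using T'(3) unfolding cost by blast
    qed
    then show "\<exists>t y. computes c' x t y \<and> t \<le> poly p' (dsize x) \<and> (feas steiner_k_tree i \<noteq> {} \<longrightarrow>
        (\<exists>s\<in>feas steiner_k_tree i. out_rep steiner_k_tree y s \<and>
          real (cost steiner_k_tree s) \<le> (case i of (xa, xb) \<Rightarrow> (case xa of (V, E) \<Rightarrow> \<lambda>(S, k). \<rho> (card V) * ratio k) xb) * real (opt steiner_k_tree i)))"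
      using t unfolding ieq by auto
  qed
  then show "poly_time_approximable steiner_k_tree (\<lambda>((V, E), S, k). \<rho> (card V) * ratio k)"
    unfolding poly_time_approximable_def by blast
qed

end
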